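(* Let $m\ge2$ and $d\ge1$ be integers. The Lie algebra $$\mathfrak{u}C\ell^{\frac1m}_d:=\{U\in C\ell^{\frac1m}_d:\ \overline{U}=-U\}$$ (with the commutator bracket) is the Lie algebra of the Lie group ${\rm U}C\ell^{\frac1m}_d:=\{U\in C\ell^{\frac1m}_d:\ \overline{U}U=e\}$, and it is isomorphic to the classical matrix unitary Lie algebra $$\mathfrak{u}C\ell^{\frac1m}_d\simeq\begin{cases}\mathfrak{u}(m^{\frac d2}),&\text{if } d \text{ is even};\\ \underbrace{\mathfrak{u}(m^{\frac{d-1}2})\oplus\mathfrak{u}(m^{\frac{d-1}2})\oplus\cdots\oplus\mathfrak{u}(m^{\frac{d-1}2})}_{m\ \text{times}},&\text{if } d\text{ is odd},\end{cases}$$ where $\mathfrak{u}(n)=\{A\in{\rm Mat}(n,\mathbb{C}):A^{\rm H}=-A\}$.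
   Context: The generalized Clifford algebra $C\ell^{\frac1m}_d$ is the unital associative algebra over $\mathbb{C}$ with identity $e$ and generators $e_1,\dots,e_d$ subject to $e_j^m=e$ for $j=1,\dots,d$ and $e_ke_l=\omega e_le_k$ for $k<l$, where $\omega:=e^{2\pi i/m}$. It has dimension $m^d$ with basis $e_1^{j_1}\cdots e_d^{j_d}$, $0\le j_1,\dots,j_d\le m-1$ (each basis element is invertible), so each element is uniquely $U=\sum_{j_1,\dots,j_d=0}^{m-1}u_{j_1\ldots j_d}e_1^{j_1}\cdots e_d^{j_d}$ with $u_{j_1\ldots j_d}\in\mathbb{C}$. Hermitian conjugation: $\overline{U}:=\sum_{j_1,\dots,j_d=0}^{m-1}\overline{u_{j_1\ldots j_d}}\,(e_1^{j_1}\cdots e_d^{j_d})^{-1}$, where $\overline{u}$ is complex conjugation for $u\in\mathbb{C}$. *)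

theory Defs
  imports
    "HOL-Analysis.Analysis"
    "HOL-Algebra.QuotRing"
    "Jordan_Normal_Form.VS_Connect"
    "Jordan_Normal_Form.Schur_Decomposition"
begin

section \<open>Generalized Clifford algebras by generators and relations\<close>

text \<open>The free unital associative complex algebra on letters \<open>1, ..., d\<close>: finitely supported
  complex functions on words over these letters, multiplied by convolution along concatenation.\<close>

definition free_algebra :: "nat \<Rightarrow> (complex, nat list \<Rightarrow> complex) module" where
  "free_algebra d =
    \<lparr>carrier = {f. finite {w. f w \<noteq> 0} \<and> {w. f w \<noteq> 0} \<subseteq> lists {1..d}},
     monoid.mult = (\<lambda>f g w. \<Sum>k\<le>length w. f (take k w) * g (drop k w)),
     one = (\<lambda>w. if w = [] then 1 else 0),
     zero = (\<lambda>w. 0),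
     add = (\<lambda>f g w. f w + g w),
     smult = (\<lambda>c f w. c * f w)\<rparr>"

definition free_gen :: "nat \<Rightarrow> nat list \<Rightarrow> complex" where
  "free_gen j = (\<lambda>w. if w = [j] then 1 else 0)"

definition root_omega :: "nat \<Rightarrow> complex" where
  "root_omega m = exp (2 * of_real pi * \<i> / of_nat m)"

definition gcliff_relations :: "nat \<Rightarrow> nat \<Rightarrow> (nat list \<Rightarrow> complex) set" where
  "gcliff_relations m d = (let F = free_algebra d; x = free_gen in
     {x j [^]\<^bsub>F\<^esub> m \<ominus>\<^bsub>F\<^esub> \<one>\<^bsub>F\<^esub> | j. j \<in> {1..d}} \<union>
     {x k \<otimes>\<^bsub>F\<^esub> x l \<ominus>\<^bsub>F\<^esub> root_omega m \<odot>\<^bsub>F\<^esub> (x l \<otimes>\<^bsub>F\<^esub> x k) | k l. 1 \<le> k \<and> k < l \<and> l \<le> d})"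

definition gcliff_ideal :: "nat \<Rightarrow> nat \<Rightarrow> (nat list \<Rightarrow> complex) set" where
  "gcliff_ideal m d = Idl\<^bsub>free_algebra d\<^esub> (gcliff_relations m d)"

definition gcliff_class :: "nat \<Rightarrow> nat \<Rightarrow> (nat list \<Rightarrow> complex) \<Rightarrow> (nat list \<Rightarrow> complex) set" where
  "gcliff_class m d f = gcliff_ideal m d +>\<^bsub>free_algebra d\<^esub> f"

text \<open>The quotient by the two-sided ideal of relations; a scalar \<open>c\<close> acts as multiplication by
  the class of \<open>c\<close> times the identity.\<close>

definition gcliff :: "nat \<Rightarrow> nat \<Rightarrow> (complex, (nat list \<Rightarrow> complex) set) module" where
  "gcliff m d = (let F = free_algebra d; Q = F Quot gcliff_ideal m d in
    \<lparr>carrier = carrier Q, monoid.mult = monoid.mult Q, one = one Q, zero = zero Q, add = add Q,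
     smult = (\<lambda>c U. gcliff_class m d (c \<odot>\<^bsub>F\<^esub> \<one>\<^bsub>F\<^esub>) \<otimes>\<^bsub>Q\<^esub> U)\<rparr>)"

definition gcliff_gen :: "nat \<Rightarrow> nat \<Rightarrow> nat \<Rightarrow> (nat list \<Rightarrow> complex) set" where
  "gcliff_gen m d j = gcliff_class m d (free_gen j)"

definition multi_indices :: "nat \<Rightarrow> nat \<Rightarrow> (nat \<Rightarrow> nat) set" where
  "multi_indices m d = {1..d} \<rightarrow>\<^sub>E {0..<m}"

text \<open>The product of the powers \<open>e\<^sub>k\<close> to the \<open>J k\<close>, taken in the order \<open>k = 1, ..., d\<close>.\<close>

definition gcliff_monomial :: "nat \<Rightarrow> nat \<Rightarrow> (nat \<Rightarrow> nat) \<Rightarrow> (nat list \<Rightarrow> complex) set" where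
  "gcliff_monomial m d J =
     foldr (\<lambda>k U. (gcliff_gen m d k [^]\<^bsub>gcliff m d\<^esub> J k) \<otimes>\<^bsub>gcliff m d\<^esub> U) [1..<Suc d] \<one>\<^bsub>gcliff m d\<^esub>"

definition gcliff_coeff :: "nat \<Rightarrow> nat \<Rightarrow> (nat list \<Rightarrow> complex) set \<Rightarrow> (nat \<Rightarrow> nat) \<Rightarrow> complex" where
  "gcliff_coeff m d U = (THE u. u \<in> multi_indices m d \<rightarrow>\<^sub>E UNIV \<and>
     U = (\<Oplus>\<^bsub>gcliff m d\<^esub>J\<in>multi_indices m d. u J \<odot>\<^bsub>gcliff m d\<^esub> gcliff_monomial m d J))"

definition gcliff_conj :: "nat \<Rightarrow> nat \<Rightarrow> (nat list \<Rightarrow> complex) set \<Rightarrow> (nat list \<Rightarrow> complex) set" where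
  "gcliff_conj m d U = (\<Oplus>\<^bsub>gcliff m d\<^esub>J\<in>multi_indices m d.
     cnj (gcliff_coeff m d U J) \<odot>\<^bsub>gcliff m d\<^esub> inv\<^bsub>gcliff m d\<^esub> (gcliff_monomial m d J))"

definition UCl :: "nat \<Rightarrow> nat \<Rightarrow> (nat list \<Rightarrow> complex) set set" where
  "UCl m d = {U \<in> carrier (gcliff m d). gcliff_conj m d U \<otimes>\<^bsub>gcliff m d\<^esub> U = \<one>\<^bsub>gcliff m d\<^esub>}"


section \<open>Smooth maps, submanifolds and Lie groups inside a topologized real vector space\<close>

text \<open>Real vector spaces and algebras with a topology, used below only in finite dimension and with
  the usual topology.\<close>

record 'a topological_module = "(real, 'a) module" +
  topo :: "'a topology"

definition real_line :: "real topological_module" where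
  "real_line = \<lparr>carrier = UNIV, monoid.mult = (*), one = 1, zero = 0, add = (+), smult = (*),
     topo = euclidean\<rparr>"

definition prod_module :: "('a, 'x) topological_module_scheme \<Rightarrow> ('b, 'y) topological_module_scheme
    \<Rightarrow> ('a \<times> 'b) topological_module" where
  "prod_module D E =
    \<lparr>carrier = carrier D \<times> carrier E,
     monoid.mult = (\<lambda>(x, y) (x', y'). (x \<otimes>\<^bsub>D\<^esub> x', y \<otimes>\<^bsub>E\<^esub> y')),
     one = (\<one>\<^bsub>D\<^esub>, \<one>\<^bsub>E\<^esub>),
     zero = (\<zero>\<^bsub>D\<^esub>, \<zero>\<^bsub>E\<^esub>),
     add = (\<lambda>(x, y) (x', y'). (x \<oplus>\<^bsub>D\<^esub> x', y \<oplus>\<^bsub>E\<^esub> y')),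
     smult = (\<lambda>r (x, y). (r \<odot>\<^bsub>D\<^esub> x, r \<odot>\<^bsub>E\<^esub> y)),
     topo = prod_topology (topo D) (topo E)\<rparr>"

text \<open>\<open>l\<close> is the derivative of \<open>f\<close> at \<open>x\<close> in the direction \<open>v\<close>.\<close>

definition has_dir_deriv ::
  "('a, 'x) topological_module_scheme \<Rightarrow> ('b, 'y) topological_module_scheme
    \<Rightarrow> ('a \<Rightarrow> 'b) \<Rightarrow> 'a \<Rightarrow> 'a \<Rightarrow> 'b \<Rightarrow> bool" where
  "has_dir_deriv D E f x v l \<longleftrightarrow>
     limitin (topo E) (\<lambda>t::real. (1 / t) \<odot>\<^bsub>E\<^esub> (f (x \<oplus>\<^bsub>D\<^esub> t \<odot>\<^bsub>D\<^esub> v) \<ominus>\<^bsub>E\<^esub> f x)) l (at 0)"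

text \<open>Being \<open>C\<^sup>\<infinity>\<close> on an open set \<open>S\<close> of a finite-dimensional space: all iterated directional
  derivatives exist and are continuous.\<close>

coinductive smooth_on_open ::
  "('a, 'x) topological_module_scheme \<Rightarrow> ('b, 'y) topological_module_scheme
    \<Rightarrow> 'a set \<Rightarrow> ('a \<Rightarrow> 'b) \<Rightarrow> bool"
  for D E S where
  "\<lbrakk>continuous_map (subtopology (topo D) S) (topo E) f;
    \<And>v. v \<in> carrier D \<Longrightarrow>
      \<exists>g. smooth_on_open D E S g \<and> (\<forall>x\<in>S. has_dir_deriv D E f x v (g x))\<rbrakk>
   \<Longrightarrow> smooth_on_open D E S f"

text \<open>Smoothness on an arbitrary subset: locally the restriction of a smooth map defined on an
  open subset of the ambient space.\<close>

definition smooth_map_on ::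
  "('a, 'x) topological_module_scheme \<Rightarrow> ('b, 'y) topological_module_scheme
    \<Rightarrow> 'a set \<Rightarrow> ('a \<Rightarrow> 'b) \<Rightarrow> bool" where
  "smooth_map_on D E S f \<longleftrightarrow>
     (\<forall>p\<in>S. \<exists>N F. openin (topo D) N \<and> p \<in> N \<and> smooth_on_open D E N F \<and> (\<forall>x\<in>S \<inter> N. F x = f x))"

text \<open>\<open>M\<close> is covered by relatively open sets that are diffeomorphic to relatively open subsets of a
  fixed linear subspace \<open>W\<close> (so the dimension of \<open>M\<close> is that of \<open>W\<close>).\<close>

definition smooth_submanifold :: "('a, 'x) topological_module_scheme \<Rightarrow> 'a set \<Rightarrow> bool" where
  "smooth_submanifold E M \<longleftrightarrow> M \<subseteq> carrier E \<and>
     (\<exists>W. Module.submodule W (class_ring :: real ring) E \<and>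
       (\<forall>p\<in>M. \<exists>P Q \<phi> \<psi>. p \<in> P \<and>
          openin (subtopology (topo E) M) P \<and> openin (subtopology (topo E) W) Q \<and>
          bij_betw \<phi> P Q \<and> (\<forall>x\<in>P. \<psi> (\<phi> x) = x) \<and>
          smooth_map_on E E P \<phi> \<and> smooth_map_on E E Q \<psi>))"

text \<open>A Lie group realized inside the group of units of the algebra \<open>A\<close>.\<close>

definition lie_group_in :: "('a, 'x) topological_module_scheme \<Rightarrow> 'a set \<Rightarrow> bool" where
  "lie_group_in A G \<longleftrightarrow>
     subgroup G (units_of A) \<and> smooth_submanifold A G \<and>
     smooth_map_on (prod_module A A) A (G \<times> G) (\<lambda>(x, y). x \<otimes>\<^bsub>A\<^esub> y) \<and>
     smooth_map_on A A G (\<lambda>x. inv\<^bsub>A\<^esub> x)"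

text \<open>\<open>\<gamma>\<close> is a smooth curve in \<open>M\<close> defined near \<open>0\<close>, with \<open>\<gamma> 0 = p\<close> and velocity \<open>X\<close> at \<open>0\<close>.\<close>

definition smooth_curve_in ::
  "('a, 'x) topological_module_scheme \<Rightarrow> 'a set \<Rightarrow> 'a \<Rightarrow> 'a \<Rightarrow> (real \<Rightarrow> 'a) \<Rightarrow> bool" where
  "smooth_curve_in E M p X \<gamma> \<longleftrightarrow>
     (\<exists>\<epsilon>>0. \<gamma> ` {-\<epsilon><..<\<epsilon>} \<subseteq> M \<and> smooth_map_on real_line E {-\<epsilon><..<\<epsilon>} \<gamma>) \<and>
     \<gamma> 0 = p \<and> has_dir_deriv real_line E \<gamma> 0 1 X"

definition tangent_vectors :: "('a, 'x) topological_module_scheme \<Rightarrow> 'a set \<Rightarrow> 'a \<Rightarrow> 'a set" where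
  "tangent_vectors E M p = {X. \<exists>\<gamma>. smooth_curve_in E M p X \<gamma>}"


section \<open>Real Lie algebras\<close>

text \<open>The fields \<open>mult\<close> and \<open>one\<close> inherited from \<open>ring\<close> play no role and are left undefined.\<close>

record 'a lie_algebra = "(real, 'a) module" +
  bracket :: "'a \<Rightarrow> 'a \<Rightarrow> 'a"

definition real_lie_algebra :: "('a, 'x) lie_algebra_scheme \<Rightarrow> bool" where
  "real_lie_algebra L \<longleftrightarrow>
     Module.module (class_ring :: real ring) L \<and>
     (\<forall>X\<in>carrier L. \<forall>Y\<in>carrier L. bracket L X Y \<in> carrier L) \<and>
     (\<forall>X\<in>carrier L. \<forall>Y\<in>carrier L. \<forall>Z\<in>carrier L.
        bracket L (X \<oplus>\<^bsub>L\<^esub> Y) Z = bracket L X Z \<oplus>\<^bsub>L\<^esub> bracket L Y Z \<and>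
        bracket L Z (X \<oplus>\<^bsub>L\<^esub> Y) = bracket L Z X \<oplus>\<^bsub>L\<^esub> bracket L Z Y) \<and>
     (\<forall>r. \<forall>X\<in>carrier L. \<forall>Y\<in>carrier L.
        bracket L (r \<odot>\<^bsub>L\<^esub> X) Y = r \<odot>\<^bsub>L\<^esub> bracket L X Y \<and>
        bracket L X (r \<odot>\<^bsub>L\<^esub> Y) = r \<odot>\<^bsub>L\<^esub> bracket L X Y) \<and>
     (\<forall>X\<in>carrier L. bracket L X X = \<zero>\<^bsub>L\<^esub>) \<and>
     (\<forall>X\<in>carrier L. \<forall>Y\<in>carrier L. \<forall>Z\<in>carrier L.
        bracket L X (bracket L Y Z) \<oplus>\<^bsub>L\<^esub> bracket L Y (bracket L Z X) \<oplus>\<^bsub>L\<^esub> bracket L Z (bracket L X Y)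
          = \<zero>\<^bsub>L\<^esub>)"

definition lie_isomorphic :: "('a, 'x) lie_algebra_scheme \<Rightarrow> ('b, 'y) lie_algebra_scheme \<Rightarrow> bool" where
  "lie_isomorphic L M \<longleftrightarrow> (\<exists>\<phi>. bij_betw \<phi> (carrier L) (carrier M) \<and>
     (\<forall>X\<in>carrier L. \<forall>Y\<in>carrier L.
        \<phi> (X \<oplus>\<^bsub>L\<^esub> Y) = \<phi> X \<oplus>\<^bsub>M\<^esub> \<phi> Y \<and> \<phi> (bracket L X Y) = bracket M (\<phi> X) (\<phi> Y)) \<and>
     (\<forall>r. \<forall>X\<in>carrier L. \<phi> (r \<odot>\<^bsub>L\<^esub> X) = r \<odot>\<^bsub>M\<^esub> \<phi> X))"

text \<open>The direct sum of \<open>k\<close> copies of \<open>L\<close>, with componentwise operations.\<close>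

definition lie_power :: "nat \<Rightarrow> ('a, 'x) lie_algebra_scheme \<Rightarrow> (nat \<Rightarrow> 'a) lie_algebra" where
  "lie_power k L =
    \<lparr>carrier = {0..<k} \<rightarrow>\<^sub>E carrier L, monoid.mult = undefined, one = undefined,
     zero = (\<lambda>i\<in>{0..<k}. \<zero>\<^bsub>L\<^esub>),
     add = (\<lambda>X Y. \<lambda>i\<in>{0..<k}. X i \<oplus>\<^bsub>L\<^esub> Y i),
     smult = (\<lambda>r X. \<lambda>i\<in>{0..<k}. r \<odot>\<^bsub>L\<^esub> X i),
     bracket = (\<lambda>X Y. \<lambda>i\<in>{0..<k}. bracket L (X i) (Y i))\<rparr>"

definition u_matrix :: "nat \<Rightarrow> complex mat lie_algebra" where
  "u_matrix n =
    \<lparr>carrier = {A \<in> carrier_mat n n. mat_adjoint A = - A}, monoid.mult = undefined, one = undefined,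
     zero = 0\<^sub>m n n,
     add = (+),
     smult = (\<lambda>r A. complex_of_real r \<cdot>\<^sub>m A),
     bracket = (\<lambda>A B. A * B - B * A)\<rparr>"

text \<open>\<open>L\<close> is the Lie algebra of the Lie group \<open>G\<close> in \<open>A\<close>: its underlying real vector space is the
  tangent space of \<open>G\<close> at the identity, and its bracket is \<open>[X, Y] = ad\<^sub>X Y\<close>, where \<open>ad\<close> is the
  differential at the identity of \<open>Ad\<^sub>g Y = g Y g\<^sup>-\<^sup>1\<close>.\<close>

definition is_lie_algebra_of ::
  "('a, 'x) lie_algebra_scheme \<Rightarrow> ('a, 'y) topological_module_scheme \<Rightarrow> 'a set \<Rightarrow> bool" where
  "is_lie_algebra_of L A G \<longleftrightarrow>
     real_lie_algebra L \<and>
     carrier L = tangent_vectors A G \<one>\<^bsub>A\<^esub> \<and>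
     \<zero>\<^bsub>L\<^esub> = \<zero>\<^bsub>A\<^esub> \<and>
     (\<forall>X\<in>carrier L. \<forall>Y\<in>carrier L. X \<oplus>\<^bsub>L\<^esub> Y = X \<oplus>\<^bsub>A\<^esub> Y) \<and>
     (\<forall>r. \<forall>X\<in>carrier L. r \<odot>\<^bsub>L\<^esub> X = r \<odot>\<^bsub>A\<^esub> X) \<and>
     (\<forall>X\<in>carrier L. \<forall>Y\<in>carrier L. \<forall>\<gamma>. smooth_curve_in A G \<one>\<^bsub>A\<^esub> X \<gamma> \<longrightarrow>
        has_dir_deriv real_line A (\<lambda>t. \<gamma> t \<otimes>\<^bsub>A\<^esub> Y \<otimes>\<^bsub>A\<^esub> inv\<^bsub>A\<^esub> (\<gamma> t)) 0 1 (bracket L X Y))"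


section \<open>The generalized Clifford algebra as a real topological algebra, and its Lie algebra\<close>

text \<open>The topology is the usual one of a finite-dimensional space, read off in the coordinates with
  respect to the monomial basis.\<close>

definition gcliff_real :: "nat \<Rightarrow> nat \<Rightarrow> (nat list \<Rightarrow> complex) set topological_module" where
  "gcliff_real m d = (let A = gcliff m d in
    \<lparr>carrier = carrier A, monoid.mult = monoid.mult A, one = one A, zero = zero A, add = add A,
     smult = (\<lambda>r U. complex_of_real r \<odot>\<^bsub>A\<^esub> U),
     topo = pullback_topology (carrier A) (gcliff_coeff m d) euclidean\<rparr>)"

definition uCl :: "nat \<Rightarrow> nat \<Rightarrow> (nat list \<Rightarrow> complex) set lie_algebra" where
  "uCl m d = (let A = gcliff m d in
    \<lparr>carrier = {U \<in> carrier A. gcliff_conj m d U = \<ominus>\<^bsub>A\<^esub> U},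
     monoid.mult = undefined, one = undefined,
     zero = zero A,
     add = add A,
     smult = (\<lambda>r U. complex_of_real r \<odot>\<^bsub>A\<^esub> U),
     bracket = (\<lambda>U V. U \<otimes>\<^bsub>A\<^esub> V \<ominus>\<^bsub>A\<^esub> V \<otimes>\<^bsub>A\<^esub> U)\<rparr>)"

end

theory Submission
  imports Defs
begin

text \<open>The monomials span the algebra, because generators can be moved past each other at the cost of
  a power of \<open>\<omega>\<close>. Kronecker products of clock and shift matrices yield \<open>d\<close> unitary matrices of size
  \<open>m\<close> to the \<open>d div 2\<close> that satisfy the defining relations; for odd \<open>d\<close>, multiplying the last of them
  by the \<open>m\<close>-th roots of unity yields \<open>m\<close> representations. Conjugation by a generator multiplies a
  monomial by a phase; these phases (for odd \<open>d\<close> together with the roots of unity above) separate the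
  monomials, so their images are orthogonal for the sum of the trace forms. Counting dimensions, the
  representations together identify the algebra with one or \<open>m\<close> copies of a full matrix algebra. As
  the images of monomials are unitary, Hermitian conjugation becomes the matrix adjoint.

  The Cayley transform \<open>x \<mapsto> 2 (1 + x)\<^sup>-\<^sup>1 - 1\<close> is an involution that exchanges the skew elements
  with the unitary elements \<open>u\<close> for which \<open>1 + u\<close> is invertible. It is rational,
  hence gives smooth charts of the unitary group and smooth curves with any prescribed skew velocity;
  conversely, differentiating \<open>\<gamma>\<^sup>* \<gamma> = 1\<close> shows that velocities are skew.\<close>

text \<open>In a quotient by an ideal the independence of the monomials is invisible, and
  \<open>gcliff_coeff\<close>, hence also \<open>gcliff_conj\<close>, is a definite description that
  says nothing before independence is known. So only spanning is proved inside the quotient.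
  Independence, a formula for the coefficients and surjectivity all come from one matrix
  \<open>Q\<close>, whose rows are the images of the monomials; it is square, so orthogonal rows
  force orthogonal columns. One representation cannot suffice for odd d: there e_1 e_2^(-1) e_3 ...
  e_d commutes with every generator, so conjugations do not tell its powers apart. Multiplying e_d
  by the m-th roots of unity gives this element m different scalar values, one in each block. The
  group side lives in an abstract star algebra. The Cayley transform replaces the exponential
  because it needs only sums, products and inverses: maps built from these are closed under
  differentiation, and no power series enters. As 1 + x is invertible for every skew x, each chart
  maps onto the whole skew space.\<close>

lemma atin_euclidean: "atin euclidean x = at x"
  by (simp add: atin_def nhdsin_def at_within_def nhds_def Compl_eq_Diff_UNIV)

section \<open>Topological star algebras and their unitary groups\<close>

text \<open>These assumptions are what the argument needs of finite dimension. Open units with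
  continuous inversion make rational expressions smooth on open sets,
  \<open>left_unitary_imp_right\<close> makes \<open>star\<close> the inverse on unitaries, and
  \<open>one_plus_skew_Units\<close> puts every skew element into the domain of the Cayley
  transform.\<close>

locale topological_star_algebra = ring A
  for A :: "('a, 'x) topological_module_scheme" (structure) +
  fixes star :: "'a \<Rightarrow> 'a"
  assumes smult_closed [simp, intro]: "x \<in> carrier A \<Longrightarrow> (r::real) \<odot> x \<in> carrier A"
    and smult_add_left: "x \<in> carrier A \<Longrightarrow> (r + s) \<odot> x = r \<odot> x \<oplus> s \<odot> x"
    and smult_add_right:
      "\<lbrakk>x \<in> carrier A; y \<in> carrier A\<rbrakk> \<Longrightarrow> r \<odot> (x \<oplus> y) = r \<odot> x \<oplus> r \<odot> y"
    and smult_smult: "x \<in> carrier A \<Longrightarrow> r \<odot> (s \<odot> x) = (r * s) \<odot> x"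
    and smult_one [simp]: "x \<in> carrier A \<Longrightarrow> 1 \<odot> x = x"
    and smult_mult_left:
      "\<lbrakk>x \<in> carrier A; y \<in> carrier A\<rbrakk> \<Longrightarrow> (r \<odot> x) \<otimes> y = r \<odot> (x \<otimes> y)"
    and smult_mult_right:
      "\<lbrakk>x \<in> carrier A; y \<in> carrier A\<rbrakk> \<Longrightarrow> x \<otimes> (r \<odot> y) = r \<odot> (x \<otimes> y)"
    and topspace_topo [simp]: "topspace (topo A) = carrier A"
    and Hausdorff: "Hausdorff_space (topo A)"
    and continuous_add:
      "continuous_map (prod_topology (topo A) (topo A)) (topo A) (\<lambda>(x, y). x \<oplus> y)"
    and continuous_mult:
      "continuous_map (prod_topology (topo A) (topo A)) (topo A) (\<lambda>(x, y). x \<otimes> y)"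
    and continuous_smult:
      "continuous_map (prod_topology euclideanreal (topo A)) (topo A) (\<lambda>(r, x). r \<odot> x)"
    and openin_Units: "openin (topo A) (Units A)"
    and continuous_inv: "continuous_map (subtopology (topo A) (Units A)) (topo A) (\<lambda>x. inv x)"
    and continuous_star: "continuous_map (topo A) (topo A) star"
    and star_closed [simp, intro]: "x \<in> carrier A \<Longrightarrow> star x \<in> carrier A"
    and star_add: "\<lbrakk>x \<in> carrier A; y \<in> carrier A\<rbrakk> \<Longrightarrow> star (x \<oplus> y) = star x \<oplus> star y"
    and star_smult: "x \<in> carrier A \<Longrightarrow> star (r \<odot> x) = r \<odot> star x"
    and star_mult: "\<lbrakk>x \<in> carrier A; y \<in> carrier A\<rbrakk> \<Longrightarrow> star (x \<otimes> y) = star y \<otimes> star x"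
    and star_star [simp]: "x \<in> carrier A \<Longrightarrow> star (star x) = x"
    and left_unitary_imp_right:
      "\<lbrakk>x \<in> carrier A; star x \<otimes> x = \<one>\<rbrakk> \<Longrightarrow> x \<otimes> star x = \<one>"
    and one_plus_skew_Units: "\<lbrakk>x \<in> carrier A; star x = \<ominus> x\<rbrakk> \<Longrightarrow> \<one> \<oplus> x \<in> Units A"
begin

definition unitaries :: "'a set" where
  "unitaries = {x \<in> carrier A. star x \<otimes> x = \<one>}"

definition skews :: "'a set" where
  "skews = {x \<in> carrier A. star x = \<ominus> x}"

lemma smult_zero_left [simp]: "x \<in> carrier A \<Longrightarrow> 0 \<odot> x = \<zero>"
  using smult_add_left[of x 0 0] by (metis add.l_cancel_one' add_0 smult_closed)

lemma smult_zero_right [simp]: "r \<odot> \<zero> = \<zero>"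
  using smult_add_right[of \<zero> \<zero> r] by (metis add.l_cancel_one' l_zero smult_closed zero_closed)

lemma smult_minus_one: "x \<in> carrier A \<Longrightarrow> (-1) \<odot> x = \<ominus> x"
  using smult_add_left[of x "-1" 1] by (metis add.inv_equality add.left_inverse smult_closed smult_one smult_zero_left)

lemma smult_minus: "x \<in> carrier A \<Longrightarrow> r \<odot> (\<ominus> x) = \<ominus> (r \<odot> x)"
  by (metis mult.commute smult_closed smult_minus_one smult_smult)

lemma smult_two: "x \<in> carrier A \<Longrightarrow> 2 \<odot> x = x \<oplus> x" using smult_add_left[of x 1 1] by simp

lemma add_diff_cancel: "\<lbrakk>x \<in> carrier A; y \<in> carrier A\<rbrakk> \<Longrightarrow> x \<oplus> (y \<ominus> x) = y"
  by (metis a_comm a_minus_def add.inv_closed r_neg2)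

text \<open>The product expands to p q - p - q + 1. With p = 2 b* and q = 2 b this is the test for
  unitarity of 2 b - 1, the shape of a Cayley transform.\<close>

lemma diff_one_mult_diff_one:
  assumes "p \<in> carrier A" "q \<in> carrier A" "p \<otimes> q = p \<oplus> q"
  shows "(p \<ominus> \<one>) \<otimes> (q \<ominus> \<one>) = \<one>"
proof -
  have "(p \<ominus> \<one>) \<otimes> (q \<ominus> \<one>) = (p \<oplus> q) \<oplus> (\<one> \<ominus> p) \<ominus> q"
    using assms by (simp add: a_minus_def l_distr r_distr l_minus r_minus minus_add a_ac)
  also have "\<dots> = \<one>" using assms by (simp add: a_assoc a_comm[of p q] add_diff_cancel)
      (simp add: a_minus_def a_comm[of q \<one>] a_assoc r_neg)
  finally show ?thesis .
qed

lemma star_minus: "x \<in> carrier A \<Longrightarrow> star (\<ominus> x) = \<ominus> star x"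
  by (metis smult_minus_one star_closed star_smult)

lemma star_diff: "\<lbrakk>x \<in> carrier A; y \<in> carrier A\<rbrakk> \<Longrightarrow> star (x \<ominus> y) = star x \<ominus> star y"
  by (simp add: a_minus_def star_add star_minus)

lemma star_one [simp]: "star \<one> = \<one>"
  by (metis l_one one_closed r_one star_closed star_mult star_star)

lemma star_zero [simp]: "star \<zero> = \<zero>" by (metis smult_zero_left star_closed star_smult zero_closed)

lemma real_module: "Module.module (class_ring :: real ring) A"
proof -
  have "cring (class_ring :: real ring)"
    by unfold_locales (auto simp: class_ring_simps Units_def algebra_simps intro: exI[of _ "- _"])
  then show ?thesis by (intro Module.module.intro abelian_group_axioms Module.module_axioms.intro)
      (auto simp: class_ring_simps smult_add_left smult_add_right smult_smult)
qed

lemma skews_minus: "x \<in> skews \<Longrightarrow> \<ominus> x \<in> skews" by (auto simp: skews_def star_minus)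

lemma skews_smult: "x \<in> skews \<Longrightarrow> r \<odot> x \<in> skews" by (auto simp: skews_def star_smult smult_minus)

lemma skews_add: "x \<in> skews \<Longrightarrow> y \<in> skews \<Longrightarrow> x \<oplus> y \<in> skews"
  by (auto simp: skews_def star_add minus_add)

lemma skews_carrier: "x \<in> skews \<Longrightarrow> x \<in> carrier A" by (simp add: skews_def)

lemma submodule_skews: "Module.submodule skews (class_ring :: real ring) A"
proof -
  interpret M: Module.module "class_ring :: real ring" A by (rule real_module)
  show ?thesis by (rule M.submoduleI)
      (auto simp: skews_carrier skews_minus skews_add skews_smult, simp add: skews_def)
qed

lemma unitary_Units:
  assumes "x \<in> unitaries" shows "x \<in> Units A" "inv x = star x"
proof -
  have x: "x \<in> carrier A" "star x \<otimes> x = \<one>" "x \<otimes> star x = \<one>"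
    using assms left_unitary_imp_right by (auto simp: unitaries_def)
  then show "x \<in> Units A" by (auto simp: Units_def)
  show "inv x = star x" using x by (metis inv_unique' star_closed)
qed

lemma unitary_carrier: "x \<in> unitaries \<Longrightarrow> x \<in> carrier A" by (simp add: unitaries_def)

lemma unitary_mult: "\<lbrakk>x \<in> unitaries; y \<in> unitaries\<rbrakk> \<Longrightarrow> x \<otimes> y \<in> unitaries"
proof -
  assume xy: "x \<in> unitaries" "y \<in> unitaries"
  then have c: "x \<in> carrier A" "y \<in> carrier A" by (auto simp: unitaries_def)
  have "star (x \<otimes> y) \<otimes> (x \<otimes> y) = star y \<otimes> ((star x \<otimes> x) \<otimes> y)"
    using c by (simp add: star_mult m_assoc)
  also have "\<dots> = \<one>" using xy by (simp add: unitaries_def)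
  finally show ?thesis using c by (simp add: unitaries_def)
qed

lemma unitary_star: "x \<in> unitaries \<Longrightarrow> star x \<in> unitaries"
  using left_unitary_imp_right by (simp add: unitaries_def)

lemma one_unitary: "\<one> \<in> unitaries" by (simp add: unitaries_def)

lemma subgroup_unitaries: "subgroup unitaries (units_of A)"
proof
  show "unitaries \<subseteq> carrier (units_of A)" by (auto simp: units_of_def unitary_Units)
  show "x \<otimes>\<^bsub>units_of A\<^esub> y \<in> unitaries" if "x \<in> unitaries" "y \<in> unitaries" for x y
    using that by (simp add: units_of_def unitary_mult)
  show "\<one>\<^bsub>units_of A\<^esub> \<in> unitaries" by (simp add: units_of_def one_unitary)
  show "inv\<^bsub>units_of A\<^esub> x \<in> unitaries" if "x \<in> unitaries" for x
    using that by (simp add: units_of_inv unitary_Units unitary_star)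
qed

subsection \<open>The Cayley transform\<close>

text \<open>This is (1 - x)(1 + x)^(-1), rewritten so that x occurs only once. Then 1 +
  \<open>cayley x\<close> is just twice an inverse, which makes the involution property
  immediate.\<close>

definition cayley :: "'a \<Rightarrow> 'a" where
  "cayley x = 2 \<odot> inv (\<one> \<oplus> x) \<ominus> \<one>"

lemma cayley_closed: "\<lbrakk>x \<in> carrier A; \<one> \<oplus> x \<in> Units A\<rbrakk> \<Longrightarrow> cayley x \<in> carrier A"
  by (simp add: cayley_def)

text \<open>The domain of \<open>cayley\<close> is mapped into itself, and the explicit inverse is
  what the second application of \<open>cayley\<close> has to evaluate.\<close>

lemma one_plus_cayley:
  assumes "x \<in> carrier A" "\<one> \<oplus> x \<in> Units A"
  shows "\<one> \<oplus> cayley x \<in> Units A" "inv (\<one> \<oplus> cayley x) = (1/2) \<odot> (\<one> \<oplus> x)"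
    "\<one> \<oplus> cayley x = 2 \<odot> inv (\<one> \<oplus> x)"
proof -
  let ?b = "inv (\<one> \<oplus> x)"
  have b: "?b \<in> carrier A" "?b \<otimes> (\<one> \<oplus> x) = \<one>" "(\<one> \<oplus> x) \<otimes> ?b = \<one>" using assms by auto
  show e: "\<one> \<oplus> cayley x = 2 \<odot> ?b" using b unfolding cayley_def by (simp add: add_diff_cancel)
  have l: "((1/2) \<odot> (\<one> \<oplus> x)) \<otimes> (2 \<odot> ?b) = \<one>" and r: "(2 \<odot> ?b) \<otimes> ((1/2) \<odot> (\<one> \<oplus> x)) = \<one>"
    using assms b by (simp_all add: smult_mult_left smult_mult_right smult_smult)
  show "\<one> \<oplus> cayley x \<in> Units A"
    unfolding e using l r b assms by (auto simp: Units_def intro!: bexI[of _ "(1/2) \<odot> (\<one> \<oplus> x)"])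
  show "inv (\<one> \<oplus> cayley x) = (1/2) \<odot> (\<one> \<oplus> x)"
    unfolding e using l r b(1) assms by (metis inv_unique' Units_closed smult_closed a_closed one_closed)
qed

lemma cayley_cayley:
  assumes "x \<in> carrier A" "\<one> \<oplus> x \<in> Units A" shows "cayley (cayley x) = x"
proof -
  have "cayley (cayley x) = 2 \<odot> ((1/2) \<odot> (\<one> \<oplus> x)) \<ominus> \<one>"
    using one_plus_cayley(2)[OF assms] by (simp add: cayley_def)
  also have "\<dots> = (\<one> \<oplus> x) \<ominus> \<one>" using assms by (simp add: smult_smult)
  also have "\<dots> = x" using assms by (simp add: a_minus_def a_ac r_neg r_neg1)
  finally show ?thesis .
qed

lemma star_inv: "x \<in> Units A \<Longrightarrow> star (inv x) = inv (star x) \<and> star x \<in> Units A"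
proof -
  assume x: "x \<in> Units A"
  then have e: "star (inv x) \<otimes> star x = \<one>" "star x \<otimes> star (inv x) = \<one>"
    using Units_closed[OF x] Units_inv_closed[OF x] by (metis Units_r_inv Units_l_inv star_mult star_one x)+
  have "star x \<in> Units A"
    using e Units_closed[OF x] Units_inv_closed[OF x] star_closed unfolding Units_def by blast
  with e x show ?thesis by (metis Units_closed Units_inv_closed inv_unique' star_closed)
qed

lemma cayley_unitary_skew:
  assumes y: "y \<in> unitaries" and u: "\<one> \<oplus> y \<in> Units A"
  shows "cayley y \<in> skews"
proof -
  let ?b = "inv (\<one> \<oplus> y)"
  have yc: "y \<in> carrier A" "y \<otimes> star y = \<one>" "star y \<otimes> y = \<one>"
    using y left_unitary_imp_right by (auto simp: unitaries_def)
  have b: "?b \<in> carrier A" "(\<one> \<oplus> y) \<otimes> ?b = \<one>" using u by auto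
  have "(\<one> \<oplus> star y) \<otimes> (y \<otimes> ?b) = (\<one> \<oplus> y) \<otimes> ?b"
    using yc b by (simp add: l_distr a_comm flip: m_assoc)
  then have s: "(\<one> \<oplus> star y) \<otimes> (y \<otimes> ?b) = \<one>" using b by simp
  have su: "star ?b = inv (\<one> \<oplus> star y)" "\<one> \<oplus> star y \<in> Units A"
    using star_inv[OF u] yc by (simp_all add: star_add)
  moreover have "inv (\<one> \<oplus> star y) \<otimes> ((\<one> \<oplus> star y) \<otimes> (y \<otimes> ?b)) = y \<otimes> ?b"
    using su(2) yc b by (simp flip: m_assoc)
  ultimately have "star ?b = y \<otimes> ?b" unfolding s using su(2) by simp
  then have "star ?b \<oplus> ?b = (\<one> \<oplus> y) \<otimes> ?b" using b(1) yc by (simp add: l_distr a_comm)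
  then have "star ?b \<oplus> ?b = \<one>" using b(2) by simp
  then have e: "2 \<odot> star ?b \<oplus> 2 \<odot> ?b = \<one> \<oplus> \<one>"
    using b(1) smult_add_right[of "star ?b" ?b 2] by (simp add: smult_two[of \<one>])
  have "star (cayley y) \<oplus> cayley y = (2 \<odot> star ?b \<oplus> 2 \<odot> ?b) \<ominus> (\<one> \<oplus> \<one>)"
    using b(1) by (simp add: cayley_def star_diff star_smult) (simp add: a_minus_def minus_add a_ac)
  also have "\<dots> = \<zero>" unfolding e by (simp add: a_minus_def r_neg)
  finally have "star (cayley y) = \<ominus> cayley y"
    using cayley_closed[OF yc(1) u] by (simp add: minus_equality)
  then show ?thesis using cayley_closed[OF yc(1) u] by (simp add: skews_def)
qed

text \<open>With b = (1 + x)^(-1) and b* = (1 - x)^(-1), inserting both inverses gives b* + b = b*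
  ((1 + x) + (1 - x)) b = 2 b* b, which is the hypothesis of \<open>diff_one_mult_diff_one\<close>
  for p = 2 b* and q = 2 b.\<close>

lemma cayley_skew_unitary:
  assumes "x \<in> skews" shows "cayley x \<in> unitaries" "\<one> \<oplus> x \<in> Units A"
proof -
  let ?b = "inv (\<one> \<oplus> x)"
  have x: "x \<in> carrier A" "star x = \<ominus> x" using assms by (auto simp: skews_def)
  show u: "\<one> \<oplus> x \<in> Units A" using one_plus_skew_Units x by simp
  then have b: "?b \<in> carrier A" "(\<one> \<oplus> x) \<otimes> ?b = \<one>" by auto
  have su: "star ?b = inv (\<one> \<oplus> star x)" "\<one> \<oplus> star x \<in> Units A"
    using star_inv[OF u] x(1) by (simp_all add: star_add)
  then have sb: "star ?b \<in> carrier A" "star ?b \<otimes> (\<one> \<ominus> x) = \<one>"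
    using x b by (simp_all add: a_minus_def)
  have "star ?b \<oplus> ?b = star ?b \<otimes> ((\<one> \<oplus> x) \<otimes> ?b) \<oplus> (star ?b \<otimes> (\<one> \<ominus> x)) \<otimes> ?b" using b sb by simp
  also have "\<dots> = star ?b \<otimes> ((\<one> \<oplus> x) \<oplus> (\<one> \<ominus> x)) \<otimes> ?b"
    using b(1) sb(1) x(1) by (simp only: l_distr r_distr m_assoc m_closed a_closed one_closed minus_closed)
  also have "(\<one> \<oplus> x) \<oplus> (\<one> \<ominus> x) = 2 \<odot> \<one>"
    using x(1) by (simp add: smult_two add_diff_cancel a_assoc)
  also have "star ?b \<otimes> (2 \<odot> \<one>) \<otimes> ?b = 2 \<odot> (star ?b \<otimes> ?b)"
    using b sb by (simp add: smult_mult_left smult_mult_right)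
  finally have e: "2 \<odot> (star ?b \<otimes> ?b) = star ?b \<oplus> ?b" by simp
  have "star (cayley x) \<otimes> cayley x = (2 \<odot> star ?b \<ominus> \<one>) \<otimes> (2 \<odot> ?b \<ominus> \<one>)"
    using b by (simp add: cayley_def star_diff star_smult)
  also have "\<dots> = \<one>"
  proof (rule diff_one_mult_diff_one)
    show "(2 \<odot> star ?b) \<otimes> (2 \<odot> ?b) = 2 \<odot> star ?b \<oplus> 2 \<odot> ?b"
      using b sb e by (simp add: smult_mult_left smult_mult_right smult_add_right)
  qed (use b sb in auto)
  finally show "cayley x \<in> unitaries" using cayley_closed[OF x(1) u] by (simp add: unitaries_def)
qed

section \<open>Limits in the topology of the algebra\<close>

lemma limitin_carrier: "limitin (topo A) f l F \<Longrightarrow> l \<in> carrier A"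
  by (metis limitin_topspace topspace_topo)

lemma limitin_add:
  "\<lbrakk>limitin (topo A) f l F; limitin (topo A) g k F\<rbrakk> \<Longrightarrow> limitin (topo A) (\<lambda>x. f x \<oplus> g x) (l \<oplus> k) F"
  using continuous_map_limit[OF continuous_add, of "\<lambda>x. (f x, g x)" "(l, k)" F]
  by (simp add: limitin_pairwise comp_def)

lemma limitin_mult:
  "\<lbrakk>limitin (topo A) f l F; limitin (topo A) g k F\<rbrakk> \<Longrightarrow> limitin (topo A) (\<lambda>x. f x \<otimes> g x) (l \<otimes> k) F"
  using continuous_map_limit[OF continuous_mult, of "\<lambda>x. (f x, g x)" "(l, k)" F]
  by (simp add: limitin_pairwise comp_def)

lemma limitin_smult:
  "\<lbrakk>(r \<longlongrightarrow> s) F; limitin (topo A) g k F\<rbrakk> \<Longrightarrow> limitin (topo A) (\<lambda>x. r x \<odot> g x) (s \<odot> k) F"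
  using continuous_map_limit[OF continuous_smult, of "\<lambda>x. (r x, g x)" "(s, k)" F]
  by (simp add: limitin_pairwise comp_def)

lemma limitin_star: "limitin (topo A) f l F \<Longrightarrow> limitin (topo A) (\<lambda>x. star (f x)) (star l) F"
  using continuous_map_limit[OF continuous_star, of f l F] by (simp add: comp_def)

lemma limitin_inv:
  assumes "limitin (topo A) f l F" "l \<in> Units A"
  shows "limitin (topo A) (\<lambda>x. inv (f x)) (inv l) F" "\<forall>\<^sub>F x in F. f x \<in> Units A"
proof -
  show e: "\<forall>\<^sub>F x in F. f x \<in> Units A" using assms openin_Units by (auto simp: limitin_def)
  have "limitin (subtopology (topo A) (Units A)) f l F"
    using assms e by (simp add: limitin_subtopology)
  from continuous_map_limit[OF continuous_inv this] show "limitin (topo A) (\<lambda>x. inv (f x)) (inv l) F"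
    by (simp add: comp_def)
qed

lemma limitin_const: "c \<in> carrier A \<Longrightarrow> limitin (topo A) (\<lambda>x. c) c F"
  by (simp add: limitin_const_iff)

lemma limitin_unique:
  "\<lbrakk>limitin (topo A) f l F; limitin (topo A) f k F; F \<noteq> bot\<rbrakk> \<Longrightarrow> l = k"
  by (rule limitin_Hausdorff_unique[OF _ _ _ Hausdorff])

subsection \<open>Derivatives of curves\<close>

text \<open>The carrier conditions allow the ring laws to be applied to difference quotients near 0;
  \<open>has_dir_deriv\<close> alone does not say where the curve takes its values.\<close>

definition curve_deriv :: "(real \<Rightarrow> 'a) \<Rightarrow> 'a \<Rightarrow> bool" where
  "curve_deriv c l \<longleftrightarrow> c 0 \<in> carrier A \<and> (\<forall>\<^sub>F t in at 0. c t \<in> carrier A) \<and>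
     limitin (topo A) (\<lambda>t. (1 / t) \<odot> (c t \<ominus> c 0)) l (at 0)"

lemma curve_derivD:
  assumes "curve_deriv c l"
  shows "c 0 \<in> carrier A" "\<forall>\<^sub>F t in at 0. c t \<in> carrier A"
    "limitin (topo A) (\<lambda>t. (1 / t) \<odot> (c t \<ominus> c 0)) l (at 0)"
  using assms by (auto simp: curve_deriv_def)

lemma curve_derivI:
  assumes "c 0 \<in> carrier A" "\<forall>\<^sub>F t in at 0. c t \<in> carrier A"
    "limitin (topo A) q l (at 0)" "\<forall>\<^sub>F t in at 0. q t = (1 / t) \<odot> (c t \<ominus> c 0)"
  shows "curve_deriv c l"
  using assms limitin_transform_eventually[OF assms(4,3)] by (simp add: curve_deriv_def)

text \<open>For t \<noteq> 0, \<open>c t\<close> is t times the difference quotient plus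
  \<open>c 0\<close>. The product and inverse rules rely on this continuity.\<close>

lemma curve_deriv_limit:
  assumes "curve_deriv c l" shows "limitin (topo A) c (c 0) (at 0)"
proof -
  have c0: "c 0 \<in> carrier A" and ev: "\<forall>\<^sub>F t in at 0. c t \<in> carrier A"
    and lim: "limitin (topo A) (\<lambda>t. (1 / t) \<odot> (c t \<ominus> c 0)) l (at 0)"
    using assms by (auto simp: curve_deriv_def)
  have "limitin (topo A) (\<lambda>t. t \<odot> ((1 / t) \<odot> (c t \<ominus> c 0)) \<oplus> c 0) (0 \<odot> l \<oplus> c 0) (at 0)"
    by (intro limitin_add limitin_smult lim limitin_const c0) (rule tendsto_ident_at)
  then have "limitin (topo A) (\<lambda>t. t \<odot> ((1 / t) \<odot> (c t \<ominus> c 0)) \<oplus> c 0) (c 0) (at 0)"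
    using limitin_carrier[OF lim] c0 by simp
  moreover have "\<forall>\<^sub>F t in at 0. t \<odot> ((1 / t) \<odot> (c t \<ominus> c 0)) \<oplus> c 0 = c t"
    using ev eventually_neq_at_within[of 0 0]
    by eventually_elim (use c0 in \<open>simp add: smult_smult a_comm add_diff_cancel\<close>)
  ultimately show ?thesis by (rule limitin_transform_eventually[rotated])
qed

lemma curve_deriv_const: "a \<in> carrier A \<Longrightarrow> curve_deriv (\<lambda>t. a) \<zero>"
  by (simp add: curve_deriv_def a_minus_def r_neg limitin_const)

lemma curve_deriv_linear:
  assumes "a \<in> carrier A" "b \<in> carrier A" shows "curve_deriv (\<lambda>t. a \<oplus> t \<odot> b) b"
proof -
  have "limitin (topo A) (\<lambda>t. (1 / t) \<odot> ((a \<oplus> t \<odot> b) \<ominus> (a \<oplus> 0 \<odot> b))) b (at 0)"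
  proof (rule limitin_transform_eventually[OF _ limitin_const])
    have "(1 / t) \<odot> ((a \<oplus> t \<odot> b) \<ominus> (a \<oplus> 0 \<odot> b)) = b" if "t \<noteq> 0" for t
    proof -
      have "(a \<oplus> t \<odot> b) \<ominus> (a \<oplus> 0 \<odot> b) = t \<odot> b"
        using assms by (simp add: a_minus_def a_ac r_neg1 r_neg r_neg2)
      then show ?thesis using that assms by (simp add: smult_smult)
    qed
    then show "\<forall>\<^sub>F t in at 0. b = (1 / t) \<odot> ((a \<oplus> t \<odot> b) \<ominus> (a \<oplus> 0 \<odot> b))"
      using eventually_neq_at_within[of 0 0 UNIV] by (auto elim!: eventually_mono)
  qed (use assms in auto)
  then show ?thesis using assms by (simp add: curve_deriv_def)
qed

lemma curve_deriv_add:
  assumes "curve_deriv c l" "curve_deriv e k" shows "curve_deriv (\<lambda>t. c t \<oplus> e t) (l \<oplus> k)"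
proof -
  note c = curve_derivD[OF assms(1)] and e = curve_derivD[OF assms(2)]
  have "\<forall>\<^sub>F t in at 0. (1 / t) \<odot> (c t \<ominus> c 0) \<oplus> (1 / t) \<odot> (e t \<ominus> e 0)
      = (1 / t) \<odot> ((c t \<oplus> e t) \<ominus> (c 0 \<oplus> e 0))" using c(2) e(2)
    by eventually_elim (use c(1) e(1) in \<open>simp add: a_minus_def minus_add a_ac flip: smult_add_right\<close>)
  moreover have "\<forall>\<^sub>F t in at 0. c t \<oplus> e t \<in> carrier A" using c(2) e(2) by eventually_elim simp
  ultimately show ?thesis using limitin_add[OF c(3) e(3)] c(1) e(1) by (intro curve_derivI) auto
qed

text \<open>The quotient is split as x y - c0 e0 = (x - c0) y + c0 (y - e0), which respects the
  order of the factors.\<close>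

lemma curve_deriv_mult:
  assumes "curve_deriv c l" "curve_deriv e k"
  shows "curve_deriv (\<lambda>t. c t \<otimes> e t) (l \<otimes> e 0 \<oplus> c 0 \<otimes> k)"
proof -
  note c = curve_derivD[OF assms(1)] and e = curve_derivD[OF assms(2)]
  have "((1 / t) \<odot> (x \<ominus> c 0)) \<otimes> y \<oplus> c 0 \<otimes> ((1 / t) \<odot> (y \<ominus> e 0))
      = (1 / t) \<odot> (x \<otimes> y \<ominus> c 0 \<otimes> e 0)" if "x \<in> carrier A" "y \<in> carrier A" for x y and t :: real
  proof -
    have "(x \<ominus> c 0) \<otimes> y \<oplus> c 0 \<otimes> (y \<ominus> e 0) = x \<otimes> y \<ominus> c 0 \<otimes> e 0"
      using that c(1) e(1) by (simp add: a_minus_def l_distr r_distr l_minus r_minus a_ac r_neg1 r_neg r_neg2)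
    then show ?thesis
      using that c(1) e(1) by (simp add: smult_mult_left smult_mult_right flip: smult_add_right)
  qed
  note eq = this
  have "\<forall>\<^sub>F t in at 0. ((1 / t) \<odot> (c t \<ominus> c 0)) \<otimes> e t \<oplus> c 0 \<otimes> ((1 / t) \<odot> (e t \<ominus> e 0))
      = (1 / t) \<odot> (c t \<otimes> e t \<ominus> c 0 \<otimes> e 0)" using c(2) e(2) by eventually_elim (rule eq)
  moreover have "limitin (topo A) (\<lambda>t. ((1 / t) \<odot> (c t \<ominus> c 0)) \<otimes> e t \<oplus> c 0 \<otimes> ((1 / t) \<odot> (e t \<ominus> e 0)))
      (l \<otimes> e 0 \<oplus> c 0 \<otimes> k) (at 0)"
    by (intro limitin_add limitin_mult c(3) e(3) limitin_const c(1) curve_deriv_limit[OF assms(2)])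
  moreover have "\<forall>\<^sub>F t in at 0. c t \<otimes> e t \<in> carrier A" using c(2) e(2) by eventually_elim simp
  ultimately show ?thesis using c(1) e(1) by (intro curve_derivI) auto
qed

lemma curve_deriv_star:
  assumes "curve_deriv c l" shows "curve_deriv (\<lambda>t. star (c t)) (star l)"
proof -
  note c = curve_derivD[OF assms(1)]
  have "\<forall>\<^sub>F t in at 0. star ((1 / t) \<odot> (c t \<ominus> c 0)) = (1 / t) \<odot> (star (c t) \<ominus> star (c 0))"
    using c(2) by eventually_elim (use c(1) in \<open>simp add: star_diff star_smult\<close>)
  moreover have "\<forall>\<^sub>F t in at 0. star (c t) \<in> carrier A" using c(2) by eventually_elim simp
  ultimately show ?thesis using limitin_star[OF c(3)] c(1) by (intro curve_derivI) auto
qed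

text \<open>Based on x^(-1) (x - c0) c0^(-1) = c0^(-1) - x^(-1). The sign is a factor
  \<open>\<ominus> \<one>\<close> so that the derivative is again built from the operations of
  \<open>rational_map\<close>, which has no rule for negation.\<close>

lemma curve_deriv_inv:
  assumes "curve_deriv c l" "c 0 \<in> Units A"
  shows "curve_deriv (\<lambda>t. inv (c t)) (\<ominus> \<one> \<otimes> (inv (c 0) \<otimes> l \<otimes> inv (c 0)))"
proof -
  note c = curve_derivD[OF assms(1)]
  note lim = limitin_inv[OF curve_deriv_limit[OF assms(1)] assms(2)]
  have "\<ominus> \<one> \<otimes> (inv x \<otimes> ((1 / t) \<odot> (x \<ominus> c 0)) \<otimes> inv (c 0)) = (1 / t) \<odot> (inv x \<ominus> inv (c 0))"
    if "x \<in> Units A" for x and t :: real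
  proof -
    have x: "x \<in> carrier A" "inv x \<in> carrier A" "inv (c 0) \<in> carrier A" using that assms(2) by auto
    have "inv x \<otimes> (x \<ominus> c 0) \<otimes> inv (c 0) = inv (c 0) \<ominus> inv x"
      using x c(1) that assms(2) by (simp add: a_minus_def l_distr r_distr l_minus r_minus m_assoc)
    then have "\<ominus> \<one> \<otimes> (inv x \<otimes> (x \<ominus> c 0) \<otimes> inv (c 0)) = inv x \<ominus> inv (c 0)"
      using x by (simp add: l_minus a_minus_def minus_add a_comm)
    then show ?thesis using x c(1) by (simp add: smult_mult_left smult_mult_right)
  qed
  note eq = this
  have "\<forall>\<^sub>F t in at 0. \<ominus> \<one> \<otimes> (inv (c t) \<otimes> ((1 / t) \<odot> (c t \<ominus> c 0)) \<otimes> inv (c 0))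
      = (1 / t) \<odot> (inv (c t) \<ominus> inv (c 0))" using lim(2) by eventually_elim (rule eq)
  moreover have "limitin (topo A) (\<lambda>t. \<ominus> \<one> \<otimes> (inv (c t) \<otimes> ((1 / t) \<odot> (c t \<ominus> c 0)) \<otimes> inv (c 0)))
      (\<ominus> \<one> \<otimes> (inv (c 0) \<otimes> l \<otimes> inv (c 0))) (at 0)"
    by (intro limitin_mult lim(1) c(3) limitin_const) (use assms(2) in auto)
  moreover have "\<forall>\<^sub>F t in at 0. inv (c t) \<in> carrier A" using lim(2) by eventually_elim simp
  ultimately show ?thesis using assms(2) by (intro curve_derivI) auto
qed

lemma has_dir_deriv_real_line:
  assumes "c 0 \<in> carrier A" "\<forall>\<^sub>F t in at 0. c t \<in> carrier A"
  shows "has_dir_deriv real_line A c 0 1 l \<longleftrightarrow> curve_deriv c l"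
  using assms by (simp add: has_dir_deriv_def curve_deriv_def real_line_def)

subsection \<open>A class of smooth maps\<close>

text \<open>Closed under directional derivatives, so smoothness follows by coinduction.\<close>

inductive rational_map :: "('d, 'y) topological_module_scheme \<Rightarrow> 'd set \<Rightarrow> ('d \<Rightarrow> 'a) \<Rightarrow> bool"
  for D S where
  const: "c \<in> carrier A \<Longrightarrow> rational_map D S (\<lambda>_. c)"
| linear: "\<lbrakk>continuous_map (topo D) (topo A) f;
     \<And>x v t. \<lbrakk>x \<in> carrier D; v \<in> carrier D\<rbrakk> \<Longrightarrow> f (x \<oplus>\<^bsub>D\<^esub> t \<odot>\<^bsub>D\<^esub> v) = f x \<oplus> t \<odot> f v\<rbrakk>
   \<Longrightarrow> rational_map D S f"
| add: "\<lbrakk>rational_map D S f; rational_map D S g\<rbrakk> \<Longrightarrow> rational_map D S (\<lambda>x. f x \<oplus> g x)"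
| mult: "\<lbrakk>rational_map D S f; rational_map D S g\<rbrakk> \<Longrightarrow> rational_map D S (\<lambda>x. f x \<otimes> g x)"
| inv: "\<lbrakk>rational_map D S f; \<And>x. x \<in> S \<Longrightarrow> f x \<in> Units A\<rbrakk> \<Longrightarrow> rational_map D S (\<lambda>x. inv (f x))"

text \<open>All that the domain of a \<open>rational_map\<close> has to provide. It covers the three
  domains that occur: the algebra, its square and the real line.\<close>

definition line_space :: "('d, 'y) topological_module_scheme \<Rightarrow> bool" where
  "line_space D \<longleftrightarrow> topspace (topo D) = carrier D \<and>
     (\<forall>x\<in>carrier D. \<forall>v\<in>carrier D. x \<oplus>\<^bsub>D\<^esub> 0 \<odot>\<^bsub>D\<^esub> v = x \<and>
        continuous_map euclideanreal (topo D) (\<lambda>t. x \<oplus>\<^bsub>D\<^esub> t \<odot>\<^bsub>D\<^esub> v))"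

lemma continuous_map_smult_fixed: "v \<in> carrier A \<Longrightarrow> continuous_map euclideanreal (topo A) (\<lambda>t. t \<odot> v)"
  using continuous_map_compose[OF _ continuous_smult, of euclideanreal "\<lambda>t. (t, v)"]
  by (simp add: continuous_map_pairwise comp_def)

lemma line_space_self: "line_space A"
proof -
  have "continuous_map euclideanreal (topo A) (\<lambda>t. x \<oplus> t \<odot> v)"
    if "x \<in> carrier A" "v \<in> carrier A" for x v
    using continuous_map_compose[OF _ continuous_add, of euclideanreal "\<lambda>t. (x, t \<odot> v)"]
      continuous_map_smult_fixed that by (simp add: continuous_map_pairwise comp_def)
  then show ?thesis by (simp add: line_space_def)
qed

lemma line_space_real_line: "line_space real_line"
  by (auto simp: line_space_def real_line_def intro!: continuous_intros)

lemma line_space_prod: "line_space (prod_module A A)" using line_space_self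
  by (auto simp: line_space_def prod_module_def continuous_map_pairwise comp_def)

context
  fixes D :: "('d, 'y) topological_module_scheme" and S
  assumes D: "line_space D" and S: "openin (topo D) S"
begin

lemma open_subset_carrier: "x \<in> S \<Longrightarrow> x \<in> carrier D"
  using D S openin_subset by (force simp: line_space_def)

lemma rational_map_continuous:
  assumes "rational_map D S f" shows "continuous_map (subtopology (topo D) S) (topo A) f"
  using assms
proof induction
  case (const c) then show ?case by simp
next
  case (linear f) then show ?case by (simp add: continuous_map_from_subtopology)
next
  case (add f g) then show ?case by (simp add: continuous_map_atin limitin_add)
next
  case (mult f g) then show ?case by (simp add: continuous_map_atin limitin_mult)
next
  case (inv f) then show ?case by (simp add: continuous_map_atin limitin_inv(1))
qed

lemma rational_map_closed: "\<lbrakk>rational_map D S f; x \<in> S\<rbrakk> \<Longrightarrow> f x \<in> carrier A"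
  using continuous_map_image_subset_topspace[OF rational_map_continuous, of f] S openin_subset[OF S]
  by (auto simp: Int_absorb1)

lemma line_eventually:
  assumes "x \<in> S" "v \<in> carrier D"
  shows "\<forall>\<^sub>F t in at 0. x \<oplus>\<^bsub>D\<^esub> t \<odot>\<^bsub>D\<^esub> v \<in> S"
proof -
  have c: "continuous_map euclideanreal (topo D) (\<lambda>t. x \<oplus>\<^bsub>D\<^esub> t \<odot>\<^bsub>D\<^esub> v)"
    and e: "x \<oplus>\<^bsub>D\<^esub> 0 \<odot>\<^bsub>D\<^esub> v = x" using D assms open_subset_carrier by (auto simp: line_space_def)
  have "limitin (topo D) (\<lambda>t. x \<oplus>\<^bsub>D\<^esub> t \<odot>\<^bsub>D\<^esub> v) x (at 0)"
    using limitin_continuous_map[OF c _ e] by (simp add: atin_euclidean)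
  then show ?thesis using assms S by (auto simp: limitin_def)
qed

lemma has_dir_deriv_curve:
  assumes "x \<in> S" "v \<in> carrier D" "\<And>y. y \<in> S \<Longrightarrow> f y \<in> carrier A"
  shows "has_dir_deriv D A f x v l \<longleftrightarrow> curve_deriv (\<lambda>t. f (x \<oplus>\<^bsub>D\<^esub> t \<odot>\<^bsub>D\<^esub> v)) l"
proof -
  have "x \<oplus>\<^bsub>D\<^esub> 0 \<odot>\<^bsub>D\<^esub> v = x" using D assms open_subset_carrier by (auto simp: line_space_def)
  moreover have "\<forall>\<^sub>F t in at 0. f (x \<oplus>\<^bsub>D\<^esub> t \<odot>\<^bsub>D\<^esub> v) \<in> carrier A"
    using line_eventually[OF assms(1,2)] assms(3) by (auto elim: eventually_mono)
  ultimately show ?thesis using assms by (simp add: has_dir_deriv_def curve_deriv_def)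
qed

lemma rational_map_deriv:
  assumes "rational_map D S f" and v: "v \<in> carrier D"
  shows "\<exists>g. rational_map D S g \<and> (\<forall>x\<in>S. curve_deriv (\<lambda>t. f (x \<oplus>\<^bsub>D\<^esub> t \<odot>\<^bsub>D\<^esub> v)) (g x))"
  using assms(1)
proof induction
  case (const c)
  then show ?case by (intro exI[of _ "\<lambda>_. \<zero>"]) (auto intro: rational_map.const curve_deriv_const)
next
  case (linear f)
  have f: "f x \<in> carrier A" if "x \<in> carrier D" for x
    using continuous_map_image_subset_topspace[OF linear(1)] D that by (auto simp: line_space_def)
  have "curve_deriv (\<lambda>t. f (x \<oplus>\<^bsub>D\<^esub> t \<odot>\<^bsub>D\<^esub> v)) (f v)" if "x \<in> S" for x
    using curve_deriv_linear f that v open_subset_carrier by (simp add: linear(2))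
  then show ?case using f v by (intro exI[of _ "\<lambda>_. f v"]) (auto intro: rational_map.const)
next
  case (add f g)
  then obtain f' g' where "rational_map D S f'" "rational_map D S g'"
    and d: "\<And>x. x \<in> S \<Longrightarrow> curve_deriv (\<lambda>t. f (x \<oplus>\<^bsub>D\<^esub> t \<odot>\<^bsub>D\<^esub> v)) (f' x)"
      "\<And>x. x \<in> S \<Longrightarrow> curve_deriv (\<lambda>t. g (x \<oplus>\<^bsub>D\<^esub> t \<odot>\<^bsub>D\<^esub> v)) (g' x)" by blast
  then show ?case
    by (intro exI[of _ "\<lambda>x. f' x \<oplus> g' x"]) (auto intro: rational_map.add curve_deriv_add)
next
  case (mult f g)
  then obtain f' g' where r: "rational_map D S f'" "rational_map D S g'"
    and d: "\<And>x. x \<in> S \<Longrightarrow> curve_deriv (\<lambda>t. f (x \<oplus>\<^bsub>D\<^esub> t \<odot>\<^bsub>D\<^esub> v)) (f' x)"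
      "\<And>x. x \<in> S \<Longrightarrow> curve_deriv (\<lambda>t. g (x \<oplus>\<^bsub>D\<^esub> t \<odot>\<^bsub>D\<^esub> v)) (g' x)" by blast
  \<comment> \<open>The product rule refers to the values of the factors at t = 0, on the line
    through x; these are the values at x itself.\<close>
  have "x \<oplus>\<^bsub>D\<^esub> 0 \<odot>\<^bsub>D\<^esub> v = x" if "x \<in> S" for x
    using D v open_subset_carrier that by (auto simp: line_space_def)
  then have "curve_deriv (\<lambda>t. f (x \<oplus>\<^bsub>D\<^esub> t \<odot>\<^bsub>D\<^esub> v) \<otimes> g (x \<oplus>\<^bsub>D\<^esub> t \<odot>\<^bsub>D\<^esub> v)) (f' x \<otimes> g x \<oplus> f x \<otimes> g' x)"
    if "x \<in> S" for x using curve_deriv_mult[OF d[OF that]] that by simp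
  then show ?case using r mult.hyps
    by (intro exI[of _ "\<lambda>x. f' x \<otimes> g x \<oplus> f x \<otimes> g' x"]) (auto intro!: rational_map.intros)
next
  case (inv f)
  then obtain f' where r: "rational_map D S f'"
    and d: "\<And>x. x \<in> S \<Longrightarrow> curve_deriv (\<lambda>t. f (x \<oplus>\<^bsub>D\<^esub> t \<odot>\<^bsub>D\<^esub> v)) (f' x)" by blast
  have "x \<oplus>\<^bsub>D\<^esub> 0 \<odot>\<^bsub>D\<^esub> v = x" if "x \<in> S" for x
    using D v open_subset_carrier that by (auto simp: line_space_def)
  then have "curve_deriv (\<lambda>t. inv (f (x \<oplus>\<^bsub>D\<^esub> t \<odot>\<^bsub>D\<^esub> v))) (\<ominus> \<one> \<otimes> (inv (f x) \<otimes> f' x \<otimes> inv (f x)))"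
    if "x \<in> S" for x using curve_deriv_inv[OF d[OF that]] that inv.hyps by simp
  then show ?case using r inv.hyps by (intro exI[of _ "\<lambda>x. \<ominus> \<one> \<otimes> (inv (f x) \<otimes> f' x \<otimes> inv (f x))"])
      (auto intro!: rational_map.intros(1,4,5))
qed

lemma rational_map_smooth:
  assumes "rational_map D S f" shows "smooth_on_open D A S f" using assms
proof (coinduction arbitrary: f)
  case (smooth_on_open f)
  have "\<exists>g. rational_map D S g \<and> (\<forall>x\<in>S. has_dir_deriv D A f x v (g x))" if v: "v \<in> carrier D" for v
  proof -
    obtain g where "rational_map D S g" "\<forall>x\<in>S. curve_deriv (\<lambda>t. f (x \<oplus>\<^bsub>D\<^esub> t \<odot>\<^bsub>D\<^esub> v)) (g x)"
      using rational_map_deriv[OF smooth_on_open v] by blast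
    then show ?thesis using has_dir_deriv_curve v rational_map_closed[OF smooth_on_open] by blast
  qed
  then show ?case using rational_map_continuous[OF smooth_on_open] by blast
qed

end

lemma rational_map_smooth_map_on:
  assumes "line_space D" "openin (topo D) N" "rational_map D N F" "S \<subseteq> N" "\<And>x. x \<in> S \<Longrightarrow> F x = f x"
  shows "smooth_map_on D A S f"
  unfolding smooth_map_on_def using assms rational_map_smooth[OF assms(1-3)]
  by (intro ballI exI[of _ N] exI[of _ F]) auto

lemma rational_map_ident: "rational_map A N (\<lambda>x. x)" by (rule rational_map.linear) auto

text \<open>Spells \<open>cayley\<close> with the operations of \<open>rational_map\<close>: the
  scalar 2 becomes a constant factor, and subtraction becomes addition of a constant.\<close>

lemma cayley_eq:
  assumes "x \<in> carrier A" "\<one> \<oplus> x \<in> Units A"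
  shows "(2 \<odot> \<one>) \<otimes> inv (\<one> \<oplus> x) \<oplus> \<ominus> \<one> = cayley x"
  using assms by (simp add: cayley_def a_minus_def smult_mult_left)

lemma rational_map_cayley:
  assumes "rational_map D N h" "\<And>x. x \<in> N \<Longrightarrow> \<one> \<oplus> h x \<in> Units A"
  shows "rational_map D N (\<lambda>x. (2 \<odot> \<one>) \<otimes> inv (\<one> \<oplus> h x) \<oplus> \<ominus> \<one>)" using assms
  by (intro rational_map.add rational_map.mult rational_map.inv rational_map.const) auto

lemma openin_Units_preimage:
  assumes "rational_map A (carrier A) h"
  shows "openin (topo A) {x \<in> carrier A. h x \<in> Units A}"
proof -
  have "openin (topo A) (carrier A)" using openin_topspace[of "topo A"] by simp
  from rational_map_continuous[OF line_space_self this assms]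
  have "continuous_map (topo A) (topo A) h" using subtopology_topspace[of "topo A"] by simp
  from openin_continuous_map_preimage[OF this openin_Units] show ?thesis by simp
qed

section \<open>The unitary elements form a Lie group\<close>

text \<open>The chart at p translates p to 1 by left multiplication with \<open>star p\<close> and
  then applies the Cayley transform. It is defined where 1 + p* x is invertible and has all of
  \<open>skews\<close> as image, so \<open>skews\<close> serves both as model space and as target of
  every chart.\<close>

lemma smooth_submanifold_unitaries: "smooth_submanifold A unitaries"
  unfolding smooth_submanifold_def
proof (intro conjI exI ballI)
  show "unitaries \<subseteq> carrier A" by (auto simp: unitary_carrier)
  show "Module.submodule skews (class_ring :: real ring) A" by (rule submodule_skews)
next
  fix p assume p: "p \<in> unitaries"
  then have pc: "p \<in> carrier A" "star p \<in> unitaries" "star p \<otimes> p = \<one>" "p \<otimes> star p = \<one>"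
    using left_unitary_imp_right by (auto simp: unitaries_def unitary_star)
  define N where "N = {x \<in> carrier A. \<one> \<oplus> star p \<otimes> x \<in> Units A}"
  define N' where "N' = {x \<in> carrier A. \<one> \<oplus> x \<in> Units A}"
  define \<phi> where "\<phi> x = cayley (star p \<otimes> x)" for x
  define \<psi> where "\<psi> x = p \<otimes> cayley x" for x
  have oN: "openin (topo A) N" and oN': "openin (topo A) N'" unfolding N_def N'_def using pc
    by (intro openin_Units_preimage rational_map.intros rational_map_ident; simp)+
  \<comment> \<open>Since 1 + p* p = 1 + 1, this puts p into its own chart domain. It is
    \<open>one_plus_cayley\<close> at 0, where the Cayley transform takes the value 1.\<close>
  have two: "\<one> \<oplus> \<one> \<in> Units A"
    using one_plus_cayley(1)[of \<zero>] by (simp add: cayley_def a_minus_def smult_two a_assoc r_neg)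
  show "p \<in> unitaries \<inter> N" using p pc two by (simp add: N_def)
  show "openin (subtopology (topo A) unitaries) (unitaries \<inter> N)"
    using oN by (auto simp: openin_subtopology)
  show "openin (subtopology (topo A) skews) skews"
    by (auto simp: openin_subtopology_refl skews_carrier)
  have \<phi>: "\<phi> x \<in> skews" "\<psi> (\<phi> x) = x" if "x \<in> unitaries \<inter> N" for x
  proof -
    have x: "x \<in> unitaries" "x \<in> carrier A" "\<one> \<oplus> star p \<otimes> x \<in> Units A"
      using that by (auto simp: N_def)
    then show "\<phi> x \<in> skews" unfolding \<phi>_def using cayley_unitary_skew unitary_mult pc by blast
    have "\<psi> (\<phi> x) = p \<otimes> (star p \<otimes> x)" unfolding \<phi>_def \<psi>_def using cayley_cayley x pc by simp
    also have "\<dots> = x" using x pc by (simp flip: m_assoc)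
    finally show "\<psi> (\<phi> x) = x" .
  qed
  have \<psi>: "\<psi> x \<in> unitaries \<inter> N" "\<phi> (\<psi> x) = x" if "x \<in> skews" for x
  proof -
    note c = cayley_skew_unitary[OF that] skews_carrier[OF that]
    have e: "star p \<otimes> \<psi> x = cayley x"
      using c pc by (simp add: \<psi>_def unitary_carrier flip: m_assoc)
    show "\<psi> x \<in> unitaries \<inter> N"
      using c pc p one_plus_cayley(1) by (simp add: N_def e) (simp add: \<psi>_def unitary_mult unitary_carrier)
    show "\<phi> (\<psi> x) = x" using c by (simp add: \<phi>_def e cayley_cayley)
  qed
  show "bij_betw \<phi> (unitaries \<inter> N) skews" by (rule bij_betw_byWitness[of _ \<psi>]) (use \<phi> \<psi> in auto)
  show "\<psi> (\<phi> x) = x" if "x \<in> unitaries \<inter> N" for x using \<phi> that by simp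
  show "smooth_map_on A A (unitaries \<inter> N) \<phi>"
  proof (rule rational_map_smooth_map_on[OF line_space_self oN])
    show "rational_map A N (\<lambda>x. (2 \<odot> \<one>) \<otimes> inv (\<one> \<oplus> star p \<otimes> x) \<oplus> \<ominus> \<one>)"
      by (rule rational_map_cayley) (use pc in \<open>auto simp: N_def intro!: rational_map.intros(1,4) rational_map_ident\<close>)
  qed (use pc in \<open>auto simp: \<phi>_def N_def cayley_eq\<close>)
  show "smooth_map_on A A skews \<psi>"
  proof (rule rational_map_smooth_map_on[OF line_space_self oN'])
    show "rational_map A N' (\<lambda>x. p \<otimes> ((2 \<odot> \<one>) \<otimes> inv (\<one> \<oplus> x) \<oplus> \<ominus> \<one>))"
      using pc by (intro rational_map.mult rational_map_cayley rational_map_ident rational_map.const)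
        (auto simp: N'_def)
  qed (use pc cayley_skew_unitary skews_carrier in \<open>auto simp: \<psi>_def N'_def cayley_eq\<close>)
qed

lemma lie_group_in_unitaries: "lie_group_in A unitaries" unfolding lie_group_in_def
proof (intro conjI subgroup_unitaries smooth_submanifold_unitaries)
  have o: "openin (topo A) (carrier A)" using openin_topspace[of "topo A"] by simp
  show "smooth_map_on (prod_module A A) A (unitaries \<times> unitaries) (\<lambda>(x, y). x \<otimes> y)"
  proof (rule rational_map_smooth_map_on[OF line_space_prod])
    show "openin (topo (prod_module A A)) (carrier A \<times> carrier A)"
      by (simp add: prod_module_def openin_prod_Times_iff o)
    \<comment> \<open>Both projections fall under the rule \<open>linear\<close>, so multiplication
      is a product of two rational maps of the pair.\<close>
    have "rational_map (prod_module A A) (carrier A \<times> carrier A) fst"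
      "rational_map (prod_module A A) (carrier A \<times> carrier A) snd"
      by (rule rational_map.linear; force simp: prod_module_def continuous_map_fst continuous_map_snd)+
    from rational_map.mult[OF this]
    show "rational_map (prod_module A A) (carrier A \<times> carrier A) (\<lambda>z. fst z \<otimes> snd z)" .
  qed (auto simp: unitary_carrier)
  show "smooth_map_on A A unitaries (\<lambda>x. inv x)"
  proof (rule rational_map_smooth_map_on[OF line_space_self openin_Units])
    show "rational_map A (Units A) (\<lambda>x. inv x)" by (rule rational_map.inv[OF rational_map_ident])
  qed (auto simp: unitary_Units)
qed

section \<open>The tangent space at the identity and the adjoint action\<close>

lemma curve_deriv_unique:
  assumes "curve_deriv c l" "curve_deriv e k" "c 0 = e 0" "\<forall>\<^sub>F t in at 0. c t = e t"
  shows "l = k"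
proof -
  have "\<forall>\<^sub>F t in at 0. (1 / t) \<odot> (c t \<ominus> c 0) = (1 / t) \<odot> (e t \<ominus> e 0)"
    using assms(4) by eventually_elim (use assms(3) in simp)
  from limitin_transform_eventually[OF this, of "topo A" l] assms(1,2)
  have "limitin (topo A) (\<lambda>t. (1 / t) \<odot> (e t \<ominus> e 0)) l (at 0)" by (simp add: curve_deriv_def)
  moreover have "limitin (topo A) (\<lambda>t. (1 / t) \<odot> (e t \<ominus> e 0)) k (at 0)"
    using assms(2) by (simp add: curve_deriv_def)
  ultimately show ?thesis by (rule limitin_unique) simp
qed

lemma smooth_curve_unitaries:
  assumes "smooth_curve_in A unitaries \<one> X \<gamma>"
  shows "curve_deriv \<gamma> X" "\<gamma> 0 = \<one>" "\<forall>\<^sub>F t in at 0. \<gamma> t \<in> unitaries"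
proof -
  obtain \<epsilon> where e: "\<epsilon> > 0" "\<gamma> ` {-\<epsilon><..<\<epsilon>} \<subseteq> unitaries"
    and g0: "\<gamma> 0 = \<one>" and d: "has_dir_deriv real_line A \<gamma> 0 1 X"
    using assms by (auto simp: smooth_curve_in_def)
  show "\<gamma> 0 = \<one>" by fact
  have "\<forall>\<^sub>F t in at 0. t \<in> {-\<epsilon><..<\<epsilon>}" using e(1) by (intro eventually_at_in_open') auto
  then show u: "\<forall>\<^sub>F t in at 0. \<gamma> t \<in> unitaries" by eventually_elim (use e in blast)
  then have "\<forall>\<^sub>F t in at 0. \<gamma> t \<in> carrier A" by (auto elim: eventually_mono simp: unitary_carrier)
  then show "curve_deriv \<gamma> X" using has_dir_deriv_real_line[of \<gamma>] d g0 by simp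
qed

lemma tangent_vectors_unitaries: "tangent_vectors A unitaries \<one> = skews"
proof (intro equalityI subsetI)
  fix X assume "X \<in> tangent_vectors A unitaries \<one>"
  then obtain \<gamma> where "smooth_curve_in A unitaries \<one> X \<gamma>" by (auto simp: tangent_vectors_def)
  note g = smooth_curve_unitaries[OF this]
  then have X: "X \<in> carrier A" by (auto simp: curve_deriv_def dest: limitin_carrier)
  have "\<forall>\<^sub>F t in at 0. star (\<gamma> t) \<otimes> \<gamma> t = \<one>"
    using g(3) by eventually_elim (simp add: unitaries_def)
  from curve_deriv_unique[OF curve_deriv_mult[OF curve_deriv_star[OF g(1)] g(1)]
      curve_deriv_const[OF one_closed] _ this]
  have "star X \<oplus> X = \<zero>" using g(2) X by simp
  then show "X \<in> skews" using X by (simp add: skews_def minus_equality)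
next
  fix X assume X: "X \<in> skews"
  \<comment> \<open>The Cayley transform sends 0 to 1 with derivative -2 there; the factor -1/2
    compensates, so that t \<mapsto> \<open>cayley\<close> (t B) has velocity X.\<close>
  define B where "B = (-1/2) \<odot> X"
  define \<gamma> where "\<gamma> t = (2 \<odot> \<one>) \<otimes> inv (\<one> \<oplus> t \<odot> B) \<oplus> \<ominus> \<one>" for t :: real
  have Bs: "t \<odot> B \<in> skews" for t unfolding B_def by (intro skews_smult X)
  have Bc: "B \<in> carrier A" using X by (simp add: B_def skews_carrier)
  have un: "\<one> \<oplus> t \<odot> B \<in> Units A" for t using cayley_skew_unitary(2)[OF Bs] .
  have \<gamma>: "\<gamma> t = cayley (t \<odot> B)" for t unfolding \<gamma>_def using cayley_eq un Bc by simp
  then have gu: "\<gamma> t \<in> unitaries" for t using cayley_skew_unitary(1)[OF Bs] by simp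
  have g0: "\<gamma> 0 = \<one>" using Bc by (simp add: \<gamma>_def smult_mult_left smult_two a_assoc r_neg)
  have "curve_deriv \<gamma> (\<zero> \<otimes> inv (\<one> \<oplus> 0 \<odot> B) \<oplus>
      (2 \<odot> \<one>) \<otimes> (\<ominus> \<one> \<otimes> (inv (\<one> \<oplus> 0 \<odot> B) \<otimes> B \<otimes> inv (\<one> \<oplus> 0 \<odot> B))) \<oplus> \<zero>)" unfolding \<gamma>_def using un Bc
    by (intro curve_deriv_add curve_deriv_mult curve_deriv_inv curve_deriv_linear curve_deriv_const) auto
  moreover have "2 \<odot> (\<ominus> B) = X"
    using skews_carrier[OF X] by (simp add: B_def smult_smult flip: smult_minus_one)
  ultimately have d: "curve_deriv \<gamma> X"
    using Bc skews_carrier[OF X] by (simp add: l_minus smult_mult_left)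
  have ol: "openin (topo real_line) UNIV" by (simp add: real_line_def)
  have r: "rational_map real_line UNIV \<gamma>"
  proof -
    have "rational_map real_line UNIV (\<lambda>t. t \<odot> B)" using Bc by (intro rational_map.linear)
        (simp_all add: real_line_def continuous_map_smult_fixed smult_add_left smult_smult)
    from rational_map_cayley[OF this] un show ?thesis by (simp add: \<gamma>_def[abs_def])
  qed
  have "smooth_map_on real_line A {-1<..<1} \<gamma>"
    by (rule rational_map_smooth_map_on[OF line_space_real_line ol r]) auto
  moreover have "has_dir_deriv real_line A \<gamma> 0 1 X"
    using has_dir_deriv_real_line[of \<gamma>] gu unitary_carrier d by simp
  ultimately have "smooth_curve_in A unitaries \<one> X \<gamma>"
    unfolding smooth_curve_in_def using gu g0 by (intro conjI exI[of _ 1]) auto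
  then show "X \<in> tangent_vectors A unitaries \<one>" by (auto simp: tangent_vectors_def)
qed

text \<open>At the identity the left factor contributes X Y by the product rule, and the right
  factor contributes - Y X by the inverse rule.\<close>

lemma has_dir_deriv_Ad:
  assumes "smooth_curve_in A unitaries \<one> X \<gamma>" "Y \<in> carrier A"
  shows "has_dir_deriv real_line A (\<lambda>t. \<gamma> t \<otimes> Y \<otimes> inv (\<gamma> t)) 0 1 (X \<otimes> Y \<ominus> Y \<otimes> X)"
proof -
  note g = smooth_curve_unitaries[OF assms(1)]
  then have X: "X \<in> carrier A" by (auto simp: curve_deriv_def dest: limitin_carrier)
  have u: "\<gamma> 0 \<in> Units A" using g(2) by simp
  have "curve_deriv (\<lambda>t. \<gamma> t \<otimes> Y \<otimes> inv (\<gamma> t))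
     ((X \<otimes> Y \<oplus> \<gamma> 0 \<otimes> \<zero>) \<otimes> inv (\<gamma> 0) \<oplus> \<gamma> 0 \<otimes> Y \<otimes> (\<ominus> \<one> \<otimes> (inv (\<gamma> 0) \<otimes> X \<otimes> inv (\<gamma> 0))))"
    by (intro curve_deriv_mult curve_deriv_inv curve_deriv_const g(1) u assms(2))
  then have d: "curve_deriv (\<lambda>t. \<gamma> t \<otimes> Y \<otimes> inv (\<gamma> t)) (X \<otimes> Y \<ominus> Y \<otimes> X)"
    using g(2) X assms(2) by (simp add: l_minus r_minus a_minus_def)
  then show ?thesis
    using has_dir_deriv_real_line[of "\<lambda>t. \<gamma> t \<otimes> Y \<otimes> inv (\<gamma> t)"] by (simp add: curve_deriv_def)
qed

lemma commutator_jacobi: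
  assumes "X \<in> carrier A" "Y \<in> carrier A" "Z \<in> carrier A"
  shows "(X \<otimes> (Y \<otimes> Z \<ominus> Z \<otimes> Y) \<ominus> (Y \<otimes> Z \<ominus> Z \<otimes> Y) \<otimes> X)
    \<oplus> (Y \<otimes> (Z \<otimes> X \<ominus> X \<otimes> Z) \<ominus> (Z \<otimes> X \<ominus> X \<otimes> Z) \<otimes> Y)
    \<oplus> (Z \<otimes> (X \<otimes> Y \<ominus> Y \<otimes> X) \<ominus> (X \<otimes> Y \<ominus> Y \<otimes> X) \<otimes> Z) = \<zero>"
proof -
  \<comment> \<open>After expansion only six triple products occur, each twice with opposite signs;
    what remains is an identity in the additive group.\<close>
  have "((a \<ominus> b) \<ominus> (c \<ominus> d)) \<oplus> ((c \<ominus> e) \<ominus> (f \<ominus> b)) \<oplus> ((f \<ominus> d) \<ominus> (a \<ominus> e)) = \<zero>"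
    if "a \<in> carrier A" "b \<in> carrier A" "c \<in> carrier A" "d \<in> carrier A" "e \<in> carrier A" "f \<in> carrier A"
    for a b c d e f using that by algebra
  from this[of "X \<otimes> Y \<otimes> Z" "X \<otimes> Z \<otimes> Y" "Y \<otimes> Z \<otimes> X" "Z \<otimes> Y \<otimes> X" "Y \<otimes> X \<otimes> Z" "Z \<otimes> X \<otimes> Y"]
  show ?thesis using assms by (simp add: a_minus_def l_distr r_distr l_minus r_minus m_assoc)
qed

lemma is_lie_algebra_of_skews:
  fixes L :: "'a lie_algebra"
  assumes L: "carrier L = skews" "\<zero>\<^bsub>L\<^esub> = \<zero>" "add L = add A" "module.smult L = module.smult A"
    "\<And>X Y. \<lbrakk>X \<in> skews; Y \<in> skews\<rbrakk> \<Longrightarrow> bracket L X Y = X \<otimes> Y \<ominus> Y \<otimes> X"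
  shows "is_lie_algebra_of L A unitaries"
proof -
  have br: "X \<otimes> Y \<ominus> Y \<otimes> X \<in> skews" if "X \<in> skews" "Y \<in> skews" for X Y
    using that by (auto simp: skews_def star_diff star_mult l_minus r_minus)
      (simp add: a_minus_def minus_add a_comm)
  have "Module.module (class_ring :: real ring) L"
  proof (intro Module.module.intro Module.module_axioms.intro)
    show "cring (class_ring :: real ring)" using real_module by (rule Module.module.axioms)
    show "abelian_group L"
    proof (rule abelian_groupI)
      show "\<exists>y\<in>carrier L. y \<oplus>\<^bsub>L\<^esub> x = \<zero>\<^bsub>L\<^esub>" if "x \<in> carrier L" for x
        using that L skews_minus skews_carrier by (intro bexI[of _ "\<ominus> x"]) (auto simp: l_neg)
    qed (use L in \<open>auto simp: skews_add skews_carrier a_ac, simp add: skews_def\<close>)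
  qed (use L in \<open>auto simp: class_ring_simps skews_smult smult_add_left smult_add_right smult_smult skews_carrier\<close>)
  then have "real_lie_algebra L" unfolding real_lie_algebra_def
    using skews_carrier commutator_jacobi by (simp add: L br skews_add skews_smult)
      (auto simp: skews_carrier a_minus_def r_neg l_distr r_distr minus_add a_ac
        smult_mult_left smult_mult_right smult_add_right smult_minus)
  then show ?thesis unfolding is_lie_algebra_of_def
    using has_dir_deriv_Ad by (simp add: L tangent_vectors_unitaries skews_carrier)
qed

end

section \<open>The free algebra and its quotient\<close>

abbreviation supp :: "('a \<Rightarrow> complex) \<Rightarrow> 'a set" where
  "supp f \<equiv> {w. f w \<noteq> 0}"

lemma free_algebra_simps:
  "carrier (free_algebra d) = {f. finite (supp f) \<and> supp f \<subseteq> lists {1..d}}"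
  "f \<otimes>\<^bsub>free_algebra d\<^esub> g = (\<lambda>w. \<Sum>k\<le>length w. f (take k w) * g (drop k w))"
  "\<one>\<^bsub>free_algebra d\<^esub> = (\<lambda>w. if w = [] then 1 else 0)"
  "\<zero>\<^bsub>free_algebra d\<^esub> = (\<lambda>w. 0)"
  "f \<oplus>\<^bsub>free_algebra d\<^esub> g = (\<lambda>w. f w + g w)"
  "c \<odot>\<^bsub>free_algebra d\<^esub> f = (\<lambda>w. c * f w)" by (simp_all add: free_algebra_def)

lemma free_mult_supp:
  "supp (f \<otimes>\<^bsub>free_algebra d\<^esub> g) \<subseteq> (\<lambda>(u, v). u @ v) ` (supp f \<times> supp g)"
proof
  fix w assume "w \<in> supp (f \<otimes>\<^bsub>free_algebra d\<^esub> g)"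
  then obtain k where "f (take k w) * g (drop k w) \<noteq> 0"
    unfolding free_algebra_simps using sum.not_neutral_contains_not_neutral by fastforce
  then show "w \<in> (\<lambda>(u, v). u @ v) ` (supp f \<times> supp g)"
    by (intro image_eqI[of _ _ "(take k w, drop k w)"]) auto
qed

lemma free_mult_closed:
  assumes "f \<in> carrier (free_algebra d)" "g \<in> carrier (free_algebra d)"
  shows "f \<otimes>\<^bsub>free_algebra d\<^esub> g \<in> carrier (free_algebra d)"
proof -
  have "finite ((\<lambda>(u, v). u @ v) ` (supp f \<times> supp g))"
    "(\<lambda>(u, v). u @ v) ` (supp f \<times> supp g) \<subseteq> lists {1..d}"
    using assms by (simp add: free_algebra_simps(1))
      (use assms in \<open>unfold free_algebra_simps(1), auto dest!: subsetD\<close>)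
  with free_mult_supp[where f = f and g = g and d = d] show ?thesis
    unfolding free_algebra_simps(1) by (auto intro: finite_subset)
qed

lemma free_mult_assoc:
  "(f \<otimes>\<^bsub>free_algebra d\<^esub> g) \<otimes>\<^bsub>free_algebra d\<^esub> h = f \<otimes>\<^bsub>free_algebra d\<^esub> (g \<otimes>\<^bsub>free_algebra d\<^esub> h)"
proof
  fix w :: "nat list"
  let ?n = "length w"
  have "((f \<otimes>\<^bsub>free_algebra d\<^esub> g) \<otimes>\<^bsub>free_algebra d\<^esub> h) w =
      (\<Sum>k\<le>?n. \<Sum>j\<le>k. f (take j w) * g (drop j (take k w)) * h (drop k w))"
    by (simp add: free_algebra_simps sum_distrib_right min_absorb1 min_absorb2)
  also have "\<dots> = (\<Sum>(k, j)\<in>(SIGMA k:{..?n}. {..k}). f (take j w) * g (drop j (take k w)) * h (drop k w))"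
    by (simp add: sum.Sigma)
  \<comment> \<open>Both sides sum over the ways to cut w into three pieces; i = k - j is the length
    of the middle piece.\<close>
  also have "\<dots> = (\<Sum>(j, i)\<in>(SIGMA j:{..?n}. {..?n - j}).
      f (take j w) * (g (take i (drop j w)) * h (drop i (drop j w))))"
    by (rule sum.reindex_bij_witness[of _ "\<lambda>(j, i). (i + j, j)" "\<lambda>(k, j). (j, k - j)"])
      (auto simp: drop_take mult.assoc)
  also have "\<dots> = (\<Sum>j\<le>?n. \<Sum>i\<le>?n - j. f (take j w) * (g (take i (drop j w)) * h (drop i (drop j w))))"
    by (simp add: sum.Sigma)
  also have "\<dots> = (f \<otimes>\<^bsub>free_algebra d\<^esub> (g \<otimes>\<^bsub>free_algebra d\<^esub> h)) w"
    by (simp add: free_algebra_simps sum_distrib_left)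
  finally show "((f \<otimes>\<^bsub>free_algebra d\<^esub> g) \<otimes>\<^bsub>free_algebra d\<^esub> h) w =
    (f \<otimes>\<^bsub>free_algebra d\<^esub> (g \<otimes>\<^bsub>free_algebra d\<^esub> h)) w" .
qed

lemma free_mult_word:
  "((\<lambda>v. if v = u then 1 else 0) \<otimes>\<^bsub>free_algebra d\<^esub> f) w =
     (if take (length u) w = u then f (drop (length u) w) else 0)"
proof -
  have "((\<lambda>v. if v = u then 1 else 0) \<otimes>\<^bsub>free_algebra d\<^esub> f) w =
      (\<Sum>k\<le>length w. if k = length u \<and> take (length u) w = u then f (drop k w) else 0)"
    unfolding free_algebra_simps by (intro sum.cong) auto
  also have "\<dots> = (if take (length u) w = u then f (drop (length u) w) else 0)"
  proof (cases "take (length u) w = u")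
    case True
    then have "length u \<le> length w" by (metis length_take min.cobounded1)
    then show ?thesis using True by (simp add: sum.delta)
  qed simp
  finally show ?thesis .
qed

lemma free_ring: "ring (free_algebra d)"
proof (rule ringI)
  have addc: "f \<oplus>\<^bsub>free_algebra d\<^esub> g \<in> carrier (free_algebra d)"
    if "f \<in> carrier (free_algebra d)" "g \<in> carrier (free_algebra d)" for f g
  proof -
    have "supp (\<lambda>w. f w + g w) \<subseteq> supp f \<union> supp g" by auto
    with that show ?thesis unfolding free_algebra_simps by (auto intro: finite_subset)
  qed
  show "abelian_group (free_algebra d)"
  proof (rule abelian_groupI)
    fix f assume f: "f \<in> carrier (free_algebra d)"
    then show "\<exists>g\<in>carrier (free_algebra d). g \<oplus>\<^bsub>free_algebra d\<^esub> f = \<zero>\<^bsub>free_algebra d\<^esub>"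
      by (intro bexI[of _ "\<lambda>w. - f w"]) (auto simp: free_algebra_simps)
  qed (auto simp: addc, auto simp: free_algebra_simps)
  show "monoid (free_algebra d)"
  proof (rule monoidI)
    show "\<one>\<^bsub>free_algebra d\<^esub> \<in> carrier (free_algebra d)" by (auto simp: free_algebra_simps)
    show "\<one>\<^bsub>free_algebra d\<^esub> \<otimes>\<^bsub>free_algebra d\<^esub> f = f" for f
      using free_mult_word[where u = "[]" and f = f and d = d] by (auto simp: free_algebra_simps(3))
    show "f \<otimes>\<^bsub>free_algebra d\<^esub> \<one>\<^bsub>free_algebra d\<^esub> = f" for f
    proof
      fix w
      have "(f \<otimes>\<^bsub>free_algebra d\<^esub> \<one>\<^bsub>free_algebra d\<^esub>) w = (\<Sum>k\<le>length w. if k = length w then f w else 0)"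
        unfolding free_algebra_simps by (intro sum.cong) auto
      then show "(f \<otimes>\<^bsub>free_algebra d\<^esub> \<one>\<^bsub>free_algebra d\<^esub>) w = f w" by simp
    qed
  qed (auto simp: free_mult_closed free_mult_assoc)
qed (auto simp: free_algebra_simps algebra_simps sum.distrib)

definition word_fun :: "nat list \<Rightarrow> nat list \<Rightarrow> complex" where
  "word_fun u = (\<lambda>w. if w = u then 1 else 0)"

lemma word_fun_carrier: "u \<in> lists {1..d} \<Longrightarrow> word_fun u \<in> carrier (free_algebra d)"
  by (auto simp: word_fun_def free_algebra_simps)

lemma free_gen_word: "free_gen k = word_fun [k]" by (auto simp: word_fun_def free_gen_def)

lemma word_fun_Nil: "word_fun [] = \<one>\<^bsub>free_algebra d\<^esub>"
  by (auto simp: word_fun_def free_algebra_simps)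

lemma word_fun_append: "word_fun (u @ v) = word_fun u \<otimes>\<^bsub>free_algebra d\<^esub> word_fun v"
proof
  fix w
  have "w = u @ v \<longleftrightarrow> take (length u) w = u \<and> drop (length u) w = v" by (metis append_eq_conv_conj)
  then show "word_fun (u @ v) w = (word_fun u \<otimes>\<^bsub>free_algebra d\<^esub> word_fun v) w"
    using free_mult_word[where u = u and f = "word_fun v" and d = d and w = w]
    by (simp add: word_fun_def)
qed

lemma free_smult_closed: "f \<in> carrier (free_algebra d) \<Longrightarrow> c \<odot>\<^bsub>free_algebra d\<^esub> f \<in> carrier (free_algebra d)"
  unfolding free_algebra_simps by (auto elim: rev_finite_subset)

lemma free_induct [consumes 1, case_names word add smult]:
  assumes "f \<in> carrier (free_algebra d)"
    and word: "\<And>w. w \<in> lists {1..d} \<Longrightarrow> P (word_fun w)"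
    and add: "\<And>f g. \<lbrakk>f \<in> carrier (free_algebra d); g \<in> carrier (free_algebra d); P f; P g\<rbrakk>
        \<Longrightarrow> P (f \<oplus>\<^bsub>free_algebra d\<^esub> g)"
    and smult: "\<And>c f. \<lbrakk>f \<in> carrier (free_algebra d); P f\<rbrakk> \<Longrightarrow> P (c \<odot>\<^bsub>free_algebra d\<^esub> f)"
  shows "P f"
proof -
  \<comment> \<open>Induction runs over a finite set containing the support, so a word can be split
    off even if its coefficient vanishes.\<close>
  have "\<And>f. \<lbrakk>S \<subseteq> lists {1..d}; supp f \<subseteq> S\<rbrakk> \<Longrightarrow> P f" if "finite S" for S using that
  proof induction
    case empty
    \<comment> \<open>The zero function is not a case of its own; it is obtained as 0 times the
      empty word.\<close>
    then have "f = 0 \<odot>\<^bsub>free_algebra d\<^esub> word_fun []" by (auto simp: free_algebra_simps)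
    then show ?case using word_fun_carrier[of "[]" d] by (simp add: smult word)
  next
    case (insert u S)
    define g where "g = (\<lambda>w. if w = u then 0 else f w)"
    have g: "supp g \<subseteq> S" using insert.prems by (auto simp: g_def)
    then have gc: "g \<in> carrier (free_algebra d)"
      using insert.prems insert.hyps by (auto simp: free_algebra_simps intro: finite_subset)
    have e: "f = f u \<odot>\<^bsub>free_algebra d\<^esub> word_fun u \<oplus>\<^bsub>free_algebra d\<^esub> g"
      by (auto simp: free_algebra_simps word_fun_def g_def)
    have u: "u \<in> lists {1..d}" using insert.prems by auto
    show ?case
      by (subst e, intro add smult word free_smult_closed word_fun_carrier u gc insert.IH g)
        (use insert.prems in auto)
  qed
  then show ?thesis using assms(1) by (auto simp: free_algebra_simps(1))
qed

lemma free_smult_mult: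
  "(c \<odot>\<^bsub>free_algebra d\<^esub> f) \<otimes>\<^bsub>free_algebra d\<^esub> g = c \<odot>\<^bsub>free_algebra d\<^esub> (f \<otimes>\<^bsub>free_algebra d\<^esub> g)"
  "f \<otimes>\<^bsub>free_algebra d\<^esub> (c \<odot>\<^bsub>free_algebra d\<^esub> g) = c \<odot>\<^bsub>free_algebra d\<^esub> (f \<otimes>\<^bsub>free_algebra d\<^esub> g)"
  by (auto simp: free_algebra_simps sum_distrib_left algebra_simps)

lemma gcliff_relations_carrier: "gcliff_relations m d \<subseteq> carrier (free_algebra d)"
proof -
  interpret F: ring "free_algebra d" by (rule free_ring)
  have "free_gen k \<in> carrier (free_algebra d)" if "k \<in> {1..d}" for k
    using that by (simp add: free_gen_word word_fun_carrier)
  then show ?thesis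
    unfolding gcliff_relations_def Let_def by (auto intro!: F.minus_closed F.nat_pow_closed F.m_closed free_smult_closed)
qed

lemma gcliff_ideal_is_ideal: "ideal (gcliff_ideal m d) (free_algebra d)"
  unfolding gcliff_ideal_def by (rule ring.genideal_ideal[OF free_ring gcliff_relations_carrier])

text \<open>\<open>gcliff\<close> and \<open>gcliff_real\<close> are new records assembled from the
  fields of an existing ring, so the ring axioms have to be carried over field by field.\<close>

lemma ring_cong:
  assumes "ring R" "carrier S = carrier R" "monoid.mult S = monoid.mult R" "one S = one R"
    "zero S = zero R" "add S = add R"
  shows "ring S"
proof -
  interpret R: ring R by fact
  show ?thesis
  proof (rule ringI)
    show "abelian_group S"
    proof (rule abelian_groupI)
      show "\<exists>y\<in>carrier S. y \<oplus>\<^bsub>S\<^esub> x = \<zero>\<^bsub>S\<^esub>" if "x \<in> carrier S" for x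
        using that assms R.l_neg by (metis R.a_inv_closed)
    qed (simp_all add: assms R.a_ac)
    show "monoid S" by (rule monoidI) (simp_all add: assms R.m_assoc)
  qed (simp_all add: assms R.l_distr R.r_distr)
qed

lemma gcliff_simps:
  "carrier (gcliff m d) = gcliff_class m d ` carrier (free_algebra d)"
  "\<one>\<^bsub>gcliff m d\<^esub> = gcliff_class m d \<one>\<^bsub>free_algebra d\<^esub>"
  "\<zero>\<^bsub>gcliff m d\<^esub> = gcliff_class m d \<zero>\<^bsub>free_algebra d\<^esub>"
proof -
  interpret I: ideal "gcliff_ideal m d" "free_algebra d" by (rule gcliff_ideal_is_ideal)
  show "carrier (gcliff m d) = gcliff_class m d ` carrier (free_algebra d)"
    by (auto simp: gcliff_def FactRing_def A_RCOSETS_def' gcliff_class_def Let_def)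
  show "\<one>\<^bsub>gcliff m d\<^esub> = gcliff_class m d \<one>\<^bsub>free_algebra d\<^esub>"
    by (simp add: gcliff_def FactRing_def gcliff_class_def Let_def)
  show "\<zero>\<^bsub>gcliff m d\<^esub> = gcliff_class m d \<zero>\<^bsub>free_algebra d\<^esub>"
    using I.a_rcos_zero[OF I.ideal_axioms] I.zero_closed
    by (simp add: gcliff_def FactRing_def gcliff_class_def Let_def)
qed

lemma gcliff_ring: "ring (gcliff m d)"
  by (rule ring_cong[OF ideal.quotient_is_ring[OF gcliff_ideal_is_ideal]]) (simp_all add: gcliff_def Let_def)

lemma gcliff_class_hom:
  assumes "f \<in> carrier (free_algebra d)" "g \<in> carrier (free_algebra d)"
  shows "gcliff_class m d f \<oplus>\<^bsub>gcliff m d\<^esub> gcliff_class m d g = gcliff_class m d (f \<oplus>\<^bsub>free_algebra d\<^esub> g)"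
    "gcliff_class m d f \<otimes>\<^bsub>gcliff m d\<^esub> gcliff_class m d g = gcliff_class m d (f \<otimes>\<^bsub>free_algebra d\<^esub> g)"
    "c \<odot>\<^bsub>gcliff m d\<^esub> gcliff_class m d f = gcliff_class m d (c \<odot>\<^bsub>free_algebra d\<^esub> f)"
proof -
  interpret I: ideal "gcliff_ideal m d" "free_algebra d" by (rule gcliff_ideal_is_ideal)
  interpret H: ring_hom_ring "free_algebra d" "free_algebra d Quot gcliff_ideal m d" "gcliff_class m d"
    using I.rcos_ring_hom_ring by (simp add: gcliff_class_def[abs_def])
  show "gcliff_class m d f \<oplus>\<^bsub>gcliff m d\<^esub> gcliff_class m d g = gcliff_class m d (f \<oplus>\<^bsub>free_algebra d\<^esub> g)"
    using assms by (simp add: gcliff_def Let_def)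
  show "gcliff_class m d f \<otimes>\<^bsub>gcliff m d\<^esub> gcliff_class m d g = gcliff_class m d (f \<otimes>\<^bsub>free_algebra d\<^esub> g)"
    using assms by (simp add: gcliff_def Let_def)
  have "c \<odot>\<^bsub>gcliff m d\<^esub> gcliff_class m d f =
      gcliff_class m d ((c \<odot>\<^bsub>free_algebra d\<^esub> \<one>\<^bsub>free_algebra d\<^esub>) \<otimes>\<^bsub>free_algebra d\<^esub> f)"
    using assms free_smult_closed[OF I.one_closed] by (simp add: gcliff_def Let_def)
  then show "c \<odot>\<^bsub>gcliff m d\<^esub> gcliff_class m d f = gcliff_class m d (c \<odot>\<^bsub>free_algebra d\<^esub> f)"
    using assms by (simp add: free_smult_mult)
qed

lemma gcliff_class_eqI:
  assumes "f \<in> carrier (free_algebra d)" "g \<in> carrier (free_algebra d)"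
    "f \<ominus>\<^bsub>free_algebra d\<^esub> g \<in> gcliff_relations m d"
  shows "gcliff_class m d f = gcliff_class m d g"
proof -
  interpret F: ring "free_algebra d" by (rule free_ring)
  have "f \<ominus>\<^bsub>free_algebra d\<^esub> g \<in> gcliff_ideal m d"
    using F.genideal_self[OF gcliff_relations_carrier] assms(3) unfolding gcliff_ideal_def by blast
  then show ?thesis using F.quotient_eq_iff_same_a_r_cos[OF gcliff_ideal_is_ideal assms(1,2)]
    by (simp add: gcliff_class_def)
qed

lemma gcliff_smult:
  assumes "U \<in> carrier (gcliff m d)" "V \<in> carrier (gcliff m d)"
  shows "c \<odot>\<^bsub>gcliff m d\<^esub> U \<in> carrier (gcliff m d)"
    "1 \<odot>\<^bsub>gcliff m d\<^esub> U = U"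
    "c \<odot>\<^bsub>gcliff m d\<^esub> (b \<odot>\<^bsub>gcliff m d\<^esub> U) = (c * b) \<odot>\<^bsub>gcliff m d\<^esub> U"
    "(c + b) \<odot>\<^bsub>gcliff m d\<^esub> U = c \<odot>\<^bsub>gcliff m d\<^esub> U \<oplus>\<^bsub>gcliff m d\<^esub> b \<odot>\<^bsub>gcliff m d\<^esub> U"
    "c \<odot>\<^bsub>gcliff m d\<^esub> (U \<oplus>\<^bsub>gcliff m d\<^esub> V) = c \<odot>\<^bsub>gcliff m d\<^esub> U \<oplus>\<^bsub>gcliff m d\<^esub> c \<odot>\<^bsub>gcliff m d\<^esub> V"
    "(c \<odot>\<^bsub>gcliff m d\<^esub> U) \<otimes>\<^bsub>gcliff m d\<^esub> V = c \<odot>\<^bsub>gcliff m d\<^esub> (U \<otimes>\<^bsub>gcliff m d\<^esub> V)"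
    "U \<otimes>\<^bsub>gcliff m d\<^esub> (c \<odot>\<^bsub>gcliff m d\<^esub> V) = c \<odot>\<^bsub>gcliff m d\<^esub> (U \<otimes>\<^bsub>gcliff m d\<^esub> V)"
proof -
  interpret F: ring "free_algebra d" by (rule free_ring)
  obtain f g where fg: "f \<in> carrier (free_algebra d)" "g \<in> carrier (free_algebra d)"
    and U: "U = gcliff_class m d f" and V: "V = gcliff_class m d g"
    using assms by (auto simp: gcliff_simps)
  note h = gcliff_class_hom(1,2) gcliff_class_hom(3)[where g = f] free_smult_closed fg
  show "c \<odot>\<^bsub>gcliff m d\<^esub> U \<in> carrier (gcliff m d)" using h by (simp add: U gcliff_simps)
  show "1 \<odot>\<^bsub>gcliff m d\<^esub> U = U" by (simp add: U h) (simp add: free_algebra_simps)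
  show "c \<odot>\<^bsub>gcliff m d\<^esub> (b \<odot>\<^bsub>gcliff m d\<^esub> U) = (c * b) \<odot>\<^bsub>gcliff m d\<^esub> U"
    by (simp add: U h) (simp add: free_algebra_simps mult.assoc)
  show "(c + b) \<odot>\<^bsub>gcliff m d\<^esub> U = c \<odot>\<^bsub>gcliff m d\<^esub> U \<oplus>\<^bsub>gcliff m d\<^esub> b \<odot>\<^bsub>gcliff m d\<^esub> U"
    by (simp add: U h) (simp add: free_algebra_simps distrib_right)
  show "c \<odot>\<^bsub>gcliff m d\<^esub> (U \<oplus>\<^bsub>gcliff m d\<^esub> V) = c \<odot>\<^bsub>gcliff m d\<^esub> U \<oplus>\<^bsub>gcliff m d\<^esub> c \<odot>\<^bsub>gcliff m d\<^esub> V"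
    by (simp add: U V h) (simp add: free_algebra_simps distrib_left)
  show "(c \<odot>\<^bsub>gcliff m d\<^esub> U) \<otimes>\<^bsub>gcliff m d\<^esub> V = c \<odot>\<^bsub>gcliff m d\<^esub> (U \<otimes>\<^bsub>gcliff m d\<^esub> V)"
    by (simp add: U V h free_smult_mult)
  show "U \<otimes>\<^bsub>gcliff m d\<^esub> (c \<odot>\<^bsub>gcliff m d\<^esub> V) = c \<odot>\<^bsub>gcliff m d\<^esub> (U \<otimes>\<^bsub>gcliff m d\<^esub> V)"
    by (simp add: U V h free_smult_mult)
qed

section \<open>The ordered monomials span the quotient\<close>

context
  fixes m d :: nat
begin

interpretation F: ring "free_algebra d" by (rule free_ring)
interpretation Cl: ring "gcliff m d" by (rule gcliff_ring)

lemma gcliff_class_carrier: "f \<in> carrier (free_algebra d) \<Longrightarrow> gcliff_class m d f \<in> carrier (gcliff m d)"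
  by (simp add: gcliff_simps)

lemma gcliff_class_pow:
  "f \<in> carrier (free_algebra d) \<Longrightarrow>
    gcliff_class m d (f [^]\<^bsub>free_algebra d\<^esub> (n::nat)) = gcliff_class m d f [^]\<^bsub>gcliff m d\<^esub> n"
  by (induction n) (simp_all add: gcliff_simps flip: gcliff_class_hom)

lemma free_gen_carrier: "k \<in> {1..d} \<Longrightarrow> free_gen k \<in> carrier (free_algebra d)"
  by (simp add: free_gen_word word_fun_carrier)

lemma gcliff_gen_carrier: "k \<in> {1..d} \<Longrightarrow> gcliff_gen m d k \<in> carrier (gcliff m d)"
  by (simp add: gcliff_gen_def gcliff_class_carrier free_gen_carrier)

lemma gcliff_gen_pow: "k \<in> {1..d} \<Longrightarrow> gcliff_gen m d k [^]\<^bsub>gcliff m d\<^esub> m = \<one>\<^bsub>gcliff m d\<^esub>"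
  unfolding gcliff_gen_def gcliff_simps gcliff_class_pow[OF free_gen_carrier, symmetric]
  by (rule gcliff_class_eqI) (auto simp: free_gen_carrier gcliff_relations_def Let_def)

lemma gcliff_gen_comm:
  assumes "1 \<le> k" "k < l" "l \<le> d"
  shows "gcliff_gen m d k \<otimes>\<^bsub>gcliff m d\<^esub> gcliff_gen m d l =
    root_omega m \<odot>\<^bsub>gcliff m d\<^esub> (gcliff_gen m d l \<otimes>\<^bsub>gcliff m d\<^esub> gcliff_gen m d k)"
proof -
  have c: "free_gen k \<in> carrier (free_algebra d)" "free_gen l \<in> carrier (free_algebra d)"
    using assms by (auto intro: free_gen_carrier)
  then have "gcliff_class m d (free_gen k \<otimes>\<^bsub>free_algebra d\<^esub> free_gen l) = gcliff_class m d
      (root_omega m \<odot>\<^bsub>free_algebra d\<^esub> (free_gen l \<otimes>\<^bsub>free_algebra d\<^esub> free_gen k))"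
    using assms by (intro gcliff_class_eqI) (auto simp: gcliff_relations_def Let_def free_smult_closed)
  with c show ?thesis by (simp add: gcliff_gen_def gcliff_class_hom)
qed

lemma gcliff_gen_comm_pow:
  assumes "1 \<le> k" "k < l" "l \<le> d"
  shows "gcliff_gen m d l \<otimes>\<^bsub>gcliff m d\<^esub> (gcliff_gen m d k [^]\<^bsub>gcliff m d\<^esub> (j::nat)) =
    (inverse (root_omega m)) ^ j \<odot>\<^bsub>gcliff m d\<^esub>
      ((gcliff_gen m d k [^]\<^bsub>gcliff m d\<^esub> j) \<otimes>\<^bsub>gcliff m d\<^esub> gcliff_gen m d l)"
proof -
  have c: "gcliff_gen m d k \<in> carrier (gcliff m d)" "gcliff_gen m d l \<in> carrier (gcliff m d)"
    using assms by (auto intro: gcliff_gen_carrier)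
  note sm = gcliff_smult[OF Cl.one_closed Cl.one_closed] gcliff_smult
  have w: "root_omega m \<noteq> 0" by (simp add: root_omega_def)
  have r: "gcliff_gen m d l \<otimes>\<^bsub>gcliff m d\<^esub> gcliff_gen m d k =
      inverse (root_omega m) \<odot>\<^bsub>gcliff m d\<^esub> (gcliff_gen m d k \<otimes>\<^bsub>gcliff m d\<^esub> gcliff_gen m d l)"
    using c w gcliff_gen_comm[OF assms] gcliff_smult(2,3)[of "gcliff_gen m d l \<otimes>\<^bsub>gcliff m d\<^esub> gcliff_gen m d k"]
    by simp
  show ?thesis
  proof (induction j)
    case 0
    then show ?case using c gcliff_smult(2)[of "gcliff_gen m d l"] by simp
  next
    case (Suc j)
    let ?P = "gcliff_gen m d k [^]\<^bsub>gcliff m d\<^esub> j"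
    have P: "?P \<in> carrier (gcliff m d)" using c by simp
    have "gcliff_gen m d l \<otimes>\<^bsub>gcliff m d\<^esub> (?P \<otimes>\<^bsub>gcliff m d\<^esub> gcliff_gen m d k) =
      (inverse (root_omega m) ^ j \<odot>\<^bsub>gcliff m d\<^esub> (?P \<otimes>\<^bsub>gcliff m d\<^esub> gcliff_gen m d l)) \<otimes>\<^bsub>gcliff m d\<^esub> gcliff_gen m d k"
      using c P by (simp add: Suc[symmetric] Cl.m_assoc)
    also have "\<dots> = inverse (root_omega m) ^ j \<odot>\<^bsub>gcliff m d\<^esub>
        (?P \<otimes>\<^bsub>gcliff m d\<^esub> (gcliff_gen m d l \<otimes>\<^bsub>gcliff m d\<^esub> gcliff_gen m d k))"
      using c P by (simp add: gcliff_smult(6) Cl.m_assoc)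
    also have "\<dots> = inverse (root_omega m) ^ Suc j \<odot>\<^bsub>gcliff m d\<^esub>
        ((?P \<otimes>\<^bsub>gcliff m d\<^esub> gcliff_gen m d k) \<otimes>\<^bsub>gcliff m d\<^esub> gcliff_gen m d l)"
      unfolding r using c P
      by (simp add: gcliff_smult(7) gcliff_smult(3)[where V = "\<one>\<^bsub>gcliff m d\<^esub>"] Cl.m_assoc mult.commute)
    finally show ?case using P by simp
  qed
qed

text \<open>\<open>gcliff_monomial\<close> with its list of letters as a parameter, so that
  induction on the list becomes possible.\<close>

definition mono_list :: "nat list \<Rightarrow> (nat \<Rightarrow> nat) \<Rightarrow> (nat list \<Rightarrow> complex) set" where
  "mono_list xs J =
     foldr (\<lambda>k U. (gcliff_gen m d k [^]\<^bsub>gcliff m d\<^esub> J k) \<otimes>\<^bsub>gcliff m d\<^esub> U) xs \<one>\<^bsub>gcliff m d\<^esub>"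

lemma mono_list_carrier: "set xs \<subseteq> {1..d} \<Longrightarrow> mono_list xs J \<in> carrier (gcliff m d)"
  by (induction xs) (auto simp: mono_list_def gcliff_gen_carrier)

text \<open>As \<open>xs\<close> is sorted, the letters passed on the way to the slot of l are
  smaller than l, and each passage costs a power of the inverse of \<open>root_omega m\<close>. In
  its slot the generator raises the exponent, which wraps to 0 at m because the m-th power is
  one.\<close>

lemma gen_mono_list:
  assumes "sorted_wrt (<) xs" "set xs \<subseteq> {1..d}" "l \<in> set xs" "J l < m"
  shows "\<exists>c. gcliff_gen m d l \<otimes>\<^bsub>gcliff m d\<^esub> mono_list xs J =
    c \<odot>\<^bsub>gcliff m d\<^esub> mono_list xs (J(l := Suc (J l) mod m))" using assms
proof (induction xs)
  case (Cons x ys)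
  let ?J = "J(l := Suc (J l) mod m)"
  let ?P = "gcliff_gen m d x [^]\<^bsub>gcliff m d\<^esub> J x"
  have c: "gcliff_gen m d x \<in> carrier (gcliff m d)" "gcliff_gen m d l \<in> carrier (gcliff m d)"
    using Cons.prems by (auto intro!: gcliff_gen_carrier)
  have M: "mono_list ys J' \<in> carrier (gcliff m d)" for J'
    using Cons.prems by (intro mono_list_carrier) auto
  have e: "mono_list (x # ys) J' = (gcliff_gen m d x [^]\<^bsub>gcliff m d\<^esub> J' x) \<otimes>\<^bsub>gcliff m d\<^esub> mono_list ys J'" for J'
    by (simp add: mono_list_def)
  show ?case
  proof (cases "l = x")
    case True
    then have "l \<notin> set ys" using Cons.prems by auto
    then have "mono_list ys J = mono_list ys ?J"
      unfolding mono_list_def by (intro foldr_cong) auto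
    moreover have "gcliff_gen m d x \<otimes>\<^bsub>gcliff m d\<^esub> ?P = gcliff_gen m d x [^]\<^bsub>gcliff m d\<^esub> ?J x"
    proof -
      have "gcliff_gen m d x \<otimes>\<^bsub>gcliff m d\<^esub> ?P = gcliff_gen m d x [^]\<^bsub>gcliff m d\<^esub> Suc (J x)"
        using c by (metis Cl.nat_pow_Suc2)
      also have "\<dots> = gcliff_gen m d x [^]\<^bsub>gcliff m d\<^esub> ?J x"
        using Cons.prems True gcliff_gen_pow[of x]
        by (cases "Suc (J x) = m") (auto simp del: Cl.nat_pow_Suc)
      finally show ?thesis .
    qed
    ultimately have "gcliff_gen m d l \<otimes>\<^bsub>gcliff m d\<^esub> mono_list (x # ys) J = mono_list (x # ys) ?J"
      unfolding e using c M True by (simp del: fun_upd_apply flip: Cl.m_assoc)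
    then show ?thesis using gcliff_smult(2)[of "mono_list (x # ys) ?J"] c M
      by (intro exI[of _ 1]) (simp add: e del: fun_upd_apply)
  next
    case False
    then have xl: "1 \<le> x" "x < l" "l \<le> d" using Cons.prems by auto
    obtain b where b: "gcliff_gen m d l \<otimes>\<^bsub>gcliff m d\<^esub> mono_list ys J = b \<odot>\<^bsub>gcliff m d\<^esub> mono_list ys ?J"
      using Cons.IH[OF _ _ _ Cons.prems(4)] Cons.prems False by (auto simp del: fun_upd_apply)
    have P: "?P \<in> carrier (gcliff m d)" using c by simp
    have "gcliff_gen m d l \<otimes>\<^bsub>gcliff m d\<^esub> mono_list (x # ys) J =
        (gcliff_gen m d l \<otimes>\<^bsub>gcliff m d\<^esub> ?P) \<otimes>\<^bsub>gcliff m d\<^esub> mono_list ys J"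
      using c M P by (simp add: e Cl.m_assoc)
    also have "\<dots> = inverse (root_omega m) ^ J x \<odot>\<^bsub>gcliff m d\<^esub>
        (?P \<otimes>\<^bsub>gcliff m d\<^esub> (gcliff_gen m d l \<otimes>\<^bsub>gcliff m d\<^esub> mono_list ys J))"
      unfolding gcliff_gen_comm_pow[OF xl] using c M P by (simp add: gcliff_smult(6) Cl.m_assoc)
    also have "\<dots> = (inverse (root_omega m) ^ J x * b) \<odot>\<^bsub>gcliff m d\<^esub> (?P \<otimes>\<^bsub>gcliff m d\<^esub> mono_list ys ?J)"
      unfolding b using M P by (simp add: gcliff_smult(7) gcliff_smult(3)[where V = "\<one>\<^bsub>gcliff m d\<^esub>"])
    finally show ?thesis using False unfolding e by (metis fun_upd_other)
  qed
qed simp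

lemma monomial_mono_list: "gcliff_monomial m d J = mono_list [1..<Suc d] J"
  by (simp only: gcliff_monomial_def mono_list_def)

lemma gcliff_monomial_carrier: "gcliff_monomial m d J \<in> carrier (gcliff m d)"
  unfolding monomial_mono_list by (rule mono_list_carrier) auto

lemma finite_multi_indices: "finite (multi_indices m d)"
  by (simp add: multi_indices_def finite_PiE)

lemma gcliff_word_monomial:
  assumes "m \<ge> 1" "w \<in> lists {1..d}"
  shows "\<exists>c. \<exists>J\<in>multi_indices m d. gcliff_class m d (word_fun w) = c \<odot>\<^bsub>gcliff m d\<^esub> gcliff_monomial m d J"
  using assms(2)
proof (induction w)
  case Nil
  have one: "mono_list xs (\<lambda>k\<in>{1..d}. 0) = \<one>\<^bsub>gcliff m d\<^esub>" if "set xs \<subseteq> {1..d}" for xs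
    using that by (induction xs) (auto simp: mono_list_def)
  have "gcliff_monomial m d (\<lambda>k\<in>{1..d}. 0) = \<one>\<^bsub>gcliff m d\<^esub>"
    unfolding monomial_mono_list by (rule one) auto
  moreover have "(\<lambda>k\<in>{1..d}. 0) \<in> multi_indices m d" using assms(1) by (auto simp: multi_indices_def)
  moreover have "gcliff_class m d (word_fun []) = 1 \<odot>\<^bsub>gcliff m d\<^esub> \<one>\<^bsub>gcliff m d\<^esub>"
    unfolding gcliff_smult(2)[OF Cl.one_closed Cl.one_closed]
    by (simp only: word_fun_Nil[of d] gcliff_simps(2))
  ultimately show ?case by metis
next
  case (Cons k w)
  then obtain c J where J: "J \<in> multi_indices m d"
    and e: "gcliff_class m d (word_fun w) = c \<odot>\<^bsub>gcliff m d\<^esub> gcliff_monomial m d J" by auto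
  have k: "k \<in> {1..d}" using Cons.hyps by auto
  have Jk: "J k < m" using J k by (auto simp: multi_indices_def PiE_iff)
  obtain b where b: "gcliff_gen m d k \<otimes>\<^bsub>gcliff m d\<^esub> gcliff_monomial m d J =
      b \<odot>\<^bsub>gcliff m d\<^esub> gcliff_monomial m d (J(k := Suc (J k) mod m))"
    unfolding monomial_mono_list using gen_mono_list[where l = k and J = J, OF sorted_wrt_upt _ _ Jk] k
    by (metis atLeastLessThanSuc_atLeastAtMost order_refl set_upt)
  have "gcliff_class m d (word_fun (k # w)) = gcliff_gen m d k \<otimes>\<^bsub>gcliff m d\<^esub> gcliff_class m d (word_fun w)"
    using word_fun_append[of "[k]" w d] k Cons.hyps
    by (simp add: gcliff_gen_def gcliff_class_hom free_gen_word word_fun_carrier)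
  also have "\<dots> = (c * b) \<odot>\<^bsub>gcliff m d\<^esub> gcliff_monomial m d (J(k := Suc (J k) mod m))"
    unfolding e using gcliff_gen_carrier[OF k] gcliff_monomial_carrier
    by (simp add: gcliff_smult(7) b gcliff_smult(3)[where V = "\<one>\<^bsub>gcliff m d\<^esub>"])
  finally have "gcliff_class m d (word_fun (k # w)) =
      (c * b) \<odot>\<^bsub>gcliff m d\<^esub> gcliff_monomial m d (J(k := Suc (J k) mod m))" .
  moreover have "J(k := Suc (J k) mod m) \<in> multi_indices m d"
    using J k assms(1) by (auto simp: multi_indices_def PiE_iff extensional_def)
  ultimately show ?case by (intro exI bexI)
qed

lemma gcliff_smult_zero: "U \<in> carrier (gcliff m d) \<Longrightarrow> 0 \<odot>\<^bsub>gcliff m d\<^esub> U = \<zero>\<^bsub>gcliff m d\<^esub>"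
  using gcliff_smult(1)[of U m d U 0] gcliff_smult(4)[of U m d U 0 0]
  by (metis Cl.add.l_cancel_one' add_0)

text \<open>Gives only the upper bound m^d for the dimension. That \<open>u\<close> is determined on
  the index set follows later from \<open>coef_lincomb\<close>, by means of the
  representations.\<close>

lemma gcliff_span:
  assumes "m \<ge> 1" "U \<in> carrier (gcliff m d)"
  shows "\<exists>u. U = (\<Oplus>\<^bsub>gcliff m d\<^esub>J\<in>multi_indices m d. u J \<odot>\<^bsub>gcliff m d\<^esub> gcliff_monomial m d J)"
proof -
  note M = gcliff_monomial_carrier
  have sM: "c \<odot>\<^bsub>gcliff m d\<^esub> gcliff_monomial m d J \<in> carrier (gcliff m d)" for c J
    using M gcliff_smult(1) by blast
  let ?S = "\<lambda>u. \<Oplus>\<^bsub>gcliff m d\<^esub>J\<in>multi_indices m d. u J \<odot>\<^bsub>gcliff m d\<^esub> gcliff_monomial m d J"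
  obtain f where f: "f \<in> carrier (free_algebra d)" "U = gcliff_class m d f"
    using assms(2) by (auto simp: gcliff_simps)
  have "\<exists>u. gcliff_class m d f = ?S u" using f(1)
  proof (induction rule: free_induct)
    case (word w)
    then obtain c J where J: "J \<in> multi_indices m d"
      and e: "gcliff_class m d (word_fun w) = c \<odot>\<^bsub>gcliff m d\<^esub> gcliff_monomial m d J"
      using gcliff_word_monomial[OF assms(1)] by blast
    have "?S (\<lambda>J'. if J = J' then c else 0) =
        (\<Oplus>\<^bsub>gcliff m d\<^esub>J'\<in>multi_indices m d.
          if J = J' then c \<odot>\<^bsub>gcliff m d\<^esub> gcliff_monomial m d J' else \<zero>\<^bsub>gcliff m d\<^esub>)"
      by (intro Cl.finsum_cong') (auto simp: sM gcliff_smult_zero M)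
    also have "\<dots> = c \<odot>\<^bsub>gcliff m d\<^esub> gcliff_monomial m d J"
      using Cl.finsum_singleton[OF J finite_multi_indices, of "\<lambda>J. c \<odot>\<^bsub>gcliff m d\<^esub> gcliff_monomial m d J"] sM
      by auto
    finally show ?case unfolding e by (intro exI[of _ "\<lambda>J'. if J = J' then c else 0"]) (rule sym)
  next
    case (add f g)
    then obtain u v where "gcliff_class m d f = ?S u" "gcliff_class m d g = ?S v" by blast
    then have "gcliff_class m d (f \<oplus>\<^bsub>free_algebra d\<^esub> g) = ?S u \<oplus>\<^bsub>gcliff m d\<^esub> ?S v"
      using add by (simp flip: gcliff_class_hom)
    also have "\<dots> = ?S (\<lambda>J. u J + v J)"
      by (subst Cl.finsum_addf[symmetric]) (auto simp: sM gcliff_smult(4)[OF M M])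
    finally show ?case by (rule exI[of _ "\<lambda>J. u J + v J"])
  next
    case (smult c f)
    then obtain u where u: "gcliff_class m d f = ?S u" by blast
    \<comment> \<open>A scalar acts as multiplication by c times the identity, so moving it into the
      sum becomes distributivity in the ring.\<close>
    have one: "(c \<odot>\<^bsub>gcliff m d\<^esub> \<one>\<^bsub>gcliff m d\<^esub>) \<otimes>\<^bsub>gcliff m d\<^esub> V = c \<odot>\<^bsub>gcliff m d\<^esub> V"
      if "V \<in> carrier (gcliff m d)" for V using that by (simp add: gcliff_smult(6))
    have "gcliff_class m d (c \<odot>\<^bsub>free_algebra d\<^esub> f) = (c \<odot>\<^bsub>gcliff m d\<^esub> \<one>\<^bsub>gcliff m d\<^esub>) \<otimes>\<^bsub>gcliff m d\<^esub> ?S u"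
      using smult gcliff_class_carrier[OF smult(1)] by (simp add: gcliff_class_hom(3) one flip: u)
    also have "\<dots> = (\<Oplus>\<^bsub>gcliff m d\<^esub>J\<in>multi_indices m d.
        (c \<odot>\<^bsub>gcliff m d\<^esub> \<one>\<^bsub>gcliff m d\<^esub>) \<otimes>\<^bsub>gcliff m d\<^esub> (u J \<odot>\<^bsub>gcliff m d\<^esub> gcliff_monomial m d J))"
      by (rule Cl.finsum_rdistr[OF finite_multi_indices])
        (use sM gcliff_smult(1)[OF Cl.one_closed Cl.one_closed] in auto)
    also have "\<dots> = ?S (\<lambda>J. c * u J)"
      by (intro Cl.finsum_cong') (auto simp: sM one gcliff_smult(3)[OF M M])
    finally show ?case by (rule exI[of _ "\<lambda>J. c * u J"])
  qed
  then show ?thesis using f(2) by simp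
qed

end

section \<open>Generalized Pauli matrices\<close>

lemma mat_adjoint_eq: "mat_adjoint A = mat (dim_col A) (dim_row A) (\<lambda>(i, j). cnj (A $$ (j, i)))"
  by (intro eq_matI) (auto simp: mat_adjoint_def mat_of_rows_def)

lemma mat_adjoint_simps [simp]:
  "dim_row (mat_adjoint (A :: complex mat)) = dim_col A" "dim_col (mat_adjoint A) = dim_row A"
  by (simp_all add: mat_adjoint_eq)

lemma mat_adjoint_carrier: "A \<in> carrier_mat n k \<Longrightarrow> mat_adjoint (A :: complex mat) \<in> carrier_mat k n"
  by (auto intro!: carrier_matI)

lemma mat_adjoint_index: "\<lbrakk>i < dim_col A; j < dim_row A\<rbrakk> \<Longrightarrow> mat_adjoint A $$ (i, j) = cnj (A $$ (j, i))"
  by (simp add: mat_adjoint_eq)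

lemma mat_adjoint_adjoint: "mat_adjoint (mat_adjoint (A :: complex mat)) = A"
  by (intro eq_matI) (auto simp: mat_adjoint_index)

lemma mat_adjoint_mult:
  assumes "A \<in> carrier_mat n k" "B \<in> carrier_mat k l"
  shows "mat_adjoint (A * B :: complex mat) = mat_adjoint B * mat_adjoint A"
  using assms by (intro eq_matI) (auto simp: mat_adjoint_index scalar_prod_def mult.commute intro!: sum.cong)

lemma mat_adjoint_smult: "mat_adjoint (c \<cdot>\<^sub>m A) = cnj c \<cdot>\<^sub>m mat_adjoint A"
  by (intro eq_matI) (auto simp: mat_adjoint_index)

lemma mat_adjoint_one: "mat_adjoint (1\<^sub>m n :: complex mat) = 1\<^sub>m n"
  by (intro eq_matI) (auto simp: mat_adjoint_index)

definition mat_unitary :: "nat \<Rightarrow> complex mat \<Rightarrow> bool" where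
  "mat_unitary n A \<longleftrightarrow> A \<in> carrier_mat n n \<and> mat_adjoint A * A = 1\<^sub>m n"

lemma mat_unitary_right: "mat_unitary n A \<Longrightarrow> A * mat_adjoint A = 1\<^sub>m n"
  using mat_mult_left_right_inverse[of "mat_adjoint A" n A] mat_adjoint_carrier
  by (auto simp: mat_unitary_def)

lemma mat_unitary_mult: "\<lbrakk>mat_unitary n A; mat_unitary n B\<rbrakk> \<Longrightarrow> mat_unitary n (A * B)"
proof -
  assume AB: "mat_unitary n A" "mat_unitary n B"
  then have c: "A \<in> carrier_mat n n" "B \<in> carrier_mat n n"
    "mat_adjoint A \<in> carrier_mat n n" "mat_adjoint B \<in> carrier_mat n n"
    by (auto simp: mat_unitary_def mat_adjoint_carrier)
  have "mat_adjoint (A * B) * (A * B) = mat_adjoint B * (mat_adjoint A * (A * B))"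
    using c by (simp add: mat_adjoint_mult[OF c(1,2)] assoc_mult_mat[of _ n n _ n _ n])
  also have "mat_adjoint A * (A * B) = (mat_adjoint A * A) * B"
    using c by (intro assoc_mult_mat[symmetric])
  also have "\<dots> = B" using AB c by (simp only: mat_unitary_def left_mult_one_mat)
  finally show ?thesis using AB c by (simp add: mat_unitary_def)
qed

lemma mat_unitary_one: "mat_unitary n (1\<^sub>m n)" by (simp add: mat_unitary_def mat_adjoint_one)

lemma mat_unitary_pow: "mat_unitary n A \<Longrightarrow> mat_unitary n (A ^\<^sub>m k)"
proof (induction k)
  case 0
  then have "dim_row A = n" by (auto simp: mat_unitary_def)
  then show ?case by (simp add: mat_unitary_one)
qed (simp add: mat_unitary_mult)

lemma mat_unitary_smult: "\<lbrakk>mat_unitary n A; norm c = 1\<rbrakk> \<Longrightarrow> mat_unitary n (c \<cdot>\<^sub>m A)"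
proof -
  assume A: "mat_unitary n A" and c: "norm c = 1"
  then have "A \<in> carrier_mat n n" "mat_adjoint A \<in> carrier_mat n n"
    by (auto simp: mat_unitary_def mat_adjoint_carrier)
  note c1 = this
  have "cnj c * c = 1" using c by (metis complex_norm_square mult.commute of_real_1 one_power2)
  then have "cnj c \<cdot>\<^sub>m (c \<cdot>\<^sub>m (1\<^sub>m n)) = 1\<^sub>m n" by (intro eq_matI) auto
  moreover have "mat_adjoint (c \<cdot>\<^sub>m A) * (c \<cdot>\<^sub>m A) = cnj c \<cdot>\<^sub>m (c \<cdot>\<^sub>m (mat_adjoint A * A))"
    unfolding mat_adjoint_smult using c1
    by (simp only: mult_smult_assoc_mat[of _ n n _ n] mult_smult_distrib[of _ n n _ n] smult_carrier_mat)
      (intro eq_matI, simp_all add: mult.left_commute)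
  ultimately show ?thesis using A c1 by (simp add: mat_unitary_def)
qed

subsection \<open>Kronecker products\<close>

text \<open>The Kronecker product. \<open>n\<close> stands for the size of \<open>B\<close>; a row
  or column index i encodes the pair of i div n and i mod n.\<close>

definition kron :: "nat \<Rightarrow> complex mat \<Rightarrow> complex mat \<Rightarrow> complex mat" where
  "kron n A B = mat (dim_row A * n) (dim_col A * n)
     (\<lambda>(i, j). A $$ (i div n, j div n) * B $$ (i mod n, j mod n))"

lemma kron_carrier: "A \<in> carrier_mat p p \<Longrightarrow> kron n A B \<in> carrier_mat (p * n) (p * n)"
  by (auto simp: kron_def)

lemma sum_div_mod:
  fixes f :: "nat \<Rightarrow> nat \<Rightarrow> 'a::comm_monoid_add"
  shows "(\<Sum>k<p * n. f (k div n) (k mod n)) = (\<Sum>i<p. \<Sum>j<n. f i j)"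
proof (cases "n = 0")
  case False
  have "i * n + j < p * n" if "i < p" "j < n" for i j
  proof -
    have "i * n + j < Suc i * n" using that by simp
    also have "\<dots> \<le> p * n" using that by (intro mult_le_mono1) simp
    finally show ?thesis .
  qed
  then have "(\<Sum>k<p * n. f (k div n) (k mod n)) = (\<Sum>(i, j)\<in>{..<p} \<times> {..<n}. f i j)" using False
    by (intro sum.reindex_bij_witness[of _ "\<lambda>(i, j). i * n + j" "\<lambda>k. (k div n, k mod n)"])
      (auto simp: less_mult_imp_div_less)
  then show ?thesis by (simp add: sum.cartesian_product)
qed simp

lemma kron_index:
  "\<lbrakk>A \<in> carrier_mat p p; i < p * n; j < p * n\<rbrakk>
    \<Longrightarrow> kron n A B $$ (i, j) = A $$ (i div n, j div n) * B $$ (i mod n, j mod n)"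
  by (auto simp: kron_def)

lemma kron_mult:
  assumes "A \<in> carrier_mat p p" "B \<in> carrier_mat n n" "A' \<in> carrier_mat p p" "B' \<in> carrier_mat n n"
  shows "kron n A B * kron n A' B' = kron n (A * A') (B * B')"
proof (rule eq_matI)
  have c: "kron n A B \<in> carrier_mat (p * n) (p * n)" "kron n A' B' \<in> carrier_mat (p * n) (p * n)"
    "kron n (A * A') (B * B') \<in> carrier_mat (p * n) (p * n)"
    using assms by (auto intro: kron_carrier mult_carrier_mat)
  then show "dim_row (kron n A B * kron n A' B') = dim_row (kron n (A * A') (B * B'))"
    "dim_col (kron n A B * kron n A' B') = dim_col (kron n (A * A') (B * B'))" by auto
  fix i j assume "i < dim_row (kron n (A * A') (B * B'))" "j < dim_col (kron n (A * A') (B * B'))"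
  then have ij: "i < p * n" "j < p * n" using c by auto
  then have n: "n > 0" by (metis mult_0_right neq0_conv not_less0)
  have d: "i div n < p" "j div n < p" using ij by (simp_all add: less_mult_imp_div_less)
  have "(kron n A B * kron n A' B') $$ (i, j) =
     (\<Sum>k<p * n. kron n A B $$ (i, k) * kron n A' B' $$ (k, j))"
    using c ij by (simp add: scalar_prod_def atLeast0LessThan)
  also have "\<dots> = (\<Sum>k<p * n. A $$ (i div n, k div n) * B $$ (i mod n, k mod n)
      * (A' $$ (k div n, j div n) * B' $$ (k mod n, j mod n)))"
    using assms ij by (intro sum.cong) (auto simp: kron_index)
  also have "\<dots> = (\<Sum>k<p. \<Sum>l<n. A $$ (i div n, k) * B $$ (i mod n, l)
      * (A' $$ (k, j div n) * B' $$ (l, j mod n)))" by (rule sum_div_mod)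
  also have "\<dots> = (\<Sum>k<p. A $$ (i div n, k) * A' $$ (k, j div n)) *
      (\<Sum>l<n. B $$ (i mod n, l) * B' $$ (l, j mod n))" by (simp add: sum_product algebra_simps)
  also have "\<dots> = (A * A') $$ (i div n, j div n) * (B * B') $$ (i mod n, j mod n)"
    using assms d n by (simp add: scalar_prod_def atLeast0LessThan)
  also have "\<dots> = kron n (A * A') (B * B') $$ (i, j)"
    using assms ij by (intro kron_index[symmetric, where p = p]) auto
  finally show "(kron n A B * kron n A' B') $$ (i, j) = kron n (A * A') (B * B') $$ (i, j)" .
qed

lemma kron_one: "kron n (1\<^sub>m p) (1\<^sub>m n) = 1\<^sub>m (p * n)"
proof (rule eq_matI)
  fix i j assume ij: "i < dim_row (1\<^sub>m (p * n) :: complex mat)" "j < dim_col (1\<^sub>m (p * n) :: complex mat)"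
  then have n: "n > 0" by (metis index_one_mat(2) mult_0_right neq0_conv not_less0)
  have "i div n = j div n \<and> i mod n = j mod n \<longleftrightarrow> i = j" by (metis div_mult_mod_eq)
  then show "kron n (1\<^sub>m p) (1\<^sub>m n) $$ (i, j) = (1\<^sub>m (p * n) :: complex mat) $$ (i, j)"
    using ij n by (auto simp: kron_def less_mult_imp_div_less)
qed (auto simp: kron_def)

lemma kron_adjoint:
  assumes "A \<in> carrier_mat p p" "B \<in> carrier_mat n n"
  shows "mat_adjoint (kron n A B) = kron n (mat_adjoint A) (mat_adjoint B)"
proof (rule eq_matI)
  fix i j assume "i < dim_row (kron n (mat_adjoint A) (mat_adjoint B))"
    "j < dim_col (kron n (mat_adjoint A) (mat_adjoint B))"
  then have ij: "i < p * n" "j < p * n" using assms by (auto simp: kron_def)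
  then have n: "n > 0" by (metis mult_0_right neq0_conv not_less0)
  have d: "i div n < p" "j div n < p" using ij by (simp_all add: less_mult_imp_div_less)
  show "mat_adjoint (kron n A B) $$ (i, j) = kron n (mat_adjoint A) (mat_adjoint B) $$ (i, j)"
    using assms ij n d mat_adjoint_carrier[OF assms(1)]
    by (simp add: mat_adjoint_index kron_index kron_carrier kron_def)
qed (use assms in \<open>auto simp: kron_def\<close>)

lemma kron_smult_left:
  "A \<in> carrier_mat p p \<Longrightarrow> kron n (c \<cdot>\<^sub>m A) B = c \<cdot>\<^sub>m kron n A B"
  by (intro eq_matI) (auto simp: kron_def less_mult_imp_div_less)

lemma kron_smult_right:
  "\<lbrakk>A \<in> carrier_mat p p; B \<in> carrier_mat n n\<rbrakk> \<Longrightarrow> kron n A (c \<cdot>\<^sub>m B) = c \<cdot>\<^sub>m kron n A B"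
proof (intro eq_matI)
  assume AB: "A \<in> carrier_mat p p" "B \<in> carrier_mat n n"
  fix i j assume "i < dim_row (c \<cdot>\<^sub>m kron n A B)" "j < dim_col (c \<cdot>\<^sub>m kron n A B)"
  then have ij: "i < p * n" "j < p * n" using AB by (auto simp: kron_def)
  then have "n > 0" by (metis mult_0_right neq0_conv not_less0)
  then show "kron n A (c \<cdot>\<^sub>m B) $$ (i, j) = (c \<cdot>\<^sub>m kron n A B) $$ (i, j)"
    using AB ij by (simp add: kron_def)
qed (auto simp: kron_def)

lemma kron_pow:
  assumes "A \<in> carrier_mat p p" "B \<in> carrier_mat n n"
  shows "kron n A B ^\<^sub>m k = kron n (A ^\<^sub>m k) (B ^\<^sub>m k)"
proof (induction k)
  case 0
  have "dim_row (kron n A B) = p * n" using assms by (auto simp: kron_def)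
  then show ?case using assms by (simp add: kron_one)
next
  case (Suc k)
  then show ?case using assms by (simp add: kron_mult[where p = p])
qed

lemma kron_unitary:
  assumes "mat_unitary p A" "mat_unitary n B" shows "mat_unitary (p * n) (kron n A B)" using assms
  by (auto simp: mat_unitary_def kron_carrier kron_adjoint[where p = p] kron_mult[where p = p] mat_adjoint_carrier kron_one)

section \<open>Roots of unity and weighted shift matrices\<close>

lemma root_omega_pow: "root_omega m ^ j = exp (2 * of_real pi * \<i> * of_nat j / of_nat m)"
  by (simp add: root_omega_def flip: exp_of_nat_mult) (simp add: mult_ac)

lemma root_omega_nonzero [simp]: "root_omega m \<noteq> 0" by (simp add: root_omega_def)

lemma root_omega_pow_m: "m \<ge> 1 \<Longrightarrow> root_omega m ^ m = 1"
  using exp_two_pi_i by (simp add: root_omega_pow)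

lemma root_omega_pow_eq_iff:
  "\<lbrakk>j < m; k < m\<rbrakk> \<Longrightarrow> root_omega m ^ j = root_omega m ^ k \<longleftrightarrow> j = k"
  using complex_root_unity_eq[of m j k] by (simp add: root_omega_pow)

lemma norm_root_omega [simp]: "norm (root_omega m) = 1"
  by (simp add: root_omega_def norm_exp_eq_Re)

lemma root_omega_pow_mod: "m \<ge> 1 \<Longrightarrow> root_omega m ^ (j mod m) = root_omega m ^ j"
proof -
  assume m: "m \<ge> 1"
  have "root_omega m ^ j = root_omega m ^ (m * (j div m) + j mod m)" by simp
  also have "\<dots> = root_omega m ^ (j mod m)"
    unfolding power_add power_mult root_omega_pow_m[OF m] by simp
  finally show ?thesis by simp
qed

text \<open>The weighted cyclic shift that sends the b-th basis vector to \<open>g b\<close> times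
  the one with index b + s modulo m. Clock and shift belong to this family, which is closed under
  products, so matrix relations reduce to identities between weights.\<close>

definition shift_mat :: "nat \<Rightarrow> nat \<Rightarrow> (nat \<Rightarrow> complex) \<Rightarrow> complex mat" where
  "shift_mat m s g = mat m m (\<lambda>(a, b). if a = (b + s) mod m then g b else 0)"

lemma shift_mat_cong:
  "\<lbrakk>s mod m = s' mod m; \<And>b. b < m \<Longrightarrow> g b = g' b\<rbrakk> \<Longrightarrow> shift_mat m s g = shift_mat m s' g'"
  unfolding shift_mat_def by (intro eq_matI) (auto, metis mod_add_cong, metis mod_add_cong)

lemma shift_mat_smult: "c \<cdot>\<^sub>m shift_mat m s g = shift_mat m s (\<lambda>b. c * g b)"
  unfolding shift_mat_def by (intro eq_matI) auto

lemma shift_mat_one: "shift_mat m 0 (\<lambda>b. 1) = 1\<^sub>m m"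
  unfolding shift_mat_def by (intro eq_matI) auto

lemma shift_mat_mult:
  "shift_mat m s g * shift_mat m s' g' = shift_mat m (s + s') (\<lambda>b. g ((b + s') mod m) * g' b)"
proof (rule eq_matI)
  fix a b assume "a < dim_row (shift_mat m (s + s') (\<lambda>b. g ((b + s') mod m) * g' b))"
    "b < dim_col (shift_mat m (s + s') (\<lambda>b. g ((b + s') mod m) * g' b))"
  then have ab: "a < m" "b < m" by (auto simp: shift_mat_def)
  let ?k = "(b + s') mod m"
  have "(shift_mat m s g * shift_mat m s' g') $$ (a, b) =
      (\<Sum>k<m. (if a = (k + s) mod m then g k else 0) * (if k = ?k then g' b else 0))"
    using ab by (simp add: shift_mat_def scalar_prod_def atLeast0LessThan)
  also have "\<dots> = (\<Sum>k<m. if k = ?k then (if a = (?k + s) mod m then g ?k else 0) * g' b else 0)"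
    by (intro sum.cong) auto
  also have "\<dots> = (if a = (?k + s) mod m then g ?k else 0) * g' b"
    using ab by (subst sum.delta) auto
  also have "(?k + s) mod m = (b + (s + s')) mod m" by (simp add: mod_simps ac_simps)
  also have "(if a = (b + (s + s')) mod m then g ?k else 0) * g' b =
      shift_mat m (s + s') (\<lambda>b. g ((b + s') mod m) * g' b) $$ (a, b)"
    using ab by (simp add: shift_mat_def)
  finally show "(shift_mat m s g * shift_mat m s' g') $$ (a, b) =
      shift_mat m (s + s') (\<lambda>b. g ((b + s') mod m) * g' b) $$ (a, b)" .
qed (auto simp: shift_mat_def)

lemma shift_mat_pow:
  "shift_mat m s g ^\<^sub>m k = shift_mat m (k * s) (\<lambda>b. \<Prod>i<k. g ((b + i * s) mod m))"
proof (induction k)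
  case 0
  then show ?case by (simp add: shift_mat_one) (simp add: shift_mat_def)
next
  case (Suc k)
  have "(\<Prod>i<k. g (((b + s) mod m + i * s) mod m)) * g b = (\<Prod>i<Suc k. g ((b + i * s) mod m))" if "b < m" for b
    using that by (simp add: prod.lessThan_Suc_shift mod_simps add.assoc mult.commute del: prod.lessThan_Suc)
  then show ?case
    unfolding pow_mat.simps Suc shift_mat_mult by (intro shift_mat_cong) (auto simp: add.commute)
qed

lemma shift_mat_unitary:
  assumes "\<And>b. b < m \<Longrightarrow> norm (g b) = 1" shows "mat_unitary m (shift_mat m s g)"
  unfolding mat_unitary_def
proof (intro conjI eq_matI)
  fix a b assume "a < dim_row (1\<^sub>m m :: complex mat)" "b < dim_col (1\<^sub>m m :: complex mat)"
  then have ab: "a < m" "b < m" by auto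
  have inj: "(a + s) mod m = (b + s) mod m \<longleftrightarrow> a = b"
  proof
    assume "(a + s) mod m = (b + s) mod m"
    \<comment> \<open>Over the naturals, adding m * s - s does the work of subtracting s modulo
      m.\<close>
    then have "(a + s + (m * s - s)) mod m = (b + s + (m * s - s)) mod m" by (rule mod_add_cong) simp
    moreover have "x + s + (m * s - s) = x + m * s" for x using ab by (cases m) auto
    ultimately show "a = b" using ab by simp
  qed simp
  have n: "cnj (g b) * g b = 1"
    using assms[OF ab(2)] by (metis complex_norm_square mult.commute of_real_1 one_power2)
  have "(mat_adjoint (shift_mat m s g) * shift_mat m s g) $$ (a, b) =
      (\<Sum>k<m. cnj (if k = (a + s) mod m then g a else 0) * (if k = (b + s) mod m then g b else 0))"
    using ab by (simp add: shift_mat_def scalar_prod_def atLeast0LessThan mat_adjoint_index)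
  also have "\<dots> = (\<Sum>k<m. if k = (b + s) mod m then (if k = (a + s) mod m then cnj (g a) else 0) * g b else 0)"
    by (intro sum.cong) auto
  also have "\<dots> = (if (b + s) mod m = (a + s) mod m then cnj (g a) else 0) * g b"
    using ab by (subst sum.delta) auto
  also have "\<dots> = (1\<^sub>m m :: complex mat) $$ (a, b)" using ab inj n by auto
  finally show "(mat_adjoint (shift_mat m s g) * shift_mat m s g) $$ (a, b) = (1\<^sub>m m :: complex mat) $$ (a, b)" .
qed (auto simp: shift_mat_def)

text \<open>In the m-th power of a weighted shift by one, every diagonal entry is the product of all
  weights, read from a different starting point; hence that power is scalar.\<close>

lemma prod_rotate: "(m::nat) \<ge> 1 \<Longrightarrow> (\<Prod>i<m. g ((b + i) mod m)) = (\<Prod>i<m. g i :: 'a::comm_monoid_mult)"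
proof (induction b)
  case (Suc b)
  then obtain l where l: "m = Suc l" by (cases m) auto
  have "(Suc b + l) mod Suc l = b mod Suc l" by (metis add_Suc_shift mod_add_self2)
  then have "(\<Prod>i<m. g ((Suc b + i) mod m)) = (\<Prod>i<l. g ((b + Suc i) mod m)) * g ((b + 0) mod m)"
    unfolding l prod.lessThan_Suc by simp
  also have "\<dots> = (\<Prod>i<m. g ((b + i) mod m))"
    unfolding l prod.lessThan_Suc_shift by (simp add: mult.commute)
  finally show ?case using Suc by simp
qed (auto intro: prod.cong)

section \<open>Unitary matrices that satisfy the defining relations\<close>

definition unitary_system :: "nat \<Rightarrow> nat \<Rightarrow> nat \<Rightarrow> (nat \<Rightarrow> complex mat) \<Rightarrow> bool" where
  "unitary_system m d n E \<longleftrightarrow> (\<forall>k\<in>{1..d}. mat_unitary n (E k) \<and> E k ^\<^sub>m m = 1\<^sub>m n) \<and>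
     (\<forall>k l. 1 \<le> k \<and> k < l \<and> l \<le> d \<longrightarrow> E k * E l = root_omega m \<cdot>\<^sub>m (E l * E k))"

lemma unitary_systemD:
  assumes "unitary_system m d n E"
  shows "k \<in> {1..d} \<Longrightarrow> mat_unitary n (E k)" "k \<in> {1..d} \<Longrightarrow> E k ^\<^sub>m m = 1\<^sub>m n"
    "1 \<le> k \<and> k < l \<and> l \<le> d \<Longrightarrow> E k * E l = root_omega m \<cdot>\<^sub>m (E l * E k)"
proof -
  have 1: "\<forall>k\<in>{1..d}. mat_unitary n (E k) \<and> E k ^\<^sub>m m = 1\<^sub>m n"
    and 2: "\<forall>k l. 1 \<le> k \<and> k < l \<and> l \<le> d \<longrightarrow> E k * E l = root_omega m \<cdot>\<^sub>m (E l * E k)"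
    using assms[unfolded unitary_system_def] by (rule conjunct1, rule conjunct2)
  show "k \<in> {1..d} \<Longrightarrow> mat_unitary n (E k)" "k \<in> {1..d} \<Longrightarrow> E k ^\<^sub>m m = 1\<^sub>m n"
    by (rule conjunct1[OF bspec[OF 1]], assumption, rule conjunct2[OF bspec[OF 1]], assumption)
  show "1 \<le> k \<and> k < l \<and> l \<le> d \<Longrightarrow> E k * E l = root_omega m \<cdot>\<^sub>m (E l * E k)" by (rule 2[rule_format])
qed

lemma unitary_system_mono:
  assumes "unitary_system m d n E" "d' \<le> d" shows "unitary_system m d' n E"
proof -
  note D = unitary_systemD[OF assms(1)]
  show ?thesis unfolding unitary_system_def
    by (intro conjI ballI allI impI D) (use assms(2) in simp_all)
qed

text \<open>\<open>Z\<close> is the clock matrix, \<open>X\<close> the shift matrix, and \<open>T\<close> is \<open>X Z\<^sup>-\<^sup>1\<close> up to the scalar \<open>c\<close> that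
  makes its \<open>m\<close>-th power the identity.\<close>

lemma clock_shift_exists:
  assumes m: "m \<ge> 1"
  obtains Z X T where "mat_unitary m Z" "mat_unitary m X" "mat_unitary m T"
    "Z ^\<^sub>m m = 1\<^sub>m m" "X ^\<^sub>m m = 1\<^sub>m m" "T ^\<^sub>m m = 1\<^sub>m m"
    "Z * X = root_omega m \<cdot>\<^sub>m (X * Z)" "Z * T = root_omega m \<cdot>\<^sub>m (T * Z)"
    "X * T = root_omega m \<cdot>\<^sub>m (T * X)"
proof -
  let ?w = "root_omega m"
  have m0: "m \<noteq> 0" using m by simp
  \<comment> \<open>The product of all m-th roots of unity is (-1)^(m-1), so for even m the scalar
    cannot be taken to be 1.\<close>
  obtain c where c: "(\<Prod>b<m. ?w ^ b) = c ^ m" by (rule exists_complex_root[OF m0])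
  have "norm (c ^ m) = 1" unfolding c[symmetric] by (simp add: prod_norm[symmetric] norm_power)
  then have "norm c ^ m = 1" by (simp add: norm_power)
  then have nc: "norm c = 1" using power_eq_iff_eq_base[of m "norm c" 1] m0 by simp
  define Z where "Z = shift_mat m 0 (\<lambda>b. ?w ^ b)"
  define X where "X = shift_mat m 1 (\<lambda>b. 1)"
  define T where "T = shift_mat m 1 (\<lambda>b. c * inverse ?w ^ b)"
  have wm: "(?w ^ b) ^ m = 1" for b 
   unfolding power_mult[symmetric] mult.commute[of b m] unfolding power_mult root_omega_pow_m[OF m] by simp
  have ws: "?w ^ ((b + 1) mod m) = ?w * ?w ^ b" for b using root_omega_pow_mod[OF m, of "b + 1"] by simp
  have wi: "inverse ?w ^ ((b + 1) mod m) = inverse ?w * inverse ?w ^ b" for b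
    unfolding power_inverse ws by simp
  show ?thesis
  proof
    show "mat_unitary m Z" "mat_unitary m X" "mat_unitary m T"
      unfolding Z_def X_def T_def using nc
      by (auto intro!: shift_mat_unitary simp: norm_power norm_mult norm_inverse)
    have prodT: "(\<Prod>b<m. c * inverse ?w ^ b) = 1"
    proof -
      have "(\<Prod>b<m. c * inverse ?w ^ b) = c ^ m * (\<Prod>b<m. inverse (?w ^ b))"
        by (simp add: prod.distrib power_inverse)
      also have "(\<Prod>b<m. inverse (?w ^ b)) = inverse (c ^ m)"
        using prod_inversef[of "\<lambda>b. ?w ^ b" "{..<m}"] c by (simp add: comp_def)
      also have "c ^ m * inverse (c ^ m) = 1" using nc by (intro right_inverse) auto
      finally show ?thesis .
    qed
    show "Z ^\<^sub>m m = 1\<^sub>m m" "X ^\<^sub>m m = 1\<^sub>m m" "T ^\<^sub>m m = 1\<^sub>m m"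
      unfolding Z_def X_def T_def shift_mat_pow shift_mat_one[symmetric]
      using prod_rotate[OF m, of "\<lambda>b. c * inverse ?w ^ b"] prodT wm
      by (auto intro!: shift_mat_cong)
    show "Z * X = ?w \<cdot>\<^sub>m (X * Z)"
      unfolding Z_def X_def shift_mat_mult shift_mat_smult ws by (rule shift_mat_cong) simp_all
    show "Z * T = ?w \<cdot>\<^sub>m (T * Z)"
      unfolding Z_def T_def shift_mat_mult shift_mat_smult ws by (rule shift_mat_cong) simp_all
    show "X * T = ?w \<cdot>\<^sub>m (T * X)"
      unfolding X_def T_def shift_mat_mult shift_mat_smult wi by (rule shift_mat_cong) simp_all
  qed
qed

text \<open>Each step turns matrices E_k of size n into Z \<otimes> 1, X \<otimes> 1 and T \<otimes>
  E_k of size m n, gaining two. Relations that involve one of the first two come from Z, X and T;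
  between T \<otimes> E_k and T \<otimes> E_l the left factors commute, and the phase comes from E_k
  and E_l.\<close>

lemma unitary_system_odd:
  assumes m: "m \<ge> 1"
  shows "\<exists>E. unitary_system m (2 * r + 1) (m ^ r) E"
proof (induction r)
  case 0
  have "(1\<^sub>m 1 :: complex mat) ^\<^sub>m k = 1\<^sub>m 1" for k by (induction k) auto
  then have "unitary_system m 1 1 (\<lambda>_. 1\<^sub>m 1)" by (auto simp: unitary_system_def mat_unitary_one)
  then show ?case by auto
next
  case (Suc r)
  then obtain E where E: "unitary_system m (2 * r + 1) (m ^ r) E" by blast
  let ?n = "m ^ r"
  obtain Z X T where U: "mat_unitary m Z" "mat_unitary m X" "mat_unitary m T"
    and P: "Z ^\<^sub>m m = 1\<^sub>m m" "X ^\<^sub>m m = 1\<^sub>m m" "T ^\<^sub>m m = 1\<^sub>m m"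
    and C: "Z * X = root_omega m \<cdot>\<^sub>m (X * Z)" "Z * T = root_omega m \<cdot>\<^sub>m (T * Z)"
      "X * T = root_omega m \<cdot>\<^sub>m (T * X)" using clock_shift_exists[OF m] by blast
  define F where "F k = (if k = 1 then kron ?n Z (1\<^sub>m ?n) else if k = 2 then kron ?n X (1\<^sub>m ?n)
    else kron ?n T (E (k - 2)))" for k
  have c: "Z \<in> carrier_mat m m" "X \<in> carrier_mat m m" "T \<in> carrier_mat m m"
    using U by (auto simp: mat_unitary_def)
  have EU: "mat_unitary ?n (E k)" "E k ^\<^sub>m m = 1\<^sub>m ?n" "E k \<in> carrier_mat ?n ?n" if "k \<in> {1..2 * r + 1}" for k
    using unitary_systemD(1,2)[OF E that] by (auto simp: mat_unitary_def)
  have one_pow: "(1\<^sub>m ?n :: complex mat) ^\<^sub>m k = 1\<^sub>m ?n" for k by (induction k) auto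
  have "unitary_system m (2 * Suc r + 1) (m * ?n) F" unfolding unitary_system_def
  proof (intro conjI ballI allI impI)
    fix k assume "k \<in> {1..2 * Suc r + 1}"
    then consider "k = 1" | "k = 2" | "2 < k" "k - 2 \<in> {1..2 * r + 1}" by fastforce
    note k = this
    show "mat_unitary (m * ?n) (F k)"
      using k U EU(1)[of "k - 2"] by cases (auto simp: F_def intro!: kron_unitary mat_unitary_one)
    show "F k ^\<^sub>m m = 1\<^sub>m (m * ?n)"
      using k c P EU(2,3)[of "k - 2"] by cases (auto simp: F_def kron_pow[where p = m] one_pow kron_one)
  next
    fix k l assume kl: "1 \<le> k \<and> k < l \<and> l \<le> 2 * Suc r + 1"
    have El: "E (l - 2) \<in> carrier_mat ?n ?n" if "2 < l" by (rule EU(3)) (use kl that in auto)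
    consider "k = 1" "l = 2" | "k = 1" "2 < l" | "k = 2" "2 < l" | "2 < k" "2 < l"
      using kl by linarith
    then show "F k * F l = root_omega m \<cdot>\<^sub>m (F l * F k)"
    proof cases
      case 4
      then have Ek: "E (k - 2) \<in> carrier_mat ?n ?n" by (intro EU(3)) (use kl in auto)
      have "E (k - 2) * E (l - 2) = root_omega m \<cdot>\<^sub>m (E (l - 2) * E (k - 2))"
      proof -
        have "1 \<le> k - 2 \<and> k - 2 < l - 2 \<and> l - 2 \<le> 2 * r + 1" using kl 4 by arith
        then show ?thesis by (rule unitary_systemD(3)[OF E])
      qed
      then show ?thesis
        using 4 c Ek El by (simp add: F_def kron_mult[where p = m] kron_smult_right[where p = m])
    qed (use c C El in \<open>auto simp: F_def kron_mult[where p = m] kron_smult_left[where p = m]\<close>)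
  qed
  then show ?case by auto
qed

text \<open>The odd construction gives 2 (d div 2) + 1 matrices of the required size; for even d the
  last one is dropped.\<close>

lemma unitary_system_exists:
  assumes "m \<ge> 1" "d \<ge> 1" shows "\<exists>E. unitary_system m d (m ^ (d div 2)) E"
proof -
  have "d \<le> 2 * (d div 2) + 1" by simp
  then show ?thesis using unitary_system_odd[OF assms(1)] unitary_system_mono by blast
qed

subsection \<open>Orthogonality of the monomials\<close>

definition mono_mat :: "nat \<Rightarrow> (nat \<Rightarrow> complex mat) \<Rightarrow> nat list \<Rightarrow> (nat \<Rightarrow> nat) \<Rightarrow> complex mat" where
  "mono_mat n E xs J = foldr (\<lambda>k M. (E k ^\<^sub>m J k) * M) xs (1\<^sub>m n)"

definition mat_trace :: "nat \<Rightarrow> complex mat \<Rightarrow> complex" where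
  "mat_trace n A = (\<Sum>i<n. A $$ (i, i))"

lemma mat_trace_comm:
  assumes "A \<in> carrier_mat n n" "B \<in> carrier_mat n n"
  shows "mat_trace n (A * B) = mat_trace n (B * A)"
proof -
  have "mat_trace n (A * B) = (\<Sum>i<n. \<Sum>k<n. A $$ (i, k) * B $$ (k, i))"
    using assms by (simp add: mat_trace_def scalar_prod_def atLeast0LessThan)
  also have "\<dots> = (\<Sum>k<n. \<Sum>i<n. A $$ (i, k) * B $$ (k, i))" by (rule sum.swap)
  also have "\<dots> = mat_trace n (B * A)"
    using assms by (simp add: mat_trace_def scalar_prod_def atLeast0LessThan mult.commute)
  finally show ?thesis .
qed

lemma mat_trace_smult: "A \<in> carrier_mat n n \<Longrightarrow> mat_trace n (c \<cdot>\<^sub>m A) = c * mat_trace n A"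
  by (simp add: mat_trace_def sum_distrib_left)

lemma smult_one_mat: "1 \<cdot>\<^sub>m (U :: complex mat) = U" by (intro eq_matI) simp_all

definition comm_phase :: "nat \<Rightarrow> nat \<Rightarrow> nat \<Rightarrow> complex" where
  "comm_phase m k l = (if k < l then root_omega m else if k = l then 1 else inverse (root_omega m))"

text \<open>The eigenvalue of conjugation by the k-th matrix on the monomial with letters
  \<open>xs\<close> and exponents \<open>J\<close>, as \<open>E_comm_mono\<close> shows.\<close>

definition mono_phase :: "nat \<Rightarrow> nat \<Rightarrow> nat list \<Rightarrow> (nat \<Rightarrow> nat) \<Rightarrow> complex" where
  "mono_phase m k xs J = (\<Prod>l\<leftarrow>xs. comm_phase m k l ^ J l)"

lemma norm_comm_phase: "norm (comm_phase m k l) = 1" by (simp add: comm_phase_def norm_inverse)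

lemma norm_mono_phase: "norm (mono_phase m k xs J) = 1"
  by (induction xs) (simp_all add: mono_phase_def norm_mult norm_power norm_comm_phase)

context
  fixes m d n :: nat and E :: "nat \<Rightarrow> complex mat"
  assumes sys: "unitary_system m d n E"
begin

lemma E_unitary: "k \<in> {1..d} \<Longrightarrow> mat_unitary n (E k)" by (rule unitary_systemD(1)[OF sys])

lemma E_carrier: "k \<in> {1..d} \<Longrightarrow> E k \<in> carrier_mat n n"
  using E_unitary[of k] unfolding mat_unitary_def by simp

lemma mono_mat_unitary: "set xs \<subseteq> {1..d} \<Longrightarrow> mat_unitary n (mono_mat n E xs J)"
proof (induction xs)
  case (Cons x xs)
  have "mat_unitary n (E x ^\<^sub>m J x * mono_mat n E xs J)"
    using Cons by (intro mat_unitary_mult mat_unitary_pow E_unitary) auto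
  then show ?case by (simp add: mono_mat_def)
qed (simp add: mono_mat_def mat_unitary_one)

lemma mono_mat_carrier: "set xs \<subseteq> {1..d} \<Longrightarrow> mono_mat n E xs J \<in> carrier_mat n n"
  using mono_mat_unitary[of xs J] unfolding mat_unitary_def by simp

lemma E_comm_phase:
  assumes "k \<in> {1..d}" "l \<in> {1..d}"
  shows "E k * E l = comm_phase m k l \<cdot>\<^sub>m (E l * E k)"
proof -
  note c = E_carrier[OF assms(1)] E_carrier[OF assms(2)]
  consider "k < l" | "k = l" | "l < k" by linarith
  then show ?thesis
  proof cases
    case 1
    then have "E k * E l = root_omega m \<cdot>\<^sub>m (E l * E k)"
      using assms by (intro unitary_systemD(3)[OF sys]) auto
    then show ?thesis using 1 by (simp only: comm_phase_def if_True)
  next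
    case 2
    have "comm_phase m k k \<cdot>\<^sub>m (E k * E k) = E k * E k"
      using c(1) by (intro eq_matI) (auto simp: comm_phase_def)
    then show ?thesis using 2 by (simp only:)
  next
    case 3
    have e: "E l * E k = root_omega m \<cdot>\<^sub>m (E k * E l)"
      using assms 3 by (intro unitary_systemD(3)[OF sys]) auto
    have "E k * E l = inverse (root_omega m) \<cdot>\<^sub>m (root_omega m \<cdot>\<^sub>m (E k * E l))"
      using c by (intro eq_matI) simp_all
    then show ?thesis using 3 unfolding e[symmetric] by (simp add: comm_phase_def)
  qed
qed

lemma comm_phase_mult:
  fixes A B U :: "complex mat"
  assumes "A \<in> carrier_mat n n" "B \<in> carrier_mat n n" "U \<in> carrier_mat n n"
    and "U * A = p \<cdot>\<^sub>m (A * U)" "U * B = q \<cdot>\<^sub>m (B * U)"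
  shows "U * (A * B) = (p * q) \<cdot>\<^sub>m (A * B * U)"
proof -
  have "U * (A * B) = U * A * B" using assms(1-3) by (intro assoc_mult_mat[symmetric])
  also have "\<dots> = p \<cdot>\<^sub>m (A * U * B)" unfolding assms(4)
    by (rule mult_smult_assoc_mat[of _ n n _ n]) (use assms(1-3) in simp_all)
  also have "A * U * B = A * (U * B)" using assms(1-3) by (intro assoc_mult_mat)
  also have "\<dots> = q \<cdot>\<^sub>m (A * (B * U))" unfolding assms(5)
    by (rule mult_smult_distrib[of _ n n _ n]) (use assms(1-3) in simp_all)
  also have "A * (B * U) = A * B * U" using assms(1-3) by (intro assoc_mult_mat[symmetric])
  also have "p \<cdot>\<^sub>m (q \<cdot>\<^sub>m (A * B * U)) = (p * q) \<cdot>\<^sub>m (A * B * U)" by (intro eq_matI) simp_all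
  finally show ?thesis .
qed

lemma E_comm_pow:
  assumes "k \<in> {1..d}" "l \<in> {1..d}"
  shows "E k * (E l ^\<^sub>m j) = (comm_phase m k l ^ j) \<cdot>\<^sub>m ((E l ^\<^sub>m j) * E k)"
proof (induction j)
  case 0
  then show ?case using E_carrier[OF assms(1)] E_carrier[OF assms(2)] by (simp add: smult_one_mat)
next
  case (Suc j)
  have "E k * (E l ^\<^sub>m j * E l) = (comm_phase m k l ^ j * comm_phase m k l) \<cdot>\<^sub>m (E l ^\<^sub>m j * E l * E k)"
    by (rule comm_phase_mult[OF _ _ _ Suc E_comm_phase[OF assms]])
      (use E_carrier[OF assms(1)] E_carrier[OF assms(2)] in simp_all)
  then show ?case by (simp only: pow_mat.simps power_Suc2)
qed

lemma E_comm_mono: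
  assumes k: "k \<in> {1..d}" and "set xs \<subseteq> {1..d}"
  shows "E k * mono_mat n E xs J = mono_phase m k xs J \<cdot>\<^sub>m (mono_mat n E xs J * E k)"
  using assms(2)
proof (induction xs)
  case Nil
  then show ?case using E_carrier[OF k] by (simp add: mono_mat_def mono_phase_def smult_one_mat)
next
  case (Cons x xs)
  then have x: "x \<in> {1..d}" and xs: "set xs \<subseteq> {1..d}" by auto
  have "E k * (E x ^\<^sub>m J x * mono_mat n E xs J) =
      (comm_phase m k x ^ J x * mono_phase m k xs J) \<cdot>\<^sub>m (E x ^\<^sub>m J x * mono_mat n E xs J * E k)"
    by (rule comm_phase_mult[OF _ _ _ E_comm_pow[OF k x] Cons.IH[OF xs]])
      (use E_carrier[OF k] E_carrier[OF x] mono_mat_carrier[OF xs] in simp_all)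
  moreover have "mono_mat n E (x # xs) J = E x ^\<^sub>m J x * mono_mat n E xs J"
    "mono_phase m k (x # xs) J = comm_phase m k x ^ J x * mono_phase m k xs J"
    by (simp_all add: mono_mat_def mono_phase_def)
  ultimately show ?case by (simp only:)
qed

text \<open>The trace form is invariant under conjugation by the unitary \<open>U\<close>, and
  \<open>A\<close> and \<open>B\<close> are eigenvectors of that conjugation with eigenvalues
  \<open>p\<close> and \<open>q\<close>.\<close>

lemma trace_phase:
  assumes U: "mat_unitary n U" and A: "A \<in> carrier_mat n n" and B: "B \<in> carrier_mat n n"
    and "U * A = p \<cdot>\<^sub>m (A * U)" "U * B = q \<cdot>\<^sub>m (B * U)"
  shows "mat_trace n (mat_adjoint A * B) = cnj p * q * mat_trace n (mat_adjoint A * B)"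
proof -
  have Uc: "U \<in> carrier_mat n n" "mat_adjoint U \<in> carrier_mat n n" "mat_adjoint A \<in> carrier_mat n n"
    using U A mat_adjoint_carrier unfolding mat_unitary_def by blast+
  note as = assoc_mult_mat[of _ n n _ n _ n]
  have "mat_adjoint A * B = mat_adjoint A * ((mat_adjoint U * U) * B)"
    using U B by (simp add: mat_unitary_def)
  also have "\<dots> = mat_adjoint A * (mat_adjoint U * (U * B))"
    using Uc B by (simp only: as mult_carrier_mat[of _ n n _ n])
  also have "\<dots> = mat_adjoint A * mat_adjoint U * (U * B)"
    by (rule as[symmetric]) (use Uc B in simp_all)
  also have "mat_adjoint A * mat_adjoint U = mat_adjoint (U * A)"
    using mat_adjoint_mult[OF Uc(1) A] by (rule sym)
  also have "mat_adjoint (U * A) = cnj p \<cdot>\<^sub>m (mat_adjoint U * mat_adjoint A)"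
    unfolding assms(4) mat_adjoint_smult mat_adjoint_mult[OF A Uc(1)] by (rule refl)
  also have "cnj p \<cdot>\<^sub>m (mat_adjoint U * mat_adjoint A) * (U * B) =
      (cnj p * q) \<cdot>\<^sub>m (mat_adjoint U * mat_adjoint A * (B * U))"
  proof -
    have "cnj p \<cdot>\<^sub>m (mat_adjoint U * mat_adjoint A) * (U * B) =
        cnj p \<cdot>\<^sub>m (mat_adjoint U * mat_adjoint A * (q \<cdot>\<^sub>m (B * U)))"
      unfolding assms(5) by (rule mult_smult_assoc_mat[of _ n n _ n]) (use Uc A B in \<open>simp_all add: mult_carrier_mat[of _ n n _ n]\<close>)
    also have "mat_adjoint U * mat_adjoint A * (q \<cdot>\<^sub>m (B * U)) = q \<cdot>\<^sub>m (mat_adjoint U * mat_adjoint A * (B * U))"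
      by (rule mult_smult_distrib[of _ n n _ n]) (use Uc A B in \<open>simp_all add: mult_carrier_mat[of _ n n _ n]\<close>)
    also have "cnj p \<cdot>\<^sub>m (q \<cdot>\<^sub>m (mat_adjoint U * mat_adjoint A * (B * U))) =
        (cnj p * q) \<cdot>\<^sub>m (mat_adjoint U * mat_adjoint A * (B * U))" by (intro eq_matI) simp_all
    finally show ?thesis .
  qed
  finally have "mat_trace n (mat_adjoint A * B) =
      mat_trace n ((cnj p * q) \<cdot>\<^sub>m (mat_adjoint U * mat_adjoint A * (B * U)))" by (rule arg_cong)
  also have "\<dots> = cnj p * q * mat_trace n (mat_adjoint U * mat_adjoint A * (B * U))"
    by (rule mat_trace_smult) (use Uc A B in \<open>simp add: mult_carrier_mat[of _ n n _ n]\<close>)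
  also have "mat_adjoint U * mat_adjoint A * (B * U) = mat_adjoint U * (mat_adjoint A * B * U)"
    using Uc A B by (simp only: as mult_carrier_mat[of _ n n _ n])
  also have "mat_trace n (mat_adjoint U * (mat_adjoint A * B * U)) =
      mat_trace n (mat_adjoint A * B * U * mat_adjoint U)"
    by (rule mat_trace_comm) (use Uc A B in \<open>simp_all add: mult_carrier_mat[of _ n n _ n]\<close>)
  also have "mat_adjoint A * B * U * mat_adjoint U = mat_adjoint A * B * (U * mat_adjoint U)"
    by (rule as) (use Uc A B in \<open>simp_all add: mult_carrier_mat[of _ n n _ n]\<close>)
  also have "\<dots> = mat_adjoint A * B"
    unfolding mat_unitary_right[OF U] by (rule right_mult_one_mat[of _ n]) (use Uc A B in \<open>simp add: mult_carrier_mat[of _ n n _ n]\<close>)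
  finally show ?thesis .
qed

lemma mono_mat_trace:
  assumes "set xs \<subseteq> {1..d}" "k \<in> {1..d}" "mono_phase m k xs J \<noteq> mono_phase m k xs K"
  shows "mat_trace n (mat_adjoint (mono_mat n E xs J) * mono_mat n E xs K) = 0"
proof -
  let ?p = "mono_phase m k xs J" and ?q = "mono_phase m k xs K"
  \<comment> \<open>As p has modulus one, cnj p is its inverse, and the product could be 1 only for
    q = p.\<close>
  have "cnj ?p * ?q \<noteq> 1"
  proof
    assume "cnj ?p * ?q = 1"
    then have "?p * cnj ?p * ?q = ?p" by (simp add: mult.assoc)
    moreover have "?p * cnj ?p = 1"
      using complex_norm_square[of ?p] norm_mono_phase[of m k xs J] by simp
    ultimately show False using assms(3) by simp
  qed
  then show ?thesis
    using trace_phase[OF E_unitary[OF assms(2)] mono_mat_carrier[OF assms(1)] mono_mat_carrier[OF assms(1)]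
        E_comm_mono[OF assms(2,1)] E_comm_mono[OF assms(2,1)], of J K]
    by (metis mult_cancel_right1)
qed

end

text \<open>If \<open>P k\<close> is the product of the first \<open>k\<close> values, then the hypothesis forces \<open>P k\<close> to be \<open>P d\<close>
  for odd \<open>k\<close> and \<open>1\<close> for even \<open>k\<close>.\<close>

lemma alternating_products:
  fixes z :: "nat \<Rightarrow> complex"
  assumes nz: "\<And>k. z k \<noteq> 0" and d: "d \<ge> 1"
    and h: "\<And>k. k \<in> {1..d} \<Longrightarrow> (\<Prod>l=1..k. z l) * (\<Prod>l=1..k-1. z l) = (\<Prod>l=1..d. z l)"
    and e: "even d \<or> z d = 1" and k: "k \<in> {1..d}"
  shows "z k = 1"
proof -
  define P where "P k = (\<Prod>l=1..k. z l)" for k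
  have Pnz: "P k \<noteq> 0" for k using nz by (simp add: P_def)
  have PS: "P (Suc k) = P k * z (Suc k)" for k by (simp add: P_def)
  have h': "P k * P (k - 1) = P d" if "k \<in> {1..d}" for k using h[OF that] by (simp add: P_def)
  have alt: "P k = (if odd k then P d else 1)" if "k \<le> d" for k using that
  proof (induction k)
    case 0
    then show ?case by (simp add: P_def)
  next
    case (Suc k)
    then have "P (Suc k) * P k = P d" using h'[of "Suc k"] by simp
    then show ?case using Suc Pnz[of d] by (auto split: if_splits)
  qed
  have "P d = 1"
  proof (cases "even d")
    case True
    then show ?thesis using alt[of d] by simp
  next
    case False
    then obtain c where c: "d = Suc c" using d by (cases d) auto
    with False have "P c = 1" using alt[of c] by simp
    then show ?thesis using PS[of c] e False c by simp
  qed
  then have one: "P k = 1" if "k \<le> d" for k using alt[OF that] by simp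
  obtain c where c: "k = Suc c" using k by (cases k) auto
  then show ?thesis using PS[of c] one[of k] one[of c] k by simp
qed

text \<open>The k-th phase is the product of the powers of \<omega> for letters above k divided by
  the product for letters below k. With z l the quotient of the powers for \<open>K\<close> and
  \<open>J\<close>, equal phases say that the z above k and the z below k have the same product;
  multiplying by the product of the z up to k gives the hypothesis of
  \<open>alternating_products\<close>.\<close>

lemma mono_phase_eq_imp:
  assumes d: "d \<ge> 1" and eq: "\<And>k. k \<in> {1..d} \<Longrightarrow> mono_phase m k [1..<Suc d] J = mono_phase m k [1..<Suc d] K"
    and e: "even d \<or> root_omega m ^ J d = root_omega m ^ K d" and k: "k \<in> {1..d}"
  shows "root_omega m ^ J k = root_omega m ^ K k"
proof -
  let ?w = "root_omega m"
  define z where "z l = ?w ^ K l / ?w ^ J l" for l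
  have nz: "z l \<noteq> 0" for l by (simp add: z_def)
  have split: "mono_phase m k [1..<Suc d] J = (\<Prod>l=Suc k..d. ?w ^ J l) * inverse (\<Prod>l=1..k-1. ?w ^ J l)"
    if k: "k \<in> {1..d}" for k J
  proof -
    have "mono_phase m k [1..<Suc d] J = (\<Prod>l\<in>set [1..<Suc d]. comm_phase m k l ^ J l)"
      unfolding mono_phase_def by (rule prod.distinct_set_conv_list[OF distinct_upt, symmetric])
    also have "set [1..<Suc d] = {1..d}" by (simp only: set_upt atLeastLessThanSuc_atLeastAtMost)
    also have "{1..d} = insert k ({1..k-1} \<union> {Suc k..d})" using k by auto
    also have "(\<Prod>l\<in>\<dots>. comm_phase m k l ^ J l) =
        (\<Prod>l\<in>{1..k-1} \<union> {Suc k..d}. comm_phase m k l ^ J l)"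
      using k by (subst prod.insert) (auto simp: comm_phase_def)
    also have "\<dots> = (\<Prod>l=1..k-1. comm_phase m k l ^ J l) * (\<Prod>l=Suc k..d. comm_phase m k l ^ J l)"
      by (rule prod.union_disjoint) auto
    also have "(\<Prod>l=1..k-1. comm_phase m k l ^ J l) = (\<Prod>l=1..k-1. inverse (?w ^ J l))"
      using k by (intro prod.cong) (auto simp: comm_phase_def power_inverse)
    also have "\<dots> = inverse (\<Prod>l=1..k-1. ?w ^ J l)"
      using prod_inversef[of "\<lambda>l. ?w ^ J l" "{1..k-1}"] by (simp add: comp_def)
    also have "(\<Prod>l=Suc k..d. comm_phase m k l ^ J l) = (\<Prod>l=Suc k..d. ?w ^ J l)"
      by (intro prod.cong) (auto simp: comm_phase_def)
    finally show ?thesis by (simp add: mult.commute)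
  qed
  have h: "(\<Prod>l=1..k. z l) * (\<Prod>l=1..k-1. z l) = (\<Prod>l=1..d. z l)" if k: "k \<in> {1..d}" for k
  proof -
    define a b a' b' where "a = (\<Prod>l=Suc k..d. ?w ^ J l)" and "b = (\<Prod>l=1..k-1. ?w ^ J l)"
      and "a' = (\<Prod>l=Suc k..d. ?w ^ K l)" and "b' = (\<Prod>l=1..k-1. ?w ^ K l)"
    have nz': "a \<noteq> 0" "b \<noteq> 0" "a' \<noteq> 0" "b' \<noteq> 0" by (simp_all add: a_def b_def a'_def b'_def)
    have "a * inverse b = a' * inverse b'"
      using eq[OF k] unfolding split[OF k] a_def b_def a'_def b'_def .
    then have "a' / a = b' / b" using nz' by (simp add: field_simps)
    then have "(\<Prod>l=Suc k..d. z l) = (\<Prod>l=1..k-1. z l)"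
      unfolding z_def prod_dividef a_def b_def a'_def b'_def .
    moreover have "(\<Prod>l=1..d. z l) = (\<Prod>l=1..k. z l) * (\<Prod>l=Suc k..d. z l)"
    proof -
      have "{1..d} = {1..k} \<union> {Suc k..d}" using k by auto
      then show ?thesis by (simp only:) (rule prod.union_disjoint, auto)
    qed
    ultimately show ?thesis by simp
  qed
  have "z k = 1" by (rule alternating_products[OF nz d h _ k]) (use e in \<open>auto simp: z_def\<close>)
  then show ?thesis by (simp add: z_def)
qed

text \<open>A geometric sum whose ratio is an m-th root of unity and equals 1 exactly for j =
  k.\<close>

lemma omega_geometric:
  assumes "j < m" "k < m"
  shows "(\<Sum>i<m. cnj (root_omega m ^ (i * j)) * root_omega m ^ (i * k)) = (if j = k then of_nat m else 0)"
proof -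
  let ?w = "root_omega m"
  define r where "r = cnj (?w ^ j) * ?w ^ k"
  have n: "cnj (?w ^ j) * ?w ^ j = 1" for j
    using complex_norm_square[of "?w ^ j"] by (simp add: norm_power mult.commute)
  have r1: "r = 1 \<longleftrightarrow> j = k"
  proof
    assume "r = 1"
    have "?w ^ j * r = (cnj (?w ^ j) * ?w ^ j) * ?w ^ k" by (simp only: r_def mult_ac)
    then have "?w ^ k = ?w ^ j" unfolding n[of j] \<open>r = 1\<close> by (simp only: mult_1_left mult_1_right)
    then show "j = k" using root_omega_pow_eq_iff[OF assms] by simp
  next
    assume "j = k"
    then show "r = 1" unfolding r_def using n[of k] by (simp only:)
  qed
  have m: "m \<ge> 1" using assms by simp
  have w1: "(?w ^ j) ^ m = 1" for j
    unfolding power_mult[symmetric] mult.commute[of j m] unfolding power_mult root_omega_pow_m[OF m] by simp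
  have rm: "r ^ m = 1" unfolding r_def power_mult_distrib complex_cnj_power[symmetric] w1 by simp
  have "(\<Sum>i<m. cnj (?w ^ (i * j)) * ?w ^ (i * k)) = (\<Sum>i<m. r ^ i)"
    by (intro sum.cong) (auto simp: r_def power_mult_distrib mult.commute[of _ j] mult.commute[of _ k] simp flip: power_mult)
  also have "\<dots> = (if j = k then of_nat m else 0)" using r1 rm by (simp add: sum_gp_strict)
  finally show ?thesis .
qed

definition rep_count :: "nat \<Rightarrow> nat \<Rightarrow> nat" where
  "rep_count m d = (if even d then 1 else m)"

text \<open>For odd d the central element e_1 e_2^(-1) e_3 ... e_d contains e_d to the first power,
  so this change multiplies its image by the i-th power of \<omega> and tells the representations
  apart. For even d only i = 0 is taken, which changes nothing.\<close>

definition twist :: "nat \<Rightarrow> nat \<Rightarrow> (nat \<Rightarrow> complex mat) \<Rightarrow> nat \<Rightarrow> nat \<Rightarrow> complex mat" where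
  "twist m d E i = E(d := root_omega m ^ i \<cdot>\<^sub>m E d)"

lemma pow_mat_smult: "A \<in> carrier_mat n n \<Longrightarrow> (c \<cdot>\<^sub>m A) ^\<^sub>m k = (c ^ k :: complex) \<cdot>\<^sub>m (A ^\<^sub>m k)"
proof (induction k)
  case 0
  then show ?case by (intro eq_matI) auto
next
  case (Suc k)
  have "(c ^ k \<cdot>\<^sub>m A ^\<^sub>m k) * (c \<cdot>\<^sub>m A) = c ^ k \<cdot>\<^sub>m (A ^\<^sub>m k * (c \<cdot>\<^sub>m A))"
    by (rule mult_smult_assoc_mat[of _ n n _ n]) (use Suc.prems in simp_all)
  also have "A ^\<^sub>m k * (c \<cdot>\<^sub>m A) = c \<cdot>\<^sub>m (A ^\<^sub>m k * A)"
    by (rule mult_smult_distrib[of _ n n _ n]) (use Suc.prems in simp_all)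
  also have "c ^ k \<cdot>\<^sub>m (c \<cdot>\<^sub>m (A ^\<^sub>m k * A)) = c ^ Suc k \<cdot>\<^sub>m (A ^\<^sub>m k * A)"
    by (intro eq_matI) (simp_all add: mult_ac)
  finally show ?case using Suc by simp
qed

lemma twist_system:
  assumes sys: "unitary_system m d n E" and m: "m \<ge> 1"
  shows "unitary_system m d n (twist m d E i)" unfolding unitary_system_def
proof (intro conjI ballI allI impI)
  let ?w = "root_omega m"
  fix k assume k: "k \<in> {1..d}"
  note U = unitary_systemD(1)[OF sys k] and P = unitary_systemD(2)[OF sys k]
  have c: "E k \<in> carrier_mat n n" using U unfolding mat_unitary_def by simp
  show "mat_unitary n (twist m d E i k)" using U mat_unitary_smult[OF U, of "?w ^ i"]
    by (cases "k = d") (simp_all add: twist_def norm_power)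
  have "(?w ^ i) ^ m = 1"
    unfolding power_mult[symmetric] mult.commute[of i m] unfolding power_mult root_omega_pow_m[OF m] by simp
  then have "(?w ^ i \<cdot>\<^sub>m E k) ^\<^sub>m m = 1\<^sub>m n"
    unfolding pow_mat_smult[OF c] P by (simp only: smult_one_mat)
  then show "twist m d E i k ^\<^sub>m m = 1\<^sub>m n" using P by (cases "k = d") (simp_all add: twist_def)
next
  let ?w = "root_omega m"
  fix k l assume kl: "1 \<le> k \<and> k < l \<and> l \<le> d"
  have c: "E k \<in> carrier_mat n n" "E l \<in> carrier_mat n n"
    using unitary_systemD(1)[OF sys, of k] unitary_systemD(1)[OF sys, of l] kl
    unfolding mat_unitary_def by auto
  note C = unitary_systemD(3)[OF sys kl]
  have s: "E k * (a \<cdot>\<^sub>m E l) = ?w \<cdot>\<^sub>m ((a \<cdot>\<^sub>m E l) * E k)" for a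
  proof -
    have "E k * (a \<cdot>\<^sub>m E l) = a \<cdot>\<^sub>m (?w \<cdot>\<^sub>m (E l * E k))"
      unfolding C[symmetric] by (rule mult_smult_distrib[OF c])
    also have "\<dots> = ?w \<cdot>\<^sub>m (a \<cdot>\<^sub>m (E l * E k))" by (intro eq_matI) simp_all
    also have "a \<cdot>\<^sub>m (E l * E k) = (a \<cdot>\<^sub>m E l) * E k"
      by (rule mult_smult_assoc_mat[OF c(2,1), symmetric])
    finally show ?thesis .
  qed
  have "k \<noteq> d" using kl by auto
  then show "twist m d E i k * twist m d E i l = ?w \<cdot>\<^sub>m (twist m d E i l * twist m d E i k)"
    using s[of "?w ^ i"] C by (cases "l = d") (simp_all only: twist_def fun_upd_same fun_upd_other not_False_eq_True)
qed

text \<open>The letter d occurs only in the last factor of the monomial, so the twist contributes a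
  single scalar.\<close>

lemma twist_mono_mat:
  assumes sys: "unitary_system m d n E" and d: "d \<ge> 1"
  shows "mono_mat n (twist m d E i) [1..<Suc d] J = root_omega m ^ (i * J d) \<cdot>\<^sub>m mono_mat n E [1..<Suc d] J"
proof -
  let ?c = "root_omega m ^ (i * J d)"
  have Ec: "E k ^\<^sub>m j \<in> carrier_mat n n" if "k \<in> {1..d}" for k j
    using unitary_systemD(1)[OF sys that] unfolding mat_unitary_def by simp
  \<comment> \<open>The scalar starts next to the innermost factor and is moved outwards through the
    letters below d, which the twist leaves alone.\<close>
  have fold: "foldr (\<lambda>k M. (twist m d E i k ^\<^sub>m J k) * M) xs (?c \<cdot>\<^sub>m B) =
      ?c \<cdot>\<^sub>m foldr (\<lambda>k M. (E k ^\<^sub>m J k) * M) xs B \<and> foldr (\<lambda>k M. (E k ^\<^sub>m J k) * M) xs B \<in> carrier_mat n n"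
    if "set xs \<subseteq> {1..<d}" "B \<in> carrier_mat n n" for xs B using that
  proof (induction xs)
    case (Cons x xs)
    let ?M = "foldr (\<lambda>k M. (E k ^\<^sub>m J k) * M) xs B"
    have x: "x \<in> {1..d}" "x \<noteq> d" using Cons.prems by auto
    have IH: "foldr (\<lambda>k M. (twist m d E i k ^\<^sub>m J k) * M) xs (?c \<cdot>\<^sub>m B) = ?c \<cdot>\<^sub>m ?M" "?M \<in> carrier_mat n n"
      using Cons by auto
    have "twist m d E i x = E x" using x by (simp add: twist_def)
    moreover have "E x ^\<^sub>m J x * (?c \<cdot>\<^sub>m ?M) = ?c \<cdot>\<^sub>m (E x ^\<^sub>m J x * ?M)"
      by (rule mult_smult_distrib[OF Ec[OF x(1)] IH(2)])
    moreover have "E x ^\<^sub>m J x * ?M \<in> carrier_mat n n" by (rule mult_carrier_mat[OF Ec[OF x(1)] IH(2)])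
    ultimately show ?case by (simp only: foldr_Cons comp_apply IH(1) simp_thms)
  qed simp
  have dd: "d \<in> {1..d}" using d by simp
  have Ed: "E d \<in> carrier_mat n n" using unitary_systemD(1)[OF sys dd] unfolding mat_unitary_def by simp
  have "twist m d E i d ^\<^sub>m J d = ?c \<cdot>\<^sub>m (E d ^\<^sub>m J d)"
    using pow_mat_smult[OF Ed, of "root_omega m ^ i" "J d"] by (simp add: twist_def power_mult)
  then have "(twist m d E i d ^\<^sub>m J d) * 1\<^sub>m n = ?c \<cdot>\<^sub>m (E d ^\<^sub>m J d * 1\<^sub>m n)"
    by (simp only: right_mult_one_mat[OF Ec[OF dd]] right_mult_one_mat[OF smult_carrier_mat[OF Ec[OF dd]]])
  moreover have "[1..<Suc d] = [1..<d] @ [d]" using d by simp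
  moreover have "set [1..<d] \<subseteq> {1..<d}" by simp
  ultimately show ?thesis
    using fold[OF _ mult_carrier_mat[OF Ec[OF dd] one_carrier_mat], of "[1..<d]" "J d"]
    unfolding mono_mat_def by (simp only: foldr_append foldr_Cons foldr_Nil comp_apply id_apply)
qed

text \<open>By \<open>twist_mono_mat\<close> the sum is one trace times a sum of powers of \<omega>.
  For J \<noteq> K the trace vanishes if some phase differs. If all phases agree, d must be odd and
  the last exponents differ, and then the sum over the twists vanishes by
  \<open>omega_geometric\<close>.\<close>

lemma twist_orthogonal:
  assumes sys: "unitary_system m d n E" and m: "m \<ge> 1" and d: "d \<ge> 1"
    and J: "J \<in> multi_indices m d" and K: "K \<in> multi_indices m d"
  shows "(\<Sum>i<rep_count m d. mat_trace n (mat_adjoint (mono_mat n (twist m d E i) [1..<Suc d] J) *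
      mono_mat n (twist m d E i) [1..<Suc d] K)) = (if J = K then of_nat (rep_count m d * n) else 0)"
proof -
  let ?w = "root_omega m" and ?M = "\<lambda>J. mono_mat n E [1..<Suc d] J"
  have xs: "set [1..<Suc d] \<subseteq> {1..d}" by auto
  have c: "?M J \<in> carrier_mat n n" for J by (rule mono_mat_carrier[OF sys xs])
  let ?t = "mat_trace n (mat_adjoint (?M J) * ?M K)"
  have "mat_trace n (mat_adjoint (mono_mat n (twist m d E i) [1..<Suc d] J) *
      mono_mat n (twist m d E i) [1..<Suc d] K) = (cnj (?w ^ (i * J d)) * ?w ^ (i * K d)) * ?t" for i
  proof -
    have "mat_adjoint (?w ^ (i * J d) \<cdot>\<^sub>m ?M J) * (?w ^ (i * K d) \<cdot>\<^sub>m ?M K) =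
        cnj (?w ^ (i * J d)) \<cdot>\<^sub>m (mat_adjoint (?M J) * (?w ^ (i * K d) \<cdot>\<^sub>m ?M K))"
      unfolding mat_adjoint_smult
      by (rule mult_smult_assoc_mat[of _ n n _ n]) (use c mat_adjoint_carrier[OF c] in simp_all)
    also have "mat_adjoint (?M J) * (?w ^ (i * K d) \<cdot>\<^sub>m ?M K) = ?w ^ (i * K d) \<cdot>\<^sub>m (mat_adjoint (?M J) * ?M K)"
      by (rule mult_smult_distrib[OF mat_adjoint_carrier[OF c] c])
    finally show ?thesis unfolding twist_mono_mat[OF sys d]
      using mat_trace_smult[of "mat_adjoint (?M J) * ?M K" n "?w ^ (i * K d)"]
        mat_trace_smult[of "?w ^ (i * K d) \<cdot>\<^sub>m (mat_adjoint (?M J) * ?M K)" n "cnj (?w ^ (i * J d))"]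
        mult_carrier_mat[OF mat_adjoint_carrier[OF c] c, of J K]
      by (simp only: smult_carrier_mat mult.assoc)
  qed
  then have sum: "(\<Sum>i<rep_count m d. mat_trace n (mat_adjoint (mono_mat n (twist m d E i) [1..<Suc d] J) *
      mono_mat n (twist m d E i) [1..<Suc d] K)) =
      (\<Sum>i<rep_count m d. cnj (?w ^ (i * J d)) * ?w ^ (i * K d)) * ?t"
    by (simp only: sum_distrib_right)
  have lt: "J k < m" "K k < m" if "k \<in> {1..d}" for k
    using J K that by (auto simp: multi_indices_def PiE_iff)
  have dd: "d \<in> {1..d}" using d by simp
  show ?thesis
  proof (cases "J = K")
    case True
    have "mat_adjoint (?M K) * ?M K = 1\<^sub>m n"
      using mono_mat_unitary[OF sys xs, of K] unfolding mat_unitary_def by (rule conjunct2)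
    then have t: "?t = of_nat n" using True by (simp add: mat_trace_def)
    have "(\<Sum>i<rep_count m d. cnj (?w ^ (i * K d)) * ?w ^ (i * K d)) = of_nat (rep_count m d)"
      using omega_geometric[OF lt(2)[OF dd] lt(2)[OF dd]] by (auto simp: rep_count_def)
    with sum t show ?thesis using True by simp
  next
    case False
    show ?thesis
    proof (cases "\<exists>k\<in>{1..d}. mono_phase m k [1..<Suc d] J \<noteq> mono_phase m k [1..<Suc d] K")
      case True
      then have "?t = 0" using mono_mat_trace[OF sys xs] by blast
      with sum False show ?thesis by simp
    next
      case ph: False
      have "odd d \<and> J d \<noteq> K d"
      proof (rule ccontr)
        assume "\<not> (odd d \<and> J d \<noteq> K d)"
        then have e: "even d \<or> ?w ^ J d = ?w ^ K d" by auto
        have "J k = K k" if "k \<in> {1..d}" for k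
        proof -
          have "mono_phase m k [1..<Suc d] J = mono_phase m k [1..<Suc d] K" if "k \<in> {1..d}" for k
            using ph that by blast
          from mono_phase_eq_imp[where d = d and J = J and K = K and m = m, OF d this e that]
          show ?thesis using root_omega_pow_eq_iff[OF lt(1)[OF that] lt(2)[OF that]] by (rule iffD1[rotated])
        qed
        then have "J = K" using J K unfolding multi_indices_def by (intro PiE_ext)
        with False show False by simp
      qed
      then have "(\<Sum>i<rep_count m d. cnj (?w ^ (i * J d)) * ?w ^ (i * K d)) = 0"
        using omega_geometric[OF lt(1)[OF dd] lt(2)[OF dd]] by (simp add: rep_count_def)
      with sum False show ?thesis by simp
    qed
  qed
qed

text \<open>Enumerating \<open>X\<close> and \<open>Y\<close> turns \<open>Q\<close> into a square
  matrix. Orthogonality of its rows gives a one-sided inverse up to the factor \<open>c\<close>,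
  which for square matrices is two-sided; read in the other order it says that the columns are
  orthogonal.\<close>

lemma orthogonal_complete:
  fixes Q :: "'a \<Rightarrow> 'b \<Rightarrow> complex"
  assumes X: "finite X" and Y: "finite Y" and card: "card X = card Y" and c: "c \<noteq> 0"
    and orth: "\<And>x x'. \<lbrakk>x \<in> X; x' \<in> X\<rbrakk> \<Longrightarrow> (\<Sum>y\<in>Y. cnj (Q x y) * Q x' y) = (if x = x' then c else 0)"
    and y: "y \<in> Y" "y' \<in> Y"
  shows "(\<Sum>x\<in>X. Q x y * cnj (Q x y')) = (if y = y' then c else 0)"
proof -
  define n where "n = card X"
  obtain f where f: "bij_betw f {0..<n} X" using ex_bij_betw_nat_finite[OF X] n_def by auto
  obtain g where g: "bij_betw g {0..<n} Y" using ex_bij_betw_nat_finite[OF Y] n_def card by auto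
  have fX: "f i \<in> X" if "i < n" for i using bij_betw_apply[OF f] that by simp
  have finj: "f i = f j \<longleftrightarrow> i = j" if "i < n" "j < n" for i j
    using bij_betw_imp_inj_on[OF f] that by (auto simp: inj_on_def)
  have ginj: "g i = g j \<longleftrightarrow> i = j" if "i < n" "j < n" for i j
    using bij_betw_imp_inj_on[OF g] that by (auto simp: inj_on_def)
  define A where "A = mat n n (\<lambda>(i, j). cnj (Q (f i) (g j)))"
  define B where "B = mat n n (\<lambda>(j, i). Q (f i) (g j) / c)"
  have AB: "A \<in> carrier_mat n n" "B \<in> carrier_mat n n" by (simp_all add: A_def B_def)
  have "A * B = 1\<^sub>m n"
  proof (rule eq_matI)
    fix i j assume "i < dim_row (1\<^sub>m n :: complex mat)" "j < dim_col (1\<^sub>m n :: complex mat)"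
    then have ij: "i < n" "j < n" by auto
    have "(A * B) $$ (i, j) = (\<Sum>k=0..<n. cnj (Q (f i) (g k)) * Q (f j) (g k)) / c"
      using ij by (simp add: A_def B_def scalar_prod_def sum_divide_distrib)
    also have "(\<Sum>k=0..<n. cnj (Q (f i) (g k)) * Q (f j) (g k)) = (\<Sum>y\<in>Y. cnj (Q (f i) y) * Q (f j) y)"
      by (rule sum.reindex_bij_betw[OF g])
    also have "\<dots> / c = (1\<^sub>m n :: complex mat) $$ (i, j)"
      using orth[OF fX[OF ij(1)] fX[OF ij(2)]] finj[OF ij] c ij by simp
    finally show "(A * B) $$ (i, j) = (1\<^sub>m n :: complex mat) $$ (i, j)" .
  qed (simp_all add: A_def B_def)
  then have BA: "B * A = 1\<^sub>m n" by (rule mat_mult_left_right_inverse[OF AB])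
  obtain i j where i: "i < n" "y = g i" and j: "j < n" "y' = g j"
    using y bij_betw_imp_surj_on[OF g] by (metis atLeastLessThan_iff imageE)
  have "(B * A) $$ (i, j) = (\<Sum>k=0..<n. Q (f k) y * cnj (Q (f k) y')) / c"
    using i j by (simp add: A_def B_def scalar_prod_def sum_divide_distrib)
  also have "(\<Sum>k=0..<n. Q (f k) y * cnj (Q (f k) y')) = (\<Sum>x\<in>X. Q x y * cnj (Q x y'))"
    by (rule sum.reindex_bij_betw[OF f])
  finally show ?thesis using BA ginj[OF i(1) j(1)] i j c by (simp add: field_simps split: if_splits)
qed

section \<open>Matrix representations\<close>

definition word_mat :: "nat \<Rightarrow> (nat \<Rightarrow> complex mat) \<Rightarrow> nat list \<Rightarrow> complex mat" where
  "word_mat n E w = foldr (\<lambda>k M. E k * M) w (1\<^sub>m n)"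

definition free_eval :: "nat \<Rightarrow> (nat \<Rightarrow> complex mat) \<Rightarrow> (nat list \<Rightarrow> complex) \<Rightarrow> complex mat" where
  "free_eval n E f = mat n n (\<lambda>(a, b). \<Sum>w\<in>supp f. f w * word_mat n E w $$ (a, b))"

lemma free_eval_carrier [simp]: "free_eval n E f \<in> carrier_mat n n" by (simp add: free_eval_def)

lemma free_eval_dim [simp]: "dim_row (free_eval n E f) = n" "dim_col (free_eval n E f) = n"
  by (simp_all add: free_eval_def)

lemma free_eval_superset:
  assumes "finite S" "supp f \<subseteq> S" "a < n" "b < n"
  shows "free_eval n E f $$ (a, b) = (\<Sum>w\<in>S. f w * word_mat n E w $$ (a, b))"
  using assms by (simp add: free_eval_def) (rule sum.mono_neutral_left, auto)

context
  fixes d n :: nat and E :: "nat \<Rightarrow> complex mat"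
  assumes E_Pi: "E \<in> {1..d} \<rightarrow> carrier_mat n n"
begin

lemma eval_gen_carrier: "k \<in> {1..d} \<Longrightarrow> E k \<in> carrier_mat n n" using E_Pi by auto

lemma word_mat_carrier: "w \<in> lists {1..d} \<Longrightarrow> word_mat n E w \<in> carrier_mat n n"
  by (induction w) (auto simp: word_mat_def intro!: mult_carrier_mat[OF eval_gen_carrier])

lemma word_mat_append:
  "\<lbrakk>u \<in> lists {1..d}; v \<in> lists {1..d}\<rbrakk> \<Longrightarrow> word_mat n E (u @ v) = word_mat n E u * word_mat n E v"
proof (induction u)
  case Nil
  then show ?case using word_mat_carrier[of v] by (simp add: word_mat_def)
next
  case (Cons k u)
  then have "E k * (word_mat n E u * word_mat n E v) = E k * word_mat n E u * word_mat n E v"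
    using word_mat_carrier eval_gen_carrier[of k] by (auto intro!: assoc_mult_mat[symmetric])
  then show ?case using Cons by (auto simp: word_mat_def)
qed

lemma free_eval_word: "w \<in> lists {1..d} \<Longrightarrow> free_eval n E (word_fun w) = word_mat n E w"
  using word_mat_carrier[of w]
  by (intro eq_matI) (auto simp: free_eval_superset[of "{w}"] word_fun_def)

lemma free_eval_add:
  assumes "f \<in> carrier (free_algebra d)" "g \<in> carrier (free_algebra d)"
  shows "free_eval n E (f \<oplus>\<^bsub>free_algebra d\<^esub> g) = free_eval n E f + free_eval n E g"
proof (rule eq_matI)
  fix a b assume "a < dim_row (free_eval n E f + free_eval n E g)" "b < dim_col (free_eval n E f + free_eval n E g)"
  then have ab: "a < n" "b < n" using free_eval_carrier[of n E g] by auto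
  have S: "finite (supp f \<union> supp g)" using assms by (auto simp: free_algebra_simps)
  have "supp (f \<oplus>\<^bsub>free_algebra d\<^esub> g) \<subseteq> supp f \<union> supp g" by (auto simp: free_algebra_simps)
  from free_eval_superset[OF S this ab]
  show "free_eval n E (f \<oplus>\<^bsub>free_algebra d\<^esub> g) $$ (a, b) = (free_eval n E f + free_eval n E g) $$ (a, b)"
    using ab free_eval_superset[OF S _ ab, of f] free_eval_superset[OF S _ ab, of g]
      free_eval_carrier[of n E g] by (simp add: free_algebra_simps distrib_right sum.distrib)
qed (use free_eval_carrier[of n E] in auto)

lemma free_eval_smult:
  assumes "f \<in> carrier (free_algebra d)"
  shows "free_eval n E (c \<odot>\<^bsub>free_algebra d\<^esub> f) = c \<cdot>\<^sub>m free_eval n E f"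
proof (rule eq_matI)
  fix a b assume "a < dim_row (c \<cdot>\<^sub>m free_eval n E f)" "b < dim_col (c \<cdot>\<^sub>m free_eval n E f)"
  then have ab: "a < n" "b < n" using free_eval_carrier[of n E f] by auto
  have S: "finite (supp f)" using assms by (auto simp: free_algebra_simps)
  have "supp (c \<odot>\<^bsub>free_algebra d\<^esub> f) \<subseteq> supp f" by (auto simp: free_algebra_simps)
  from free_eval_superset[OF S this ab]
  show "free_eval n E (c \<odot>\<^bsub>free_algebra d\<^esub> f) $$ (a, b) = (c \<cdot>\<^sub>m free_eval n E f) $$ (a, b)"
    using ab free_eval_superset[OF S _ ab, of f] free_eval_carrier[of n E f]
    by (simp add: free_algebra_simps sum_distrib_left mult.assoc)
qed (use free_eval_carrier[of n E] in auto)

text \<open>Bilinearity reduces the claim to words, first in the right factor for a fixed word on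
  the left, then in the left factor.\<close>

lemma free_eval_mult:
  assumes f: "f \<in> carrier (free_algebra d)" and g: "g \<in> carrier (free_algebra d)"
  shows "free_eval n E (f \<otimes>\<^bsub>free_algebra d\<^esub> g) = free_eval n E f * free_eval n E g"
proof -
  interpret F: ring "free_algebra d" by (rule free_ring)
  note c = free_eval_carrier[of n E]
  have w: "free_eval n E (word_fun u \<otimes>\<^bsub>free_algebra d\<^esub> g) = free_eval n E (word_fun u) * free_eval n E g"
    if u: "u \<in> lists {1..d}" for u using g
  proof (induction rule: free_induct)
    case (word v)
    then have "u @ v \<in> lists {1..d}" using u by auto
    then show ?case using u word
      by (simp add: word_fun_append[symmetric] free_eval_word word_mat_append)
  next
    case (add f g)
    then show ?case using word_fun_carrier[OF u]
      by (simp add: F.r_distr free_eval_add mult_add_distrib_mat[OF c c c])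
  next
    case (smult b f)
    then show ?case using word_fun_carrier[OF u]
      by (simp add: free_smult_mult free_eval_smult mult_smult_distrib[OF c c])
  qed
  show ?thesis using f
  proof (induction rule: free_induct)
    case (word u)
    then show ?case by (rule w)
  next
    case (add f h)
    then show ?case using g by (simp add: F.l_distr free_eval_add add_mult_distrib_mat[OF c c c])
  next
    case (smult b f)
    then show ?case using g
      by (simp add: free_smult_mult free_eval_smult mult_smult_assoc_mat[OF c c])
  qed
qed

lemma free_eval_one: "free_eval n E \<one>\<^bsub>free_algebra d\<^esub> = 1\<^sub>m n"
  using free_eval_word[of "[]"] by (simp add: word_fun_Nil[of d] word_mat_def)

lemma free_eval_gen: "k \<in> {1..d} \<Longrightarrow> free_eval n E (free_gen k) = E k"
  using free_eval_word[of "[k]"] eval_gen_carrier[of k] by (simp add: free_gen_word word_mat_def)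

lemma free_eval_hom: "ring_hom_ring (free_algebra d) (ring_mat TYPE(complex) n ()) (free_eval n E)"
  by (intro ring_hom_ringI free_ring ring_mat)
    (simp_all add: ring_mat_simps free_eval_mult free_eval_add free_eval_one)

lemma free_eval_pow:
  "f \<in> carrier (free_algebra d) \<Longrightarrow>
    free_eval n E (f [^]\<^bsub>free_algebra d\<^esub> (k::nat)) = free_eval n E f ^\<^sub>m k"
proof (induction k)
  case 0
  have "dim_row (free_eval n E f) = n" using free_eval_carrier[of n E f] by (rule carrier_matD)
  then show ?case by (simp add: free_eval_one)
next
  case (Suc k)
  interpret F: ring "free_algebra d" by (rule free_ring)
  show ?case using Suc by (simp add: free_eval_mult)
qed

end

locale gcliff_rep =
  fixes m d n :: nat and E :: "nat \<Rightarrow> complex mat"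
  assumes E_carrier: "k \<in> {1..d} \<Longrightarrow> E k \<in> carrier_mat n n"
    and E_pow: "k \<in> {1..d} \<Longrightarrow> E k ^\<^sub>m m = 1\<^sub>m n"
    and E_comm: "\<lbrakk>1 \<le> k; k < l; l \<le> d\<rbrakk> \<Longrightarrow> E k * E l = root_omega m \<cdot>\<^sub>m (E l * E k)"
begin

lemma E_Pi: "E \<in> {1..d} \<rightarrow> carrier_mat n n" using E_carrier by auto

text \<open>Evaluates a chosen representative of the class; \<open>rep_class\<close> shows that the
  choice does not matter.\<close>

definition rep :: "(nat list \<Rightarrow> complex) set \<Rightarrow> complex mat" where
  "rep U = free_eval n E (SOME f. f \<in> carrier (free_algebra d) \<and> gcliff_class m d f = U)"

text \<open>The kernel of the evaluation is an ideal and contains the relations, hence also the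
  ideal that they generate.\<close>

lemma free_eval_ideal:
  assumes "f \<in> gcliff_ideal m d" shows "free_eval n E f = 0\<^sub>m n n"
proof -
  interpret H: ring_hom_ring "free_algebra d" "ring_mat TYPE(complex) n ()" "free_eval n E"
    by (rule free_eval_hom[OF E_Pi])
  let ?K = "a_kernel (free_algebra d) (ring_mat TYPE(complex) n ()) (free_eval n E)"
  have eq: "f \<ominus>\<^bsub>free_algebra d\<^esub> g \<in> ?K"
    if "f \<in> carrier (free_algebra d)" "g \<in> carrier (free_algebra d)" "free_eval n E f = free_eval n E g" for f g
  proof -
    have "free_eval n E (f \<ominus>\<^bsub>free_algebra d\<^esub> g) = free_eval n E f \<ominus>\<^bsub>ring_mat TYPE(complex) n ()\<^esub> free_eval n E g"
      unfolding a_minus_def using that(1,2) by (simp only: H.hom_add H.hom_a_inv H.R.a_inv_closed)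
    also have "\<dots> = \<zero>\<^bsub>ring_mat TYPE(complex) n ()\<^esub>"
      unfolding that(3) a_minus_def by (rule H.S.r_neg[OF H.hom_closed[OF that(2)]])
    finally show ?thesis unfolding a_kernel_def' using H.R.minus_closed that(1,2) by blast
  qed
  have gen: "free_gen k \<in> carrier (free_algebra d)" "free_eval n E (free_gen k) = E k" if "k \<in> {1..d}" for k
    using that by (auto simp: free_gen_carrier free_eval_gen[OF E_Pi])
  have "gcliff_relations m d \<subseteq> ?K" unfolding gcliff_relations_def Let_def
    by (auto intro!: eq free_smult_closed H.R.nat_pow_closed H.R.m_closed H.R.one_closed
        simp: gen free_eval_pow[OF E_Pi] free_eval_one[OF E_Pi] free_eval_mult[OF E_Pi]
          free_eval_smult[OF E_Pi] E_pow E_comm ring_mat_simps)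
  then have "gcliff_ideal m d \<subseteq> ?K"
    unfolding gcliff_ideal_def by (intro H.R.genideal_minimal H.kernel_is_ideal)
  then have "f \<in> ?K" using assms by (rule subsetD)
  then show ?thesis unfolding a_kernel_def' ring_mat_simps by blast
qed

lemma rep_class:
  assumes f: "f \<in> carrier (free_algebra d)" shows "rep (gcliff_class m d f) = free_eval n E f"
proof -
  interpret F: ring "free_algebra d" by (rule free_ring)
  interpret H: ring_hom_ring "free_algebra d" "ring_mat TYPE(complex) n ()" "free_eval n E"
    by (rule free_eval_hom[OF E_Pi])
  define g where "g = (SOME g. g \<in> carrier (free_algebra d) \<and> gcliff_class m d g = gcliff_class m d f)"
  have g: "g \<in> carrier (free_algebra d)" "gcliff_class m d g = gcliff_class m d f"
    using someI[of "\<lambda>g. g \<in> carrier (free_algebra d) \<and> gcliff_class m d g = gcliff_class m d f" f] f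
    unfolding g_def by auto
  then have "g \<ominus>\<^bsub>free_algebra d\<^esub> f \<in> gcliff_ideal m d"
    using F.quotient_eq_iff_same_a_r_cos[OF gcliff_ideal_is_ideal g(1) f] by (simp add: gcliff_class_def)
  from free_eval_ideal[OF this] have "free_eval n E (g \<ominus>\<^bsub>free_algebra d\<^esub> f) = 0\<^sub>m n n" .
  moreover have "free_eval n E ((g \<ominus>\<^bsub>free_algebra d\<^esub> f) \<oplus>\<^bsub>free_algebra d\<^esub> f)
      = free_eval n E (g \<ominus>\<^bsub>free_algebra d\<^esub> f) + free_eval n E f"
    using f g by (intro free_eval_add[OF E_Pi]) auto
  moreover have "(g \<ominus>\<^bsub>free_algebra d\<^esub> f) \<oplus>\<^bsub>free_algebra d\<^esub> f = g"
    using f g by (simp add: a_minus_def F.a_assoc F.l_neg)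
  ultimately have "free_eval n E g = free_eval n E f" by simp
  then show ?thesis by (simp add: rep_def g_def)
qed

lemma rep_carrier: "rep U \<in> carrier_mat n n" by (simp add: rep_def)

lemma rep_hom:
  assumes "U \<in> carrier (gcliff m d)" "V \<in> carrier (gcliff m d)"
  shows "rep (U \<oplus>\<^bsub>gcliff m d\<^esub> V) = rep U + rep V" "rep (U \<otimes>\<^bsub>gcliff m d\<^esub> V) = rep U * rep V"
    "rep (c \<odot>\<^bsub>gcliff m d\<^esub> U) = c \<cdot>\<^sub>m rep U"
proof -
  interpret F: ring "free_algebra d" by (rule free_ring)
  obtain f g where fg: "f \<in> carrier (free_algebra d)" "g \<in> carrier (free_algebra d)"
    and U: "U = gcliff_class m d f" "V = gcliff_class m d g"
    using assms by (auto simp: gcliff_simps)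
  note h = gcliff_class_hom(1,2) gcliff_class_hom(3)[where g = f] free_smult_closed fg rep_class
    free_eval_add[OF E_Pi] free_eval_mult[OF E_Pi] free_eval_smult[OF E_Pi]
  show "rep (U \<oplus>\<^bsub>gcliff m d\<^esub> V) = rep U + rep V" "rep (U \<otimes>\<^bsub>gcliff m d\<^esub> V) = rep U * rep V"
    "rep (c \<odot>\<^bsub>gcliff m d\<^esub> U) = c \<cdot>\<^sub>m rep U" unfolding U by (simp_all add: h)
qed

lemma rep_one: "rep \<one>\<^bsub>gcliff m d\<^esub> = 1\<^sub>m n"
proof -
  interpret F: ring "free_algebra d" by (rule free_ring)
  show ?thesis by (simp add: gcliff_simps rep_class free_eval_one[OF E_Pi])
qed

lemma rep_zero: "rep \<zero>\<^bsub>gcliff m d\<^esub> = 0\<^sub>m n n"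
proof -
  interpret F: ring "free_algebra d" by (rule free_ring)
  have "free_eval n E \<zero>\<^bsub>free_algebra d\<^esub> = 0\<^sub>m n n"
    unfolding free_eval_def free_algebra_simps(4) by (intro eq_matI) auto
  then show ?thesis by (simp add: gcliff_simps rep_class)
qed

lemma rep_gen: "k \<in> {1..d} \<Longrightarrow> rep (gcliff_gen m d k) = E k"
  by (simp add: gcliff_gen_def rep_class free_gen_carrier free_eval_gen[OF E_Pi])

lemma rep_pow:
  "U \<in> carrier (gcliff m d) \<Longrightarrow> rep (U [^]\<^bsub>gcliff m d\<^esub> (k::nat)) = rep U ^\<^sub>m k"
proof (induction k)
  case 0
  have "dim_row (rep U) = n" using rep_carrier[of U] by (rule carrier_matD)
  then show ?case by (simp add: rep_one)
next
  case (Suc k)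
  interpret Cl: ring "gcliff m d" by (rule gcliff_ring)
  show ?case using Suc by (simp add: rep_hom)
qed

lemma rep_monomial: "rep (gcliff_monomial m d J) = mono_mat n E [1..<Suc d] J"
proof -
  interpret Cl: ring "gcliff m d" by (rule gcliff_ring)
  have "rep (mono_list m d xs J) = foldr (\<lambda>k M. (E k ^\<^sub>m J k) * M) xs (1\<^sub>m n)"
    if "set xs \<subseteq> {1..d}" for xs using that
  proof (induction xs)
    case (Cons x xs)
    then have "gcliff_gen m d x [^]\<^bsub>gcliff m d\<^esub> J x \<in> carrier (gcliff m d)"
      using gcliff_gen_carrier[of x] by auto
    moreover have "mono_list m d xs J \<in> carrier (gcliff m d)" by (rule mono_list_carrier) (use Cons in auto)
    moreover have "mono_list m d (x # xs) J =
        (gcliff_gen m d x [^]\<^bsub>gcliff m d\<^esub> J x) \<otimes>\<^bsub>gcliff m d\<^esub> mono_list m d xs J"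
      by (simp add: mono_list_def)
    ultimately show ?case using Cons gcliff_gen_carrier[of x] by (simp add: rep_hom rep_pow rep_gen)
  qed (simp add: mono_list_def rep_one)
  from this[of "[1..<Suc d]"] show ?thesis
    unfolding mono_mat_def monomial_mono_list by (metis atLeastLessThanSuc_atLeastAtMost order_refl set_upt)
qed

text \<open>Stated entrywise because the orthogonality relations are used as plain sums of complex
  numbers over matrix entries.\<close>

lemma rep_finsum:
  assumes "finite S" "\<And>J. J \<in> S \<Longrightarrow> f J \<in> carrier (gcliff m d)" "a < n" "b < n"
  shows "rep (\<Oplus>\<^bsub>gcliff m d\<^esub>J\<in>S. f J) $$ (a, b) = (\<Sum>J\<in>S. rep (f J) $$ (a, b))"
proof -
  interpret Cl: ring "gcliff m d" by (rule gcliff_ring)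
  show ?thesis using assms(1,2)
  proof (induction S)
    case empty
    then show ?case using assms(3,4) by (simp add: rep_zero)
  next
    case (insert J S)
    have c: "dim_row (rep U) = n" "dim_col (rep U) = n" for U using rep_carrier[of U] by auto
    have "(\<Oplus>\<^bsub>gcliff m d\<^esub>J\<in>insert J S. f J) = f J \<oplus>\<^bsub>gcliff m d\<^esub> (\<Oplus>\<^bsub>gcliff m d\<^esub>J\<in>S. f J)"
      using insert by (intro Cl.finsum_insert) auto
    moreover have "(\<Oplus>\<^bsub>gcliff m d\<^esub>J\<in>S. f J) \<in> carrier (gcliff m d)"
      using insert.prems by (intro Cl.finsum_closed) auto
    ultimately show ?case using insert assms(3,4) c by (simp add: rep_hom)
  qed
qed

end

section \<open>The generalized Clifford algebra as a sum of matrix algebras\<close>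

lemma continuous_map_complex:
  fixes f g :: "'a \<Rightarrow> complex"
  assumes "continuous_map X euclidean f" "continuous_map X euclidean g"
  shows "continuous_map X euclidean (\<lambda>x. f x + g x)" "continuous_map X euclidean (\<lambda>x. f x * g x)"
  using assms by (simp_all add: continuous_map_atin tendsto_add tendsto_mult)

lemma continuous_map_cnj:
  "continuous_map X euclidean f \<Longrightarrow> continuous_map X euclidean (\<lambda>x. cnj (f x))"
  by (simp add: continuous_map_atin tendsto_cnj)

lemma continuous_map_complex_inverse:
  fixes f :: "'a \<Rightarrow> complex"
  assumes "continuous_map X euclidean f" "\<And>x. x \<in> topspace X \<Longrightarrow> f x \<noteq> 0"
  shows "continuous_map X euclidean (\<lambda>x. inverse (f x))"
  using assms by (simp add: continuous_map_atin tendsto_inverse)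

lemma continuous_map_complex_sum:
  fixes f :: "'i \<Rightarrow> 'a \<Rightarrow> complex"
  assumes "\<And>i. i \<in> I \<Longrightarrow> continuous_map X euclidean (f i)"
  shows "continuous_map X euclidean (\<lambda>x. \<Sum>i\<in>I. f i x)"
  using assms by (simp add: continuous_map_atin tendsto_sum)

lemma continuous_map_complex_prod:
  fixes f :: "'i \<Rightarrow> 'a \<Rightarrow> complex"
  assumes "\<And>i. i \<in> I \<Longrightarrow> continuous_map X euclidean (f i)"
  shows "continuous_map X euclidean (\<lambda>x. \<Prod>i\<in>I. f i x)"
  using assms by (simp add: continuous_map_atin tendsto_prod)

lemma continuous_map_det:
  fixes F :: "'a \<Rightarrow> complex mat"
  assumes F: "\<And>x. F x \<in> carrier_mat n n"
    and c: "\<And>a b. \<lbrakk>a < n; b < n\<rbrakk> \<Longrightarrow> continuous_map X euclidean (\<lambda>x. F x $$ (a, b))"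
  shows "continuous_map X euclidean (\<lambda>x. det (F x))"
proof -
  have "continuous_map X euclidean (\<lambda>x. \<Sum>p\<in>{p. p permutes {0..<n}}. signof p * (\<Prod>i=0..<n. F x $$ (i, p i)))"
  proof (intro continuous_map_complex_sum continuous_map_complex(2) continuous_map_complex_prod)
    fix p i assume "p \<in> {p. p permutes {0..<n}}" "i \<in> {0..<n}"
    then have "i < n" "p i < n" using permutes_in_image[of p "{0..<n}" i] by auto
    then show "continuous_map X euclidean (\<lambda>x. F x $$ (i, p i))" by (rule c)
  qed simp
  then show ?thesis unfolding det_def'[OF F] .
qed

text \<open>The entries of the adjugate are signed minors. Together with the determinant they give
  continuity of inversion through Cramer's rule.\<close>

lemma continuous_map_adj_mat:
  fixes F :: "'a \<Rightarrow> complex mat"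
  assumes F: "\<And>x. F x \<in> carrier_mat n n"
    and c: "\<And>a b. \<lbrakk>a < n; b < n\<rbrakk> \<Longrightarrow> continuous_map X euclidean (\<lambda>x. F x $$ (a, b))"
    and ab: "a < n" "b < n"
  shows "continuous_map X euclidean (\<lambda>x. adj_mat (F x) $$ (a, b))"
proof -
  have "dim_row (F x) = n" "dim_col (F x) = n" for x using F[of x] by auto
  then have e: "adj_mat (F x) $$ (a, b) = (-1) ^ (b + a) * det (mat_delete (F x) b a)" for x
    using ab by (simp add: adj_mat_def cofactor_def)
  have "continuous_map X euclidean (\<lambda>x. det (mat_delete (F x) b a))"
  proof (rule continuous_map_det)
    show "mat_delete (F x) b a \<in> carrier_mat (n - 1) (n - 1)" for x
      using mat_delete_carrier[OF F] .
    fix i j assume ij: "i < n - 1" "j < n - 1"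
    have "mat_delete (F x) b a $$ (i, j) = F x $$ (insert_index b i, insert_index a j)" for x
      using mat_delete_index[of "F x" "n - 1" b a i j] F[of x] ab ij by simp
    moreover have "insert_index b i < n" "insert_index a j < n"
      using ij by (auto simp: insert_index_def)
    ultimately show "continuous_map X euclidean (\<lambda>x. mat_delete (F x) b a $$ (i, j))"
      using c by simp
  qed
  then show ?thesis unfolding e by (intro continuous_map_complex(2)) simp
qed

text \<open>A nonzero v with (1 + A) v = 0 satisfies A v = - v. Then v^H A v is minus the squared
  length of v, while skewness makes it equal to plus the squared length, so v = 0.\<close>

lemma det_one_plus_skew:
  assumes A: "A \<in> carrier_mat n n" and sk: "mat_adjoint A = - A"
  shows "det (1\<^sub>m n + A :: complex mat) \<noteq> 0"
proof
  assume "det (1\<^sub>m n + A) = 0"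
  then obtain v where v: "v \<in> carrier_vec n" "v \<noteq> 0\<^sub>v n" "(1\<^sub>m n + A) *\<^sub>v v = 0\<^sub>v n"
    using det_0_iff_vec_prod_zero[of "1\<^sub>m n + A" n] A by auto
  have Av: "(\<Sum>j<n. A $$ (i, j) * v $ j) = - v $ i" if i: "i < n" for i
  proof -
    have "((1\<^sub>m n + A) *\<^sub>v v) $ i = v $ i + (\<Sum>j<n. A $$ (i, j) * v $ j)"
    proof -
      have "(1\<^sub>m n + A) *\<^sub>v v = 1\<^sub>m n *\<^sub>v v + A *\<^sub>v v"
        by (rule add_mult_distrib_mat_vec[OF _ A v(1)]) simp
      then show ?thesis using i v(1) A by (simp add: scalar_prod_def atLeast0LessThan)
    qed
    then show ?thesis using v(3) i by (simp add: eq_neg_iff_add_eq_0 add.commute)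
  qed
  have skew: "A $$ (j, i) = - cnj (A $$ (i, j))" if "i < n" "j < n" for i j
  proof -
    have "mat_adjoint A $$ (j, i) = cnj (A $$ (i, j))" using A that by (intro mat_adjoint_index) auto
    then have "- A $$ (j, i) = cnj (A $$ (i, j))" using sk A that by simp
    from arg_cong[OF this, of uminus] show ?thesis by simp
  qed
  define s where "s = (\<Sum>i<n. cnj (v $ i) * v $ i)"
  have s1: "(\<Sum>i<n. cnj (v $ i) * (\<Sum>j<n. A $$ (i, j) * v $ j)) = - s"
    using Av by (simp add: s_def sum_negf)
  have "(\<Sum>i<n. cnj (v $ i) * (\<Sum>j<n. A $$ (i, j) * v $ j)) =
      (\<Sum>i<n. \<Sum>j<n. cnj (v $ i) * (A $$ (i, j) * v $ j))" by (simp add: sum_distrib_left)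
  also have "\<dots> = (\<Sum>j<n. \<Sum>i<n. cnj (v $ i) * (A $$ (i, j) * v $ j))" by (rule sum.swap)
  also have "\<dots> = (\<Sum>j<n. - (cnj (\<Sum>i<n. A $$ (j, i) * v $ i) * v $ j))"
  proof (intro sum.cong refl)
    fix j assume "j \<in> {..<n}"
    then have j: "j < n" by simp
    have "(\<Sum>i<n. cnj (v $ i) * (A $$ (i, j) * v $ j)) = (\<Sum>i<n. - (cnj (A $$ (j, i) * v $ i) * v $ j))"
    proof (rule sum.cong[OF refl])
      fix i assume "i \<in> {..<n}"
      then have "A $$ (i, j) = - cnj (A $$ (j, i))" using j by (intro skew) simp_all
      then show "cnj (v $ i) * (A $$ (i, j) * v $ j) = - (cnj (A $$ (j, i) * v $ i) * v $ j)"
        by (simp only: complex_cnj_mult) simp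
    qed
    then show "(\<Sum>i<n. cnj (v $ i) * (A $$ (i, j) * v $ j)) = - (cnj (\<Sum>i<n. A $$ (j, i) * v $ i) * v $ j)"
      by (simp add: sum_negf sum_distrib_right)
  qed
  also have "\<dots> = s" using Av by (simp add: s_def)
  finally have "s = - s" using s1 by simp
  then have "s = 0" by simp
  have "s = of_real (\<Sum>i<n. (norm (v $ i))\<^sup>2)"
    unfolding s_def of_real_sum by (intro sum.cong refl) (metis complex_norm_square mult.commute)
  with \<open>s = 0\<close> have "(\<Sum>i<n. (norm (v $ i))\<^sup>2) = 0" by (simp only: of_real_eq_0_iff)
  then have "v $ i = 0" if "i < n" for i using that by (subst (asm) sum_nonneg_eq_0_iff) auto
  then have "v = 0\<^sub>v n" using v(1) by (intro eq_vecI) auto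
  then show False using v(2) by simp
qed

locale gcliff_model =
  fixes m d n :: nat and E :: "nat \<Rightarrow> complex mat"
  assumes m: "m \<ge> 1" and d: "d \<ge> 1" and sys: "unitary_system m d n E" and n: "n = m ^ (d div 2)"
begin

abbreviation "Cl \<equiv> gcliff m d"
abbreviation "MI \<equiv> multi_indices m d"
abbreviation "K \<equiv> rep_count m d"
abbreviation "e \<equiv> gcliff_monomial m d"

definition R :: "nat \<Rightarrow> (nat list \<Rightarrow> complex) set \<Rightarrow> complex mat" where
  "R i = gcliff_rep.rep m d n (twist m d E i)"

definition M :: "nat \<Rightarrow> (nat \<Rightarrow> nat) \<Rightarrow> complex mat" where
  "M i J = mono_mat n (twist m d E i) [1..<Suc d] J"

text \<open>The squared length of the image of each monomial, taken over all entries of all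
  blocks.\<close>

definition c :: complex where "c = of_nat (K * n)"

sublocale Cl: ring Cl by (rule gcliff_ring)

lemma twist_rep: "gcliff_rep m d n (twist m d E i)"
proof
  note S = unitary_systemD[OF twist_system[OF sys m, of i]]
  show "twist m d E i k \<in> carrier_mat n n" if "k \<in> {1..d}" for k
    using S(1)[OF that] unfolding mat_unitary_def by simp
  show "twist m d E i k ^\<^sub>m m = 1\<^sub>m n" if "k \<in> {1..d}" for k by (rule S(2)[OF that])
  show "twist m d E i k * twist m d E i l = root_omega m \<cdot>\<^sub>m (twist m d E i l * twist m d E i k)"
    if "1 \<le> k" "k < l" "l \<le> d" for k l by (rule S(3)) (use that in simp)
qed

lemma R_carrier: "R i U \<in> carrier_mat n n"
  unfolding R_def by (rule gcliff_rep.rep_carrier[OF twist_rep])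

lemma R_dim [simp]: "dim_row (R i U) = n" "dim_col (R i U) = n" using R_carrier[of i U] by auto

lemmas R_hom = gcliff_rep.rep_hom[OF twist_rep, folded R_def]
lemma R_smult: "U \<in> carrier Cl \<Longrightarrow> R i (x \<odot>\<^bsub>Cl\<^esub> U) = x \<cdot>\<^sub>m R i U" by (rule R_hom(3))

lemmas R_one = gcliff_rep.rep_one[OF twist_rep, folded R_def]
lemmas R_zero = gcliff_rep.rep_zero[OF twist_rep, folded R_def]
lemmas R_finsum = gcliff_rep.rep_finsum[OF twist_rep, folded R_def]
lemmas R_monomial = gcliff_rep.rep_monomial[OF twist_rep, folded R_def M_def]

lemma M_unitary: "mat_unitary n (M i J)"
  unfolding M_def by (rule mono_mat_unitary[OF twist_system[OF sys m]]) auto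

lemma M_carrier: "M i J \<in> carrier_mat n n" using M_unitary unfolding mat_unitary_def by simp

lemma M_adjoint: "mat_adjoint (M i J) \<in> carrier_mat n n" "mat_adjoint (M i J) * M i J = 1\<^sub>m n"
  using M_unitary[of i J] mat_adjoint_carrier[OF M_carrier] unfolding mat_unitary_def by simp_all

lemma c_nonzero: "c \<noteq> 0"
proof -
  have "n \<noteq> 0" using m n by simp
  then show ?thesis unfolding c_def of_nat_eq_0_iff using m by (simp add: rep_count_def)
qed

definition entries :: "(nat \<times> nat \<times> nat) set" where
  "entries = {..<K} \<times> {..<n} \<times> {..<n}"

text \<open>The matrix to which \<open>orthogonal_complete\<close> is applied: the row of
  \<open>J\<close> lists the entries of the image of the monomial in all blocks.\<close>

definition Q :: "(nat \<Rightarrow> nat) \<Rightarrow> nat \<times> nat \<times> nat \<Rightarrow> complex" where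
  "Q J = (\<lambda>(i, a, b). M i J $$ (a, b))"

lemma Q_orthogonal:
  assumes "J \<in> MI" "J' \<in> MI"
  shows "(\<Sum>y\<in>entries. cnj (Q J y) * Q J' y) = (if J = J' then c else 0)"
proof -
  have "(\<Sum>y\<in>entries. cnj (Q J y) * Q J' y) =
      (\<Sum>i<K. \<Sum>a<n. \<Sum>b<n. cnj (M i J $$ (a, b)) * M i J' $$ (a, b))"
    unfolding entries_def Q_def by (simp add: sum.cartesian_product case_prod_unfold)
  also have "\<dots> = (\<Sum>i<K. mat_trace n (mat_adjoint (M i J) * M i J'))"
  proof (rule sum.cong[OF refl])
    fix i
    have "(\<Sum>a<n. \<Sum>b<n. cnj (M i J $$ (a, b)) * M i J' $$ (a, b)) =
        (\<Sum>b<n. \<Sum>a<n. cnj (M i J $$ (a, b)) * M i J' $$ (a, b))" by (rule sum.swap)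
    also have "\<dots> = mat_trace n (mat_adjoint (M i J) * M i J')"
      using M_carrier[of i J] M_carrier[of i J']
      by (simp add: mat_trace_def scalar_prod_def atLeast0LessThan mat_adjoint_index)
    finally show "(\<Sum>a<n. \<Sum>b<n. cnj (M i J $$ (a, b)) * M i J' $$ (a, b)) =
        mat_trace n (mat_adjoint (M i J) * M i J')" .
  qed
  also have "\<dots> = (if J = J' then c else 0)"
    unfolding M_def c_def by (rule twist_orthogonal[OF sys m d assms])
  finally show ?thesis .
qed

text \<open>With d = 2 r or d = 2 r + 1 the right side is m^r m^r or m m^r m^r. The equality makes
  \<open>Q\<close> square, and this is what fixes size and number of the blocks.\<close>

lemma card_entries: "card MI = card entries"
proof -
  have "card MI = m ^ d" by (simp add: multi_indices_def card_PiE)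
  also have "\<dots> = K * (n * n)"
  proof (cases "even d")
    case True
    then obtain r where "d = 2 * r" by blast
    then show ?thesis by (simp add: rep_count_def n mult_2 power_add)
  next
    case False
    then obtain r where "d = 2 * r + 1" by (rule oddE)
    then show ?thesis by (simp add: rep_count_def n mult_2 power_add)
  qed
  finally show ?thesis by (simp add: entries_def card_cartesian_product)
qed

lemma finite_entries: "finite entries" by (simp add: entries_def)

lemma Q_complete:
  "\<lbrakk>y \<in> entries; y' \<in> entries\<rbrakk> \<Longrightarrow> (\<Sum>J\<in>MI. Q J y * cnj (Q J y')) = (if y = y' then c else 0)"
  by (rule orthogonal_complete[OF finite_multi_indices finite_entries card_entries c_nonzero Q_orthogonal])

definition ent :: "(nat list \<Rightarrow> complex) set \<Rightarrow> nat \<times> nat \<times> nat \<Rightarrow> complex" where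
  "ent U = (\<lambda>(i, a, b). R i U $$ (a, b))"

text \<open>The Fourier coefficient with respect to the orthogonal images of the monomials. Being an
  explicit formula in the entries, it stands in for the description in \<open>gcliff_coeff\<close>
  until \<open>gcliff_coeff_eq\<close> identifies the two.\<close>

definition coef :: "(nat list \<Rightarrow> complex) set \<Rightarrow> (nat \<Rightarrow> nat) \<Rightarrow> complex" where
  "coef U J = (\<Sum>y\<in>entries. cnj (Q J y) * ent U y) / c"

definition lincomb :: "((nat \<Rightarrow> nat) \<Rightarrow> complex) \<Rightarrow> (nat list \<Rightarrow> complex) set" where
  "lincomb u = (\<Oplus>\<^bsub>Cl\<^esub>J\<in>MI. u J \<odot>\<^bsub>Cl\<^esub> e J)"

lemma e_carrier: "e J \<in> carrier Cl" by (rule gcliff_monomial_carrier)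

lemma smult_carrier: "U \<in> carrier Cl \<Longrightarrow> x \<odot>\<^bsub>Cl\<^esub> U \<in> carrier Cl" by (rule gcliff_smult(1))

lemma lincomb_carrier: "lincomb u \<in> carrier Cl"
  unfolding lincomb_def by (intro Cl.finsum_closed funcsetI smult_carrier e_carrier)

lemma ent_lincomb:
  assumes "y \<in> entries" shows "ent (lincomb u) y = (\<Sum>J\<in>MI. u J * Q J y)"
proof -
  obtain i a b where y: "y = (i, a, b)" "i < K" "a < n" "b < n"
    using assms by (auto simp: entries_def)
  have "ent (lincomb u) y = (\<Sum>J\<in>MI. R i (u J \<odot>\<^bsub>Cl\<^esub> e J) $$ (a, b))"
    unfolding y(1) ent_def lincomb_def prod.case
    by (rule R_finsum[OF finite_multi_indices smult_carrier[OF e_carrier] y(3,4)])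
  also have "\<dots> = (\<Sum>J\<in>MI. u J * Q J y)" using y(3,4) M_carrier[of i]
    by (intro sum.cong refl) (simp add: R_smult[OF e_carrier] R_monomial y(1) Q_def
        carrier_matD[OF M_carrier])
  finally show ?thesis .
qed

text \<open>Orthogonality of the rows of \<open>Q\<close> recovers the coefficients; this is the
  linear independence of the monomials.\<close>

lemma coef_lincomb:
  assumes "J \<in> MI" shows "coef (lincomb u) J = u J"
proof -
  have "(\<Sum>y\<in>entries. cnj (Q J y) * ent (lincomb u) y) =
      (\<Sum>y\<in>entries. \<Sum>J'\<in>MI. u J' * (cnj (Q J y) * Q J' y))"
    by (intro sum.cong refl) (simp add: ent_lincomb sum_distrib_left mult_ac)
  also have "\<dots> = (\<Sum>J'\<in>MI. u J' * (\<Sum>y\<in>entries. cnj (Q J y) * Q J' y))"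
    by (subst sum.swap) (simp add: sum_distrib_left)
  also have "\<dots> = (\<Sum>J'\<in>MI. if J = J' then u J' * c else 0)"
    using Q_orthogonal[OF assms] by (intro sum.cong refl) auto
  also have "\<dots> = u J * c" using assms finite_multi_indices by (simp add: sum.delta)
  finally show ?thesis using c_nonzero by (simp add: coef_def)
qed

lemma lincomb_cong: "(\<And>J. J \<in> MI \<Longrightarrow> u J = v J) \<Longrightarrow> lincomb u = lincomb v"
  unfolding lincomb_def by (intro Cl.finsum_cong') (auto intro: smult_carrier e_carrier)

lemma lincomb_coef:
  assumes "U \<in> carrier Cl" shows "lincomb (coef U) = U"
proof -
  obtain u where u: "U = lincomb u" using gcliff_span[OF m assms] unfolding lincomb_def by blast
  show ?thesis unfolding u by (rule lincomb_cong) (rule coef_lincomb)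
qed

text \<open>The coefficients are computed from the images alone, and they determine the element by
  \<open>lincomb_coef\<close>.\<close>

lemma R_inject:
  assumes "U \<in> carrier Cl" "V \<in> carrier Cl" "\<And>i. i < K \<Longrightarrow> R i U = R i V"
  shows "U = V"
proof -
  have "ent U y = ent V y" if "y \<in> entries" for y
    using that assms(3) by (auto simp: entries_def ent_def)
  then have "coef U = coef V" by (auto simp: coef_def fun_eq_iff intro!: sum.cong arg_cong[of _ _ "\<lambda>x. x / c"])
  then show ?thesis using lincomb_coef assms(1,2) by metis
qed

text \<open>The preimage is the combination whose coefficients are the Fourier coefficients of the
  prescribed entries; orthogonality of the columns of \<open>Q\<close> shows that it has these
  entries.\<close>

lemma R_surj:
  assumes A: "\<And>i. i < K \<Longrightarrow> A i \<in> carrier_mat n n"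
  shows "\<exists>U\<in>carrier Cl. \<forall>i<K. R i U = A i"
proof -
  define f where "f = (\<lambda>(i, a, b). A i $$ (a, b))"
  define u where "u J = (\<Sum>y\<in>entries. cnj (Q J y) * f y) / c" for J
  have f: "ent (lincomb u) y = f y" if y: "y \<in> entries" for y
  proof -
    have "ent (lincomb u) y = (\<Sum>J\<in>MI. \<Sum>y'\<in>entries. f y' * (Q J y * cnj (Q J y')) / c)"
      unfolding ent_lincomb[OF y] u_def
      by (intro sum.cong refl) (simp add: sum_divide_distrib sum_distrib_left mult_ac)
    also have "\<dots> = (\<Sum>y'\<in>entries. f y' * (\<Sum>J\<in>MI. Q J y * cnj (Q J y')) / c)"
      by (subst sum.swap) (simp add: sum_divide_distrib sum_distrib_left)
    also have "\<dots> = (\<Sum>y'\<in>entries. if y = y' then f y' else 0)"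
      using Q_complete[OF y] c_nonzero by (intro sum.cong refl) auto
    also have "\<dots> = f y" using y finite_entries by (simp add: sum.delta)
    finally show ?thesis .
  qed
  have "R i (lincomb u) = A i" if "i < K" for i
  proof (rule eq_matI)
    fix a b assume "a < dim_row (A i)" "b < dim_col (A i)"
    then have "(i, a, b) \<in> entries" using A[OF that] that by (auto simp: entries_def)
    from f[OF this] show "R i (lincomb u) $$ (a, b) = A i $$ (a, b)" by (simp add: ent_def f_def)
  qed (use A[OF that] in auto)
  then show ?thesis using lincomb_carrier by blast
qed

text \<open>Existence for the definite description is \<open>lincomb_coef\<close>, uniqueness on the
  index set is \<open>coef_lincomb\<close>, and outside it extensionality fixes the value.\<close>

lemma gcliff_coeff_eq:
  assumes U: "U \<in> carrier Cl" shows "gcliff_coeff m d U = (\<lambda>J\<in>MI. coef U J)"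
  unfolding gcliff_coeff_def lincomb_def[symmetric]
proof (rule the_equality)
  have "lincomb (\<lambda>J\<in>MI. coef U J) = lincomb (coef U)" by (rule lincomb_cong) simp
  then show "(\<lambda>J\<in>MI. coef U J) \<in> MI \<rightarrow>\<^sub>E UNIV \<and> U = lincomb (\<lambda>J\<in>MI. coef U J)"
    using lincomb_coef[OF U] by simp
  fix u assume u: "u \<in> MI \<rightarrow>\<^sub>E UNIV \<and> U = lincomb u"
  show "u = (\<lambda>J\<in>MI. coef U J)"
  proof
    fix J show "u J = (\<lambda>J\<in>MI. coef U J) J"
      using u coef_lincomb[of J u] by (cases "J \<in> MI") (auto simp: PiE_iff extensional_def)
  qed
qed

lemma R_minus:
  assumes "U \<in> carrier Cl" shows "R i (\<ominus>\<^bsub>Cl\<^esub> U) = - R i U"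
proof -
  have "R i (\<ominus>\<^bsub>Cl\<^esub> U) + R i U = 0\<^sub>m n n"
    using R_hom(1)[of "\<ominus>\<^bsub>Cl\<^esub> U" U i] assms by (simp add: Cl.l_neg R_zero)
  then have s: "(R i (\<ominus>\<^bsub>Cl\<^esub> U) + R i U) $$ (a, b) = 0" if "a < n" "b < n" for a b using that by simp
  show ?thesis
  proof (rule eq_matI)
    fix a b assume "a < dim_row (- R i U)" "b < dim_col (- R i U)"
    then have "a < n" "b < n" by auto
    then show "R i (\<ominus>\<^bsub>Cl\<^esub> U) $$ (a, b) = (- R i U) $$ (a, b)"
      using s[of a b] by (simp add: eq_neg_iff_add_eq_0)
  qed auto
qed

text \<open>Blockwise left inverses come from one element by \<open>R_surj\<close>; for square
  matrices they are also right inverses, and \<open>R_inject\<close> carries both identities back to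
  the algebra.\<close>

lemma inv_char:
  assumes U: "U \<in> carrier Cl" and B: "\<And>i. i < K \<Longrightarrow> B i \<in> carrier_mat n n"
    and BU: "\<And>i. i < K \<Longrightarrow> B i * R i U = 1\<^sub>m n"
  shows "U \<in> Units Cl" "i < K \<Longrightarrow> R i (inv\<^bsub>Cl\<^esub> U) = B i"
proof -
  have "\<exists>V\<in>carrier Cl. \<forall>i<K. R i V = B i" by (rule R_surj) (rule B)
  then obtain V where V: "V \<in> carrier Cl" "\<And>i. i < K \<Longrightarrow> R i V = B i" by auto
  have UB: "R i U * B i = 1\<^sub>m n" if "i < K" for i
    by (rule mat_mult_left_right_inverse[OF B[OF that] R_carrier BU[OF that]])
  have VU: "V \<otimes>\<^bsub>Cl\<^esub> U = \<one>\<^bsub>Cl\<^esub>"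
  proof (rule R_inject)
    fix i assume i: "i < K"
    show "R i (V \<otimes>\<^bsub>Cl\<^esub> U) = R i \<one>\<^bsub>Cl\<^esub>"
      unfolding R_hom(2)[OF V(1) U] V(2)[OF i] R_one by (rule BU[OF i])
  qed (intro Cl.m_closed Cl.one_closed V(1) U)+
  have UV: "U \<otimes>\<^bsub>Cl\<^esub> V = \<one>\<^bsub>Cl\<^esub>"
  proof (rule R_inject)
    fix i assume i: "i < K"
    show "R i (U \<otimes>\<^bsub>Cl\<^esub> V) = R i \<one>\<^bsub>Cl\<^esub>"
      unfolding R_hom(2)[OF U V(1)] V(2)[OF i] R_one by (rule UB[OF i])
  qed (intro Cl.m_closed Cl.one_closed V(1) U)+
  show "U \<in> Units Cl" using U V(1) VU UV unfolding Units_def by blast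
  have "inv\<^bsub>Cl\<^esub> U = V" using Cl.inv_unique'[OF U V(1) UV VU] by (rule sym)
  then show "i < K \<Longrightarrow> R i (inv\<^bsub>Cl\<^esub> U) = B i" using V(2) by simp
qed

text \<open>The inverses in the definition are meaningful only once the monomials are known to be
  units; the adjoints of their unitary images provide the blockwise inverses.\<close>

lemma gcliff_conj_carrier: "U \<in> carrier Cl \<Longrightarrow> gcliff_conj m d U \<in> carrier Cl"
proof -
  have "e J \<in> Units Cl" for J
    by (rule inv_char(1)[OF e_carrier, where B = "\<lambda>i. mat_adjoint (M i J)"])
      (simp_all only: M_adjoint R_monomial)
  then show ?thesis
    unfolding gcliff_conj_def by (intro Cl.finsum_closed funcsetI smult_carrier Cl.Units_inv_closed)
qed

lemma R_conj:
  assumes U: "U \<in> carrier Cl" and i: "i < K"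
  shows "R i (gcliff_conj m d U) = mat_adjoint (R i U)"
proof -
  have u: "e J \<in> Units Cl" "R i (inv\<^bsub>Cl\<^esub> (e J)) = mat_adjoint (M i J)" for J
    using inv_char[OF e_carrier[of J], where B = "\<lambda>i. mat_adjoint (M i J)"] i
    by (simp_all only: M_adjoint R_monomial simp_thms)
  show ?thesis
  proof (rule eq_matI)
    fix a b assume "a < dim_row (mat_adjoint (R i U))" "b < dim_col (mat_adjoint (R i U))"
    then have ab: "a < n" "b < n" by auto
    have "R i (gcliff_conj m d U) $$ (a, b) =
        (\<Sum>J\<in>MI. R i (cnj (gcliff_coeff m d U J) \<odot>\<^bsub>Cl\<^esub> inv\<^bsub>Cl\<^esub> (e J)) $$ (a, b))"
      unfolding gcliff_conj_def
      by (rule R_finsum[OF finite_multi_indices smult_carrier[OF Cl.Units_inv_closed[OF u(1)]] ab])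
    also have "\<dots> = (\<Sum>J\<in>MI. cnj (coef U J * Q J (i, b, a)))"
    proof (rule sum.cong[OF refl])
      fix J assume J: "J \<in> MI"
      have ic: "inv\<^bsub>Cl\<^esub> (e J) \<in> carrier Cl" by (rule Cl.Units_inv_closed[OF u(1)])
      show "R i (cnj (gcliff_coeff m d U J) \<odot>\<^bsub>Cl\<^esub> inv\<^bsub>Cl\<^esub> (e J)) $$ (a, b) = cnj (coef U J * Q J (i, b, a))"
        unfolding R_smult[OF ic] u(2) gcliff_coeff_eq[OF U]
        using J ab carrier_matD[OF M_carrier[of i J]] by (simp add: mat_adjoint_index Q_def)
    qed
    also have "\<dots> = cnj (ent (lincomb (coef U)) (i, b, a))"
      using ab i by (subst ent_lincomb) (auto simp: entries_def)
    also have "\<dots> = mat_adjoint (R i U) $$ (a, b)"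
      unfolding lincomb_coef[OF U] using ab by (simp add: ent_def mat_adjoint_index)
    finally show "R i (gcliff_conj m d U) $$ (a, b) = mat_adjoint (R i U) $$ (a, b)" .
  qed auto
qed

lemma inv_adj_mat:
  assumes A: "A \<in> carrier_mat n n" and "det A \<noteq> (0 :: complex)"
  shows "(inverse (det A) \<cdot>\<^sub>m adj_mat A) * A = 1\<^sub>m n" "inverse (det A) \<cdot>\<^sub>m adj_mat A \<in> carrier_mat n n"
proof -
  have "(inverse (det A) \<cdot>\<^sub>m adj_mat A) * A = inverse (det A) \<cdot>\<^sub>m (adj_mat A * A)"
    by (rule mult_smult_assoc_mat[OF adj_mat(1)[OF A] A])
  also have "\<dots> = 1\<^sub>m n" unfolding adj_mat(3)[OF A] using assms(2) by (intro eq_matI) auto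
  finally show "(inverse (det A) \<cdot>\<^sub>m adj_mat A) * A = 1\<^sub>m n" .
  show "inverse (det A) \<cdot>\<^sub>m adj_mat A \<in> carrier_mat n n" using adj_mat(1)[OF A] by simp
qed

lemma Units_iff:
  assumes U: "U \<in> carrier Cl" shows "U \<in> Units Cl \<longleftrightarrow> (\<forall>i<K. det (R i U) \<noteq> 0)"
proof
  assume u: "U \<in> Units Cl"
  show "\<forall>i<K. det (R i U) \<noteq> 0"
  proof (intro allI impI)
    fix i
    have "R i (inv\<^bsub>Cl\<^esub> U) * R i U = 1\<^sub>m n"
      unfolding R_hom(2)[OF Cl.Units_inv_closed[OF u] U, symmetric] Cl.Units_l_inv[OF u] by (rule R_one)
    then have "det (R i (inv\<^bsub>Cl\<^esub> U)) * det (R i U) = 1"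
      unfolding det_mult[OF R_carrier R_carrier, symmetric] by (simp only: det_one)
    then show "det (R i U) \<noteq> 0" by auto
  qed
next
  assume "\<forall>i<K. det (R i U) \<noteq> 0"
  then have "det (R i U) \<noteq> 0" if "i < K" for i using that by blast
  note inv = inv_adj_mat[OF R_carrier this]
  show "U \<in> Units Cl"
    by (rule inv_char(1)[OF U, where B = "\<lambda>i. inverse (det (R i U)) \<cdot>\<^sub>m adj_mat (R i U)"])
      (erule inv(2), erule inv(1))
qed

text \<open>Cramer's rule in each block, the form in which inversion is seen to be
  continuous.\<close>

lemma R_inv:
  assumes U: "U \<in> Units Cl" and i: "i < K"
  shows "R i (inv\<^bsub>Cl\<^esub> U) = inverse (det (R i U)) \<cdot>\<^sub>m adj_mat (R i U)"
proof -
  have "det (R i U) \<noteq> 0" if "i < K" for i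
    using Units_iff[OF Cl.Units_closed[OF U]] U that by blast
  note inv = inv_adj_mat[OF R_carrier this]
  show ?thesis
    by (rule inv_char(2)[OF Cl.Units_closed[OF U], where B = "\<lambda>i. inverse (det (R i U)) \<cdot>\<^sub>m adj_mat (R i U)"])
      (erule inv(2), erule inv(1), rule i)
qed

section \<open>The coordinate topology and the star algebra axioms\<close>

abbreviation "G \<equiv> gcliff_real m d"

lemma G_simps:
  "carrier G = carrier Cl" "monoid.mult G = monoid.mult Cl" "one G = one Cl" "zero G = zero Cl"
  "add G = add Cl" "module.smult G = (\<lambda>r U. complex_of_real r \<odot>\<^bsub>Cl\<^esub> U)"
  "topo G = pullback_topology (carrier Cl) (gcliff_coeff m d) euclidean"
  by (simp_all add: gcliff_real_def Let_def)

lemma G_inverse_simps: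
  "a_inv G = a_inv Cl" "a_minus G = a_minus Cl" "m_inv G = m_inv Cl" "Units G = Units Cl"
  by (simp_all add: fun_eq_iff a_inv_def a_minus_def m_inv_def Units_def G_simps)

lemma topspace_G: "topspace (topo G) = carrier Cl"
  by (simp add: G_simps topspace_pullback_topology)

lemma continuous_R:
  assumes "i < K" "a < n" "b < n"
  shows "continuous_map (topo G) euclidean (\<lambda>U. R i U $$ (a, b))"
proof -
  have y: "(i, a, b) \<in> entries" using assms by (simp add: entries_def)
  have "continuous_map (topo G) euclidean (\<lambda>U. gcliff_coeff m d U J)" for J
  proof -
    have "continuous_map euclidean euclidean (\<lambda>u :: (nat \<Rightarrow> nat) \<Rightarrow> complex. u J)"
      using continuous_map_product_projection[of J UNIV "\<lambda>_. euclidean"]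
      by (simp add: euclidean_product_topology)
    from continuous_map_pullback[OF this, of "carrier Cl" "gcliff_coeff m d"]
    show ?thesis by (simp add: G_simps comp_def)
  qed
  then have "continuous_map (topo G) euclidean (\<lambda>U. \<Sum>J\<in>MI. gcliff_coeff m d U J * Q J (i, a, b))"
    by (intro continuous_map_complex_sum continuous_map_complex(2)) simp_all
  moreover have "(\<Sum>J\<in>MI. gcliff_coeff m d U J * Q J (i, a, b)) = R i U $$ (a, b)" if "U \<in> topspace (topo G)" for U
  proof -
    have U: "U \<in> carrier Cl" using that by (simp only: topspace_G)
    have "R i U $$ (a, b) = ent (lincomb (coef U)) (i, a, b)" by (simp add: lincomb_coef[OF U] ent_def)
    also have "\<dots> = (\<Sum>J\<in>MI. coef U J * Q J (i, a, b))" by (rule ent_lincomb[OF y])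
    finally show ?thesis by (simp add: gcliff_coeff_eq[OF U])
  qed
  ultimately show ?thesis by (rule continuous_map_eq)
qed

text \<open>Together with \<open>continuous_R\<close> this says that the topology read off in
  monomial coordinates is also the one read off in the matrix entries, where product, adjoint and
  inverse have explicit formulas.\<close>

lemma continuous_into_G:
  assumes f: "\<And>x. x \<in> topspace X \<Longrightarrow> f x \<in> carrier Cl"
    and R: "\<And>i a b. \<lbrakk>i < K; a < n; b < n\<rbrakk> \<Longrightarrow> continuous_map X euclidean (\<lambda>x. R i (f x) $$ (a, b))"
  shows "continuous_map X (topo G) f" unfolding G_simps
proof (rule continuous_map_pullback')
  show "topspace X \<subseteq> f -` carrier Cl" using f by blast
  have "continuous_map X euclidean (\<lambda>x. gcliff_coeff m d (f x) J)" for J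
  proof -
    \<comment> \<open>The ambient function space has a coordinate for every J, not only for
      multi-indices; on the others the coefficient function is constantly
      \<open>undefined\<close>.\<close>
    have "continuous_map X euclidean (\<lambda>x. if J \<in> MI then coef (f x) J else undefined)"
    proof (cases "J \<in> MI")
      case True
      have "continuous_map X euclidean (\<lambda>x. \<Sum>y\<in>entries. cnj (Q J y) * ent (f x) y)"
        by (intro continuous_map_complex_sum continuous_map_complex(2))
          (auto simp: entries_def ent_def intro: R)
      from continuous_map_complex(2)[OF this, of "\<lambda>_. inverse c"] True show ?thesis
        by (simp add: coef_def divide_inverse)
    qed simp
    then show ?thesis by (rule continuous_map_eq) (simp add: gcliff_coeff_eq[OF f])
  qed
  then have "continuous_map X (product_topology (\<lambda>_. euclidean) UNIV) (gcliff_coeff m d \<circ> f)"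
    unfolding continuous_map_componentwise_UNIV by simp
  then show "continuous_map X euclidean (gcliff_coeff m d \<circ> f)"
    by (simp only: euclidean_product_topology)
qed

lemma continuous_R_comp:
  assumes "continuous_map X (topo G) f" "i < K" "a < n" "b < n"
  shows "continuous_map X euclidean (\<lambda>x. R i (f x) $$ (a, b))"
  using continuous_map_compose[OF assms(1) continuous_R[OF assms(2-4)]] by (simp add: comp_def)

lemma Hausdorff_G: "Hausdorff_space (topo G)"
proof (rule Hausdorff_space_injective_preimage)
  show "Hausdorff_space (euclidean :: ((nat \<Rightarrow> nat) \<Rightarrow> complex) topology)"
    by (simp add: Hausdorff_space_product_topology flip: euclidean_product_topology)
  show "continuous_map (topo G) euclidean (gcliff_coeff m d)"
    using continuous_map_pullback[OF continuous_map_id, of "carrier Cl" "gcliff_coeff m d"]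
    by (simp add: G_simps)
  show "inj_on (gcliff_coeff m d) (topspace (topo G))"
  proof (rule inj_onI)
    fix U V assume "U \<in> topspace (topo G)" "V \<in> topspace (topo G)" and e: "gcliff_coeff m d U = gcliff_coeff m d V"
    then have UV: "U \<in> carrier Cl" "V \<in> carrier Cl" by (simp_all only: topspace_G)
    have "coef U J = coef V J" if "J \<in> MI" for J
      using fun_cong[OF e, of J] that by (simp add: gcliff_coeff_eq UV)
    then have "lincomb (coef U) = lincomb (coef V)" by (rule lincomb_cong)
    then show "U = V" by (simp add: lincomb_coef UV)
  qed
qed

lemma mult_entry: "\<lbrakk>A \<in> carrier_mat n n; B \<in> carrier_mat n n; a < n; b < n\<rbrakk>
    \<Longrightarrow> (A * B) $$ (a, b) = (\<Sum>k<n. A $$ (a, k) * B $$ (k, b) :: complex)"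
  by (simp add: scalar_prod_def atLeast0LessThan)

lemma R_conj_eqI:
  assumes "U \<in> carrier Cl" "V \<in> carrier Cl" "\<And>i. i < K \<Longrightarrow> mat_adjoint (R i U) = R i V"
  shows "gcliff_conj m d U = V"
  by (rule R_inject) (use assms in \<open>simp_all add: gcliff_conj_carrier R_conj\<close>)

lemma star_algebra: "topological_star_algebra G (gcliff_conj m d)"
proof (intro topological_star_algebra.intro topological_star_algebra_axioms.intro)
  show "ring G" by (rule ring_cong[OF gcliff_ring]) (simp_all add: G_simps)
  show "topspace (topo G) = carrier G" unfolding G_simps(1) by (rule topspace_G)
  show "Hausdorff_space (topo G)" by (rule Hausdorff_G)
  let ?P = "prod_topology (topo G) (topo G)"
  have P: "fst z \<in> carrier Cl" "snd z \<in> carrier Cl" if "z \<in> topspace ?P" for z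
    using that by (auto simp: topspace_G)
  have entP: "continuous_map ?P euclidean (\<lambda>z. R i (fst z) $$ (a, b))"
    "continuous_map ?P euclidean (\<lambda>z. R i (snd z) $$ (a, b))" if "i < K" "a < n" "b < n" for i a b
    by (rule continuous_R_comp[OF continuous_map_fst that] continuous_R_comp[OF continuous_map_snd that])+
  show "continuous_map ?P (topo G) (\<lambda>(x, y). x \<oplus>\<^bsub>G\<^esub> y)" unfolding case_prod_unfold G_simps(5)
  proof (rule continuous_into_G)
    fix i a b assume i: "i < K" "a < n" "b < n"
    have "continuous_map ?P euclidean (\<lambda>z. R i (fst z) $$ (a, b) + R i (snd z) $$ (a, b))"
      by (rule continuous_map_complex(1)[OF entP[OF i]])
    then show "continuous_map ?P euclidean (\<lambda>z. R i (fst z \<oplus>\<^bsub>Cl\<^esub> snd z) $$ (a, b))"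
      by (rule continuous_map_eq) (use P i in \<open>simp add: R_hom(1)\<close>)
  qed (use P in simp)
  show "continuous_map ?P (topo G) (\<lambda>(x, y). x \<otimes>\<^bsub>G\<^esub> y)" unfolding case_prod_unfold G_simps(2)
  proof (rule continuous_into_G)
    fix i a b assume i: "i < K" "a < n" "b < n"
    have "continuous_map ?P euclidean (\<lambda>z. \<Sum>k<n. R i (fst z) $$ (a, k) * R i (snd z) $$ (k, b))"
      using i by (intro continuous_map_complex_sum continuous_map_complex(2) entP) auto
    then show "continuous_map ?P euclidean (\<lambda>z. R i (fst z \<otimes>\<^bsub>Cl\<^esub> snd z) $$ (a, b))"
      by (rule continuous_map_eq) (use P i in \<open>simp only: R_hom(2) mult_entry[OF R_carrier R_carrier]\<close>)
  qed (use P in simp)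
  let ?S = "prod_topology euclideanreal (topo G)"
  have S: "snd z \<in> carrier Cl" if "z \<in> topspace ?S" for z using that by (auto simp: topspace_G)
  show "continuous_map ?S (topo G) (\<lambda>(r, x). r \<odot>\<^bsub>G\<^esub> x)" unfolding case_prod_unfold G_simps(6)
  proof (rule continuous_into_G)
    fix i a b assume i: "i < K" "a < n" "b < n"
    have "continuous_map ?S euclidean (\<lambda>z. complex_of_real (fst z))"
      using continuous_map_fst[of euclideanreal "topo G"] by (simp add: continuous_map_atin tendsto_of_real)
    moreover have "continuous_map ?S euclidean (\<lambda>z. R i (snd z) $$ (a, b))"
      by (rule continuous_R_comp[OF continuous_map_snd i])
    ultimately have "continuous_map ?S euclidean (\<lambda>z. complex_of_real (fst z) * R i (snd z) $$ (a, b))"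
      by (rule continuous_map_complex(2))
    then show "continuous_map ?S euclidean (\<lambda>z. R i (complex_of_real (fst z) \<odot>\<^bsub>Cl\<^esub> snd z) $$ (a, b))"
      by (rule continuous_map_eq) (use S i in \<open>simp add: R_smult\<close>)
  qed (use S smult_carrier in simp)
  have cdet: "continuous_map X euclidean (\<lambda>x. det (R i (f x)))"
    if "continuous_map X (topo G) f" "i < K" for X f i
    using that by (intro continuous_map_det[OF R_carrier] continuous_R_comp)
  \<comment> \<open>By \<open>Units_iff\<close> an element is a unit exactly where the product of
    all block determinants is nonzero, which is an open condition.\<close>
  have "continuous_map (topo G) euclidean (\<lambda>U. \<Prod>i<K. det (R i U))"
    by (rule continuous_map_complex_prod, rule cdet) auto
  from openin_continuous_map_preimage[OF this, of "- {0}"]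
  have "openin (topo G) {U \<in> carrier Cl. (\<Prod>i<K. det (R i U)) \<in> - {0}}"
    by (simp add: topspace_G open_Compl)
  also have "{U \<in> carrier Cl. (\<Prod>i<K. det (R i U)) \<in> - {0}} = Units G"
    unfolding G_inverse_simps using Units_iff Cl.Units_closed by auto
  finally show "openin (topo G) (Units G)" .
  let ?U = "subtopology (topo G) (Units Cl)"
  have U: "x \<in> Units Cl" if "x \<in> topspace ?U" for x using that by simp
  have cU: "continuous_map ?U (topo G) (\<lambda>x. x)" by (rule continuous_map_from_subtopology) simp
  show "continuous_map (subtopology (topo G) (Units G)) (topo G) (\<lambda>x. inv\<^bsub>G\<^esub> x)"
    unfolding G_inverse_simps
  proof (rule continuous_into_G)
    fix i a b assume i: "i < K" "a < n" "b < n"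
    have "continuous_map ?U euclidean (\<lambda>x. inverse (det (R i x)) * adj_mat (R i x) $$ (a, b))"
    proof (intro continuous_map_complex(2) continuous_map_complex_inverse cdet[OF cU i(1)])
      show "det (R i x) \<noteq> 0" if "x \<in> topspace ?U" for x
        using U[OF that] Units_iff[OF Cl.Units_closed] i(1) by blast
      show "continuous_map ?U euclidean (\<lambda>x. adj_mat (R i x) $$ (a, b))"
        by (rule continuous_map_adj_mat[OF R_carrier continuous_R_comp[OF cU i(1)] i(2,3)])
    qed
    then show "continuous_map ?U euclidean (\<lambda>x. R i (inv\<^bsub>Cl\<^esub> x) $$ (a, b))"
    proof (rule continuous_map_eq)
      fix x assume x: "x \<in> topspace ?U"
      show "inverse (det (R i x)) * adj_mat (R i x) $$ (a, b) = R i (inv\<^bsub>Cl\<^esub> x) $$ (a, b)"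
        unfolding R_inv[OF U[OF x] i(1)] using i adj_mat(1)[OF R_carrier, of i x] by auto
    qed
  qed (use U in auto)
  show "continuous_map (topo G) (topo G) (gcliff_conj m d)"
  proof (rule continuous_into_G)
    fix i a b assume i: "i < K" "a < n" "b < n"
    have "continuous_map (topo G) euclidean (\<lambda>U. cnj (R i U $$ (b, a)))"
      by (rule continuous_map_cnj[OF continuous_R[OF i(1,3,2)]])
    then show "continuous_map (topo G) euclidean (\<lambda>U. R i (gcliff_conj m d U) $$ (a, b))"
      by (rule continuous_map_eq) (use i in \<open>simp add: topspace_G R_conj mat_adjoint_index\<close>)
  qed (simp add: topspace_G gcliff_conj_carrier)
next
  fix x assume "x \<in> carrier G"
  then have x: "x \<in> carrier Cl" by (simp only: G_simps)
  fix r s :: real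
  show "r \<odot>\<^bsub>G\<^esub> x \<in> carrier G" "gcliff_conj m d x \<in> carrier G"
    using x by (simp_all add: G_simps smult_carrier gcliff_conj_carrier)
  show "(r + s) \<odot>\<^bsub>G\<^esub> x = r \<odot>\<^bsub>G\<^esub> x \<oplus>\<^bsub>G\<^esub> s \<odot>\<^bsub>G\<^esub> x" "r \<odot>\<^bsub>G\<^esub> (s \<odot>\<^bsub>G\<^esub> x) = (r * s) \<odot>\<^bsub>G\<^esub> x"
    "1 \<odot>\<^bsub>G\<^esub> x = x" using gcliff_smult(2-4)[OF x x] by (simp_all add: G_simps)
  show "gcliff_conj m d (r \<odot>\<^bsub>G\<^esub> x) = r \<odot>\<^bsub>G\<^esub> gcliff_conj m d x" unfolding G_simps
    by (rule R_conj_eqI)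
      (use x in \<open>simp_all add: smult_carrier gcliff_conj_carrier R_smult
        R_conj mat_adjoint_smult\<close>)
  show "gcliff_conj m d (gcliff_conj m d x) = x"
    by (rule R_conj_eqI) (use x in \<open>simp_all add: gcliff_conj_carrier R_conj mat_adjoint_adjoint\<close>)
  show "x \<otimes>\<^bsub>G\<^esub> gcliff_conj m d x = \<one>\<^bsub>G\<^esub>" if "gcliff_conj m d x \<otimes>\<^bsub>G\<^esub> x = \<one>\<^bsub>G\<^esub>" unfolding G_simps
  proof (rule R_inject)
    fix i assume i: "i < K"
    have "mat_adjoint (R i x) * R i x = 1\<^sub>m n"
      using arg_cong[OF that[unfolded G_simps], of "R i"] x i
      by (simp only: R_hom(2)[OF gcliff_conj_carrier[OF x] x] R_conj R_one)
    then have "R i x * mat_adjoint (R i x) = 1\<^sub>m n"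
      by (rule mat_mult_left_right_inverse[OF mat_adjoint_carrier[OF R_carrier] R_carrier])
    then show "R i (x \<otimes>\<^bsub>Cl\<^esub> gcliff_conj m d x) = R i \<one>\<^bsub>Cl\<^esub>"
      using x i by (simp only: R_hom(2)[OF x gcliff_conj_carrier[OF x]] R_conj R_one)
  qed (use x gcliff_conj_carrier in auto)
  show "\<one>\<^bsub>G\<^esub> \<oplus>\<^bsub>G\<^esub> x \<in> Units G" if "gcliff_conj m d x = \<ominus>\<^bsub>G\<^esub> x"
  proof -
    have "det (R i (\<one>\<^bsub>Cl\<^esub> \<oplus>\<^bsub>Cl\<^esub> x)) \<noteq> 0" if i: "i < K" for i
    proof -
      have "mat_adjoint (R i x) = - R i x"
        using \<open>gcliff_conj m d x = \<ominus>\<^bsub>G\<^esub> x\<close> R_conj[OF x i] R_minus[OF x] by (simp add: G_inverse_simps)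
      from det_one_plus_skew[OF R_carrier this] show ?thesis
        by (simp only: R_hom(1)[OF Cl.one_closed x] R_one not_False_eq_True)
    qed
    then show ?thesis
      unfolding G_simps G_inverse_simps using Units_iff[of "\<one>\<^bsub>Cl\<^esub> \<oplus>\<^bsub>Cl\<^esub> x"] x by simp
  qed
  fix y assume "y \<in> carrier G"
  then have y: "y \<in> carrier Cl" by (simp only: G_simps)
  show "r \<odot>\<^bsub>G\<^esub> (x \<oplus>\<^bsub>G\<^esub> y) = r \<odot>\<^bsub>G\<^esub> x \<oplus>\<^bsub>G\<^esub> r \<odot>\<^bsub>G\<^esub> y"
    "(r \<odot>\<^bsub>G\<^esub> x) \<otimes>\<^bsub>G\<^esub> y = r \<odot>\<^bsub>G\<^esub> (x \<otimes>\<^bsub>G\<^esub> y)" "x \<otimes>\<^bsub>G\<^esub> (r \<odot>\<^bsub>G\<^esub> y) = r \<odot>\<^bsub>G\<^esub> (x \<otimes>\<^bsub>G\<^esub> y)"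
    unfolding G_simps by (rule gcliff_smult(5-7)[OF x y])+
  have adj_add: "mat_adjoint (A + B) = mat_adjoint A + mat_adjoint B"
    if "A \<in> carrier_mat n n" "B \<in> carrier_mat n n" for A B :: "complex mat"
    using that by (intro eq_matI) (auto simp: mat_adjoint_index)
  show "gcliff_conj m d (x \<oplus>\<^bsub>G\<^esub> y) = gcliff_conj m d x \<oplus>\<^bsub>G\<^esub> gcliff_conj m d y" unfolding G_simps
    by (rule R_conj_eqI)
      (use x y in \<open>simp_all add: gcliff_conj_carrier R_hom(1) R_conj adj_add[OF R_carrier R_carrier]\<close>)
  show "gcliff_conj m d (x \<otimes>\<^bsub>G\<^esub> y) = gcliff_conj m d y \<otimes>\<^bsub>G\<^esub> gcliff_conj m d x" unfolding G_simps
    by (rule R_conj_eqI)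
      (use x y in \<open>simp_all add: gcliff_conj_carrier R_hom(2) R_conj mat_adjoint_mult[OF R_carrier R_carrier]\<close>)
qed

section \<open>The isomorphism with the matrix Lie algebras\<close>

lemma uCl_simps:
  "carrier (uCl m d) = {U \<in> carrier Cl. gcliff_conj m d U = \<ominus>\<^bsub>Cl\<^esub> U}"
  "zero (uCl m d) = zero Cl" "add (uCl m d) = add Cl"
  "module.smult (uCl m d) = (\<lambda>r U. complex_of_real r \<odot>\<^bsub>Cl\<^esub> U)"
  "bracket (uCl m d) = (\<lambda>U V. U \<otimes>\<^bsub>Cl\<^esub> V \<ominus>\<^bsub>Cl\<^esub> V \<otimes>\<^bsub>Cl\<^esub> U)" by (simp_all add: uCl_def Let_def)

lemma uCl_iff:
  "U \<in> carrier Cl \<Longrightarrow> U \<in> carrier (uCl m d) \<longleftrightarrow> (\<forall>i<K. R i U \<in> carrier (u_matrix n))"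
proof -
  assume U: "U \<in> carrier Cl"
  have "gcliff_conj m d U = \<ominus>\<^bsub>Cl\<^esub> U \<longleftrightarrow> (\<forall>i<K. mat_adjoint (R i U) = - R i U)"
  proof
    assume "gcliff_conj m d U = \<ominus>\<^bsub>Cl\<^esub> U"
    then show "\<forall>i<K. mat_adjoint (R i U) = - R i U" using R_conj[OF U] R_minus[OF U] by metis
  next
    assume "\<forall>i<K. mat_adjoint (R i U) = - R i U"
    then show "gcliff_conj m d U = \<ominus>\<^bsub>Cl\<^esub> U" using U by (intro R_conj_eqI) (simp_all add: R_minus)
  qed
  then show ?thesis using U by (simp add: uCl_simps u_matrix_def R_carrier)
qed

lemma uCl_carrier: "U \<in> carrier (uCl m d) \<Longrightarrow> U \<in> carrier Cl" by (simp add: uCl_simps)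

lemma R_lie:
  assumes "U \<in> carrier Cl" "V \<in> carrier Cl"
  shows "R i (U \<oplus>\<^bsub>uCl m d\<^esub> V) = R i U \<oplus>\<^bsub>u_matrix n\<^esub> R i V"
    "R i (bracket (uCl m d) U V) = bracket (u_matrix n) (R i U) (R i V)"
proof -
  show "R i (U \<oplus>\<^bsub>uCl m d\<^esub> V) = R i U \<oplus>\<^bsub>u_matrix n\<^esub> R i V"
    using R_hom(1)[OF assms] by (simp add: uCl_simps u_matrix_def)
  have "R i (U \<otimes>\<^bsub>Cl\<^esub> V \<ominus>\<^bsub>Cl\<^esub> V \<otimes>\<^bsub>Cl\<^esub> U) = R i U * R i V + - (R i V * R i U)"
    using assms by (simp only: a_minus_def R_hom(1,2) R_minus Cl.m_closed Cl.a_inv_closed)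
  also have "\<dots> = R i U * R i V - R i V * R i U" by (intro eq_matI) auto
  finally show "R i (bracket (uCl m d) U V) = bracket (u_matrix n) (R i U) (R i V)"
    by (simp add: uCl_simps u_matrix_def)
qed

lemma R_lie_smult: "U \<in> carrier Cl \<Longrightarrow> R i (r \<odot>\<^bsub>uCl m d\<^esub> U) = r \<odot>\<^bsub>u_matrix n\<^esub> R i U"
  by (simp add: R_smult uCl_simps u_matrix_def)

lemma R_bij:
  "bij_betw (\<lambda>U. \<lambda>i\<in>{0..<K}. R i U) (carrier (uCl m d)) ({0..<K} \<rightarrow>\<^sub>E carrier (u_matrix n))"
proof (rule bij_betw_imageI)
  show "inj_on (\<lambda>U. \<lambda>i\<in>{0..<K}. R i U) (carrier (uCl m d))"
  proof (rule inj_onI)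
    fix U V assume UV: "U \<in> carrier (uCl m d)" "V \<in> carrier (uCl m d)"
      and e: "(\<lambda>i\<in>{0..<K}. R i U) = (\<lambda>i\<in>{0..<K}. R i V)"
    show "U = V"
    proof (rule R_inject[OF uCl_carrier[OF UV(1)] uCl_carrier[OF UV(2)]])
      fix i assume "i < K"
      then show "R i U = R i V" using fun_cong[OF e, of i] by simp
    qed
  qed
  show "(\<lambda>U. \<lambda>i\<in>{0..<K}. R i U) ` carrier (uCl m d) = {0..<K} \<rightarrow>\<^sub>E carrier (u_matrix n)"
  proof (intro equalityI subsetI)
    fix A assume "A \<in> (\<lambda>U. \<lambda>i\<in>{0..<K}. R i U) ` carrier (uCl m d)"
    then obtain U where U: "U \<in> carrier (uCl m d)" and A: "A = (\<lambda>i\<in>{0..<K}. R i U)" by blast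
    have "\<forall>i<K. R i U \<in> carrier (u_matrix n)" using uCl_iff[OF uCl_carrier[OF U]] U by simp
    then show "A \<in> {0..<K} \<rightarrow>\<^sub>E carrier (u_matrix n)" unfolding A by simp
  next
    fix A assume A: "A \<in> {0..<K} \<rightarrow>\<^sub>E carrier (u_matrix n)"
    have Ai: "A i \<in> carrier (u_matrix n)" if "i < K" for i using PiE_mem[OF A] that by simp
    then have "A i \<in> carrier_mat n n" if "i < K" for i using that by (simp add: u_matrix_def)
    then obtain U where U: "U \<in> carrier Cl" "\<forall>i<K. R i U = A i" using R_surj by blast
    have "U \<in> carrier (uCl m d)" using uCl_iff[OF U(1)] U(2) Ai by simp
    moreover have "A = (\<lambda>i\<in>{0..<K}. R i U)"
      using A U(2) by (intro ext) (auto simp: PiE_iff extensional_def)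
    ultimately show "A \<in> (\<lambda>U. \<lambda>i\<in>{0..<K}. R i U) ` carrier (uCl m d)" by blast
  qed
qed

lemma lie_isomorphic_power: "lie_isomorphic (uCl m d) (lie_power K (u_matrix n))"
  unfolding lie_isomorphic_def
proof (intro exI conjI ballI allI)
  show "bij_betw (\<lambda>U. \<lambda>i\<in>{0..<K}. R i U) (carrier (uCl m d)) (carrier (lie_power K (u_matrix n)))"
    using R_bij by (simp add: lie_power_def)
qed (auto simp: lie_power_def R_lie R_lie_smult uCl_carrier fun_eq_iff)

text \<open>A \<open>lie_power\<close> with one factor consists of functions on a singleton, so for
  a single block the bijection \<open>R_bij\<close> is followed by evaluation at 0.\<close>

lemma lie_isomorphic_single:
  assumes "K = 1" shows "lie_isomorphic (uCl m d) (u_matrix n)" unfolding lie_isomorphic_def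
proof (intro exI conjI ballI allI)
  have "bij_betw (\<lambda>A. A 0) ({0..<1::nat} \<rightarrow>\<^sub>E carrier (u_matrix n)) (carrier (u_matrix n))"
    by (rule bij_betw_byWitness[where f' = "\<lambda>B. \<lambda>i\<in>{0..<1}. B"])
      (auto simp: PiE_iff extensional_def fun_eq_iff)
  from bij_betw_trans[OF R_bij[unfolded assms] this]
  show "bij_betw (R 0) (carrier (uCl m d)) (carrier (u_matrix n))" by (simp add: comp_def)
qed (simp_all add: R_lie R_lie_smult uCl_carrier)

end

theorem corollary6p2:
  fixes m d :: nat
  assumes "m \<ge> 2" and "d \<ge> 1"
  shows "lie_group_in (gcliff_real m d) (UCl m d) \<and>
    is_lie_algebra_of (uCl m d) (gcliff_real m d) (UCl m d) \<and>
    (even d \<longrightarrow> lie_isomorphic (uCl m d) (u_matrix (m ^ (d div 2)))) \<and>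
    (odd d \<longrightarrow> lie_isomorphic (uCl m d) (lie_power m (u_matrix (m ^ ((d - 1) div 2)))))"
proof -
  have m: "m \<ge> 1" using assms(1) by simp
  obtain E where E: "unitary_system m d (m ^ (d div 2)) E"
    using unitary_system_exists[OF m assms(2)] by blast
  interpret gcliff_model m d "m ^ (d div 2)" E by unfold_locales (use m assms(2) E in simp_all)
  interpret S: topological_star_algebra G "gcliff_conj m d" by (rule star_algebra)
  have u: "UCl m d = S.unitaries" by (simp only: UCl_def S.unitaries_def G_simps)
  have sk: "carrier (uCl m d) = S.skews"
    by (simp only: uCl_simps S.skews_def G_simps G_inverse_simps)
  have "is_lie_algebra_of (uCl m d) G S.unitaries" by (rule S.is_lie_algebra_of_skews)
      (use sk in \<open>simp_all only: uCl_simps(2-5) G_simps G_inverse_simps\<close>)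
  moreover have "odd d \<Longrightarrow> (d - 1) div 2 = d div 2" by (auto elim: oddE)
  ultimately show ?thesis
    unfolding u using S.lie_group_in_unitaries lie_isomorphic_power lie_isomorphic_single
    by (cases "even d") (simp_all add: rep_count_def)
qed

end
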